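(* Let $\mathbb{F}$ be a field. Assume access to a deterministic algorithm deciding whether two weighted graphs with $n$ vertices and weights in $\mathbb{F}$ are isomorphic in time $\mathsf{GI}(n)$. Then permutation code equivalence between two linear codes $A,B\subseteq\mathbb{F}^n$ whose hulls $A\cap A^\perp$ and $B\cap B^\perp$ have dimension $h$ can be decided deterministically in $O\big(h\, n^{\omega+h+1}\,\mathsf{GI}(n)\big)$ operations.
   Context: A linear code of length $n$ over $\mathbb{F}$ is a linear subspace of $\mathbb{F}^n$. $U^\perp$ is the orthogonal complement of $U$ with respect to the Euclidean inner product $\sum_i x_iy_i$, and the hull of $U$ is $U\cap U^\perp$. Codes $A,B$ are permutation equivalent if $B=AX=\{aX:a\in A\}$ for some $n\times n$ permutation matrix $X$. Weighted graphs with adjacency matrices $M_1,M_2$ are isomorphic if $M_2=X^TM_1X$ for some permutation matrix $X$. $\omega$ is the exponent of matrix multiplication ($2\le\omega<3$); field operations are counted at unit cost.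
   Formalization: For h = 0 the stated bound O(h n^(ω+h+1) GI(n)) would be zero, which no algorithm meets, so the factor h is read as max(1, h); it is also assumed that GI(n) ≥ 1 and n ≥ 1. *)

theory Defs
  imports "Jordan_Normal_Form.DL_Rank" "HOL-Combinatorics.Permutations"
begin

section \<open>Linear codes\<close>

definition linear_code :: "nat \<Rightarrow> 'a::field vec set \<Rightarrow> bool" where
  "linear_code n U \<longleftrightarrow> subspace class_ring U (module_vec TYPE('a) n)"

definition code_dim :: "nat \<Rightarrow> 'a::field vec set \<Rightarrow> nat" where
  "code_dim n U = vectorspace.dim class_ring ((module_vec TYPE('a) n)\<lparr>carrier := U\<rparr>)"

definition code_hull :: "nat \<Rightarrow> 'a::field vec set \<Rightarrow> 'a vec set" where
  "code_hull n U = U \<inter> vec_module.orthogonal_complement n U"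

definition generator_matrix :: "nat \<Rightarrow> 'a::field vec set \<Rightarrow> 'a mat \<Rightarrow> bool" where
  "generator_matrix n U G \<longleftrightarrow> dim_col G = n \<and> distinct (rows G) \<and>
     \<not> module.lin_dep class_ring (module_vec TYPE('a) n) (set (rows G)) \<and>
     vec_space.row_space n G = U"

definition permutation_mats :: "nat \<Rightarrow> 'a::field mat set" where
  "permutation_mats n =
     {mat n n (\<lambda>(i, j). if p i = j then 1 else 0) | p. p permutes {..<n}}"

text \<open>Codewords are row vectors, so \<open>a X\<close> is the vector \<open>X\<^sup>T *\<^sub>v a\<close>.\<close>

definition permutation_equivalent :: "nat \<Rightarrow> 'a::field vec set \<Rightarrow> 'a vec set \<Rightarrow> bool" where
  "permutation_equivalent n A B \<longleftrightarrow> (\<exists>X \<in> permutation_mats n. B = (\<lambda>a. X\<^sup>T *\<^sub>v a) ` A)"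


section \<open>Weighted graphs\<close>

text \<open>Graphs are undirected and loops may carry weights: an adjacency matrix is an arbitrary
  symmetric matrix.\<close>

definition weighted_graph :: "nat \<Rightarrow> 'a::field mat \<Rightarrow> bool" where
  "weighted_graph n M \<longleftrightarrow> M \<in> carrier_mat n n \<and> M\<^sup>T = M"

definition graph_isomorphic :: "nat \<Rightarrow> 'a::field mat \<Rightarrow> 'a mat \<Rightarrow> bool" where
  "graph_isomorphic n M1 M2 \<longleftrightarrow> (\<exists>X \<in> permutation_mats n. M2 = X\<^sup>T * M1 * X)"

definition decides_graph_isomorphism :: "('a::field mat \<Rightarrow> 'a mat \<Rightarrow> bool) \<Rightarrow> bool" where
  "decides_graph_isomorphism gi \<longleftrightarrow>
     (\<forall>n M1 M2. weighted_graph n M1 \<longrightarrow> weighted_graph n M2 \<longrightarrow>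
        (gi M1 M2 \<longleftrightarrow> graph_isomorphic n M1 M2))"


section \<open>Unit-cost machine over a field\<close>

text \<open>
  Deterministic algorithms are structured programs for an algebraic random access machine. The
  memory consists of arrays of natural numbers (loop counters, indices) and two-dimensional arrays
  of field elements. A program is a finite syntactic object that mentions neither the input
  size nor field elements other than 0 and 1, and it can inspect field elements only by testing
  equality. Every elementary operation, on indices as well as on field elements, costs one unit.
  Indices can be added and subtracted but not multiplied, since unit-cost multiplication of
  unbounded integers would make the machine unreasonably powerful.
  Division by 0 yields 0.

  The test \<open>Iso M1 M2 e\<close> calls the graph isomorphism algorithm on the \<open>m \<times> m\<close> matrices
  stored in the arrays \<open>M1\<close> and \<open>M2\<close>, where \<open>m\<close> is the value of \<open>e\<close>. The call costs \<open>GI m\<close>, in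
  addition to the operations needed to issue it.
\<close>

datatype iexp = Num nat | Idx nat iexp | Add iexp iexp | Sub iexp iexp

datatype fexp = Zero | One | Entry nat iexp iexp
  | FAdd fexp fexp | FSub fexp fexp | FMul fexp fexp | FDiv fexp fexp

datatype test = Less iexp iexp | FEq fexp fexp | Iso nat nat iexp | Neg test

datatype com = Skip | ISet nat iexp iexp | FSet nat iexp iexp fexp
  | Seq com com | Cond test com com | Loop test com

record 'a state =
  idx :: "nat \<Rightarrow> nat \<Rightarrow> nat"
  ent :: "nat \<Rightarrow> nat \<Rightarrow> nat \<Rightarrow> 'a"

definition read_mat :: "'a state \<Rightarrow> nat \<Rightarrow> nat \<Rightarrow> nat \<Rightarrow> 'a mat" where
  "read_mat s M nr nc = mat nr nc (\<lambda>(i, j). ent s M i j)"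

primrec ival :: "iexp \<Rightarrow> 'a state \<Rightarrow> nat" where
  "ival (Num k) s = k"
| "ival (Idx a e) s = idx s a (ival e s)"
| "ival (Add e1 e2) s = ival e1 s + ival e2 s"
| "ival (Sub e1 e2) s = ival e1 s - ival e2 s"

primrec icost :: "iexp \<Rightarrow> nat" where
  "icost (Num k) = 1"
| "icost (Idx a e) = 1 + icost e"
| "icost (Add e1 e2) = 1 + icost e1 + icost e2"
| "icost (Sub e1 e2) = 1 + icost e1 + icost e2"

primrec fval :: "fexp \<Rightarrow> 'a::field state \<Rightarrow> 'a" where
  "fval Zero s = 0"
| "fval One s = 1"
| "fval (Entry M e1 e2) s = ent s M (ival e1 s) (ival e2 s)"
| "fval (FAdd f1 f2) s = fval f1 s + fval f2 s"
| "fval (FSub f1 f2) s = fval f1 s - fval f2 s"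
| "fval (FMul f1 f2) s = fval f1 s * fval f2 s"
| "fval (FDiv f1 f2) s = fval f1 s / fval f2 s"

primrec fcost :: "fexp \<Rightarrow> nat" where
  "fcost Zero = 1"
| "fcost One = 1"
| "fcost (Entry M e1 e2) = 1 + icost e1 + icost e2"
| "fcost (FAdd f1 f2) = 1 + fcost f1 + fcost f2"
| "fcost (FSub f1 f2) = 1 + fcost f1 + fcost f2"
| "fcost (FMul f1 f2) = 1 + fcost f1 + fcost f2"
| "fcost (FDiv f1 f2) = 1 + fcost f1 + fcost f2"

primrec tval :: "('a::field mat \<Rightarrow> 'a mat \<Rightarrow> bool) \<Rightarrow> test \<Rightarrow> 'a state \<Rightarrow> bool" where
  "tval gi (Less e1 e2) s \<longleftrightarrow> ival e1 s < ival e2 s"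
| "tval gi (FEq f1 f2) s \<longleftrightarrow> fval f1 s = fval f2 s"
| "tval gi (Iso M1 M2 e) s \<longleftrightarrow>
     gi (read_mat s M1 (ival e s) (ival e s)) (read_mat s M2 (ival e s) (ival e s))"
| "tval gi (Neg b) s \<longleftrightarrow> \<not> tval gi b s"

primrec tcost :: "(nat \<Rightarrow> nat) \<Rightarrow> test \<Rightarrow> 'a state \<Rightarrow> nat" where
  "tcost GI (Less e1 e2) s = 1 + icost e1 + icost e2"
| "tcost GI (FEq f1 f2) s = 1 + fcost f1 + fcost f2"
| "tcost GI (Iso M1 M2 e) s = 1 + icost e + GI (ival e s)"
| "tcost GI (Neg b) s = 1 + tcost GI b s"

text \<open>\<open>exec gi GI c s t s'\<close>: started in \<open>s\<close>, program \<open>c\<close> halts in \<open>s'\<close> after \<open>t\<close> operations.\<close>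

inductive exec ::
  "('a::field mat \<Rightarrow> 'a mat \<Rightarrow> bool) \<Rightarrow> (nat \<Rightarrow> nat) \<Rightarrow>
   com \<Rightarrow> 'a state \<Rightarrow> nat \<Rightarrow> 'a state \<Rightarrow> bool"
  for gi GI
where
  exec_Skip: "exec gi GI Skip s 1 s"
| exec_ISet: "exec gi GI (ISet a e1 e2) s (1 + icost e1 + icost e2)
     (s\<lparr>idx := (idx s)(a := (idx s a)(ival e1 s := ival e2 s))\<rparr>)"
| exec_FSet: "exec gi GI (FSet M e1 e2 f) s (1 + icost e1 + icost e2 + fcost f)
     (s\<lparr>ent := (ent s)(M := (ent s M)(ival e1 s :=
        (ent s M (ival e1 s))(ival e2 s := fval f s)))\<rparr>)"
| exec_Seq: "exec gi GI c1 s t1 s1 \<Longrightarrow> exec gi GI c2 s1 t2 s2 \<Longrightarrow>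
     exec gi GI (Seq c1 c2) s (t1 + t2) s2"
| exec_CondTrue: "tval gi b s \<Longrightarrow> exec gi GI c1 s t s1 \<Longrightarrow>
     exec gi GI (Cond b c1 c2) s (tcost GI b s + t) s1"
| exec_CondFalse: "\<not> tval gi b s \<Longrightarrow> exec gi GI c2 s t s1 \<Longrightarrow>
     exec gi GI (Cond b c1 c2) s (tcost GI b s + t) s1"
| exec_LoopFalse: "\<not> tval gi b s \<Longrightarrow> exec gi GI (Loop b c) s (tcost GI b s) s"
| exec_LoopTrue: "tval gi b s \<Longrightarrow> exec gi GI c s t1 s1 \<Longrightarrow> exec gi GI (Loop b c) s1 t2 s2 \<Longrightarrow>
     exec gi GI (Loop b c) s (tcost GI b s + t1 + t2) s2"

lemma exec_deterministic:
  assumes "exec gi GI c s t s1" and "exec gi GI c s t' s1'"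
  shows "t' = t \<and> s1' = s1"
  using assms
proof (induction arbitrary: t' s1' rule: exec.induct)
  case exec_Skip
  then show ?case by (cases rule: exec.cases) simp
next
  case exec_ISet
  then show ?case by (cases rule: exec.cases) simp
next
  case exec_FSet
  then show ?case by (cases rule: exec.cases) simp
next
  case (exec_Seq c1 s t1 s1 c2 t2 s2)
  note IH = exec_Seq.IH
  from exec_Seq.prems show ?case by (cases rule: exec.cases) (use IH in blast)
next
  case (exec_CondTrue b s c1 t s1 c2)
  note IH = exec_CondTrue.IH and b = exec_CondTrue.hyps(1)
  from exec_CondTrue.prems show ?case by (cases rule: exec.cases) (use IH b in blast)+
next
  case (exec_CondFalse b s c2 t s1 c1)
  note IH = exec_CondFalse.IH and b = exec_CondFalse.hyps(1)
  from exec_CondFalse.prems show ?case by (cases rule: exec.cases) (use IH b in blast)+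
next
  case (exec_LoopFalse b s c)
  note b = exec_LoopFalse.hyps
  from exec_LoopFalse.prems show ?case by (cases rule: exec.cases) (use b in blast)+
next
  case (exec_LoopTrue b s c t1 s1 t2 s2)
  note IH = exec_LoopTrue.IH and b = exec_LoopTrue.hyps(1)
  from exec_LoopTrue.prems show ?case by (cases rule: exec.cases) (use IH b in blast)+
qed

text \<open>Inputs: the numbers \<open>ns\<close> are stored in index array 0, the matrices \<open>Ms\<close> in the field arrays
  0, 1, \<open>\<dots>\<close>; all other cells hold 0. A decision program answers yes iff it leaves 1 in
  cell 0 of index array 1.\<close>

definition input :: "nat list \<Rightarrow> 'a::field mat list \<Rightarrow> 'a state" where
  "input ns Ms = \<lparr>
     idx = (\<lambda>a i. if a = 0 \<and> i < length ns then ns ! i else 0),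
     ent = (\<lambda>M i j. if M < length Ms \<and> i < dim_row (Ms ! M) \<and> j < dim_col (Ms ! M)
                    then Ms ! M $$ (i, j) else 0)\<rparr>"

definition accepts :: "'a state \<Rightarrow> bool" where
  "accepts s \<longleftrightarrow> idx s 1 0 = 1"


section \<open>Exponent of matrix multiplication\<close>

primrec oracle_free_test :: "test \<Rightarrow> bool" where
  "oracle_free_test (Less e1 e2) \<longleftrightarrow> True"
| "oracle_free_test (FEq f1 f2) \<longleftrightarrow> True"
| "oracle_free_test (Iso M1 M2 e) \<longleftrightarrow> False"
| "oracle_free_test (Neg b) \<longleftrightarrow> oracle_free_test b"

primrec oracle_free :: "com \<Rightarrow> bool" where
  "oracle_free Skip \<longleftrightarrow> True"
| "oracle_free (ISet a e1 e2) \<longleftrightarrow> True"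
| "oracle_free (FSet M e1 e2 f) \<longleftrightarrow> True"
| "oracle_free (Seq c1 c2) \<longleftrightarrow> oracle_free c1 \<and> oracle_free c2"
| "oracle_free (Cond b c1 c2) \<longleftrightarrow> oracle_free_test b \<and> oracle_free c1 \<and> oracle_free c2"
| "oracle_free (Loop b c) \<longleftrightarrow> oracle_free_test b \<and> oracle_free c"

text \<open>The arguments \<open>\<lambda>_ _. False\<close> and \<open>\<lambda>_. 0\<close> of \<open>exec\<close> are irrelevant for oracle-free programs.
  The product is left in field array 2.\<close>

definition matmul_in_time :: "'a::field itself \<Rightarrow> real \<Rightarrow> bool" where
  "matmul_in_time _ \<tau> \<longleftrightarrow> (\<exists>c C. oracle_free c \<and>
     (\<forall>n \<ge> 1. \<forall>A \<in> carrier_mat n n. \<forall>B \<in> carrier_mat n n. \<exists>t s.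
        exec (\<lambda>_ _. False) (\<lambda>_. 0) c (input [n] [A, B :: 'a mat]) t s \<and>
        read_mat s 2 n n = A * B \<and> real t \<le> C * real n powr \<tau>))"

definition matmul_exponent :: "'a::field itself \<Rightarrow> real" where
  "matmul_exponent _ = Inf {\<tau>. matmul_in_time TYPE('a) \<tau>}"

end

(*
  For 0/1 weights D on the coordinates such that the form <x, y>_D = sum_j D_j x_j y_j is
  nondegenerate on a code A with generator matrix G, the symmetric matrix
  M_A(D) = G^T (G D G^T)^{-1} G depends only on A and D, and its rows span A. Hence an isomorphism
  between the graphs M_A(D) and M_B(D') carries A to B, and conversely an equivalence from A to B
  carries M_A(D) to M_B(D'), where D' is D permuted. The form becomes nondegenerate on A once the
  coordinates of an information set of the hull, h of them, get weight 0. It therefore suffices to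
  find one suitable D for A by trying at most (n+1)^h candidates, and to compare M_A(D) with M_B(D')
  for at most (n+1)^h candidates D' that include every permutation of D. Each M is computed by
  elimination with O(n^3) operations, and (n+1)^h <= e n^h since h <= n. The claimed exponent is
  omega + h + 1 >= h + 3 because writing an n x n product takes n^2 steps.
*)
theory Submission
  imports Defs
begin

section \<open>Programs with frame conditions and time bounds\<close>

text \<open>With all weights 1 the radical of the form on \<open>A\<close> is the hull, so a
  nontrivial hull is exactly what prevents the use of the unweighted projector. Neither an
  information set of the hull nor h is known to the program, which is fixed before n and h. Sets of
  coordinates are therefore coded as numbers in base n + 1 and tried in increasing order. The first
  success has at most h digits, and its digit count l also bounds the trials for \<open>B\<close>.
  Indices cannot be multiplied, so (n + 1)^l is never computed: the end of the second loop is
  recognised by a carry into digit l. Nothing but the existence of a projector is asked of the first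
  success, because an equivalence maps the removed set to a set of the same size, and all sets of at
  most l coordinates occur among the numbers below (n + 1)^l. That some candidate succeeds is proved
  with the same elimination steps that the program executes.\<close>

definition iupd :: "'a state \<Rightarrow> nat \<Rightarrow> nat \<Rightarrow> nat \<Rightarrow> 'a state" where
  "iupd s a i v = s\<lparr>idx := (idx s)(a := (idx s a)(i := v))\<rparr>"

definition fupd :: "'a state \<Rightarrow> nat \<Rightarrow> nat \<Rightarrow> nat \<Rightarrow> 'a \<Rightarrow> 'a state" where
  "fupd s M i j v = s\<lparr>ent := (ent s)(M := (ent s M)(i := (ent s M i)(j := v)))\<rparr>"

lemma upd_simps [simp]:
  "idx (iupd s a i v) = (idx s)(a := (idx s a)(i := v))" "ent (iupd s a i v) = ent s"
  "ent (fupd s M i j x) = (ent s)(M := (ent s M)(i := (ent s M i)(j := x)))"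
  "idx (fupd s M i j x) = idx s"
  by (simp_all add: iupd_def fupd_def)

primrec iarrays :: "com \<Rightarrow> nat set" where
  "iarrays Skip = {}"
| "iarrays (ISet a e1 e2) = {a}"
| "iarrays (FSet M e1 e2 f) = {}"
| "iarrays (Seq c1 c2) = iarrays c1 \<union> iarrays c2"
| "iarrays (Cond b c1 c2) = iarrays c1 \<union> iarrays c2"
| "iarrays (Loop b c) = iarrays c"

primrec farrays :: "com \<Rightarrow> nat set" where
  "farrays Skip = {}"
| "farrays (ISet a e1 e2) = {}"
| "farrays (FSet M e1 e2 f) = {M}"
| "farrays (Seq c1 c2) = farrays c1 \<union> farrays c2"
| "farrays (Cond b c1 c2) = farrays c1 \<union> farrays c2"
| "farrays (Loop b c) = farrays c"

text \<open>A frame condition read off from the program text. It speaks of whole arrays, not of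
  cells, which is why nested loop counters live in separate arrays.\<close>

definition unchanged :: "com \<Rightarrow> 'a state \<Rightarrow> 'a state \<Rightarrow> bool" where
  "unchanged c s s' \<longleftrightarrow> (\<forall>a. a \<notin> iarrays c \<longrightarrow> idx s' a = idx s a) \<and>
     (\<forall>M. M \<notin> farrays c \<longrightarrow> ent s' M = ent s M)"

lemma exec_unchanged: "exec gi GI c s t s' \<Longrightarrow> unchanged c s s'"
  by (induction rule: exec.induct) (simp_all add: unchanged_def)

text \<open>Total correctness with a time bound. \<open>T\<close> is only an upper bound, so that
  bounds can be rounded up with \<open>run_mono\<close> after each construct.\<close>

definition run ::
  "('a::field mat \<Rightarrow> 'a mat \<Rightarrow> bool) \<Rightarrow> (nat \<Rightarrow> nat) \<Rightarrow> com \<Rightarrow> 'a state \<Rightarrow> nat \<Rightarrow>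
    ('a state \<Rightarrow> bool) \<Rightarrow> bool" where
  "run gi GI c s T Q \<longleftrightarrow> (\<exists>t s'. exec gi GI c s t s' \<and> t \<le> T \<and> Q s')"

lemma run_mono:
  assumes "run gi GI c s T Q" "T \<le> T'" "\<And>s'. Q s' \<Longrightarrow> unchanged c s s' \<Longrightarrow> Q' s'"
  shows "run gi GI c s T' Q'"
  using assms exec_unchanged unfolding run_def by (meson le_trans)

lemma run_Skip: "Q s \<Longrightarrow> run gi GI Skip s 1 Q"
  unfolding run_def using exec_Skip by blast

lemma run_ISet:
  "Q (iupd s a (ival e1 s) (ival e2 s)) \<Longrightarrow> run gi GI (ISet a e1 e2) s (1 + icost e1 + icost e2) Q"
  unfolding run_def iupd_def using exec_ISet by blast

lemma run_FSet:
  "Q (fupd s M (ival e1 s) (ival e2 s) (fval f s)) \<Longrightarrow>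
    run gi GI (FSet M e1 e2 f) s (1 + icost e1 + icost e2 + fcost f) Q"
  unfolding run_def fupd_def using exec_FSet by blast

text \<open>The second program gets the frame condition of the first for free, so intermediate
  assertions list only what has changed.\<close>

lemma run_Seq:
  assumes "run gi GI c1 s T1 P" "\<And>s'. P s' \<Longrightarrow> unchanged c1 s s' \<Longrightarrow> run gi GI c2 s' T2 Q"
  shows "run gi GI (Seq c1 c2) s (T1 + T2) Q"
proof -
  obtain t1 s1 where 1: "exec gi GI c1 s t1 s1" "t1 \<le> T1" "P s1"
    using assms(1) unfolding run_def by blast
  obtain t2 s2 where 2: "exec gi GI c2 s1 t2 s2" "t2 \<le> T2" "Q s2"
    using assms(2)[OF 1(3) exec_unchanged[OF 1(1)]] unfolding run_def by blast
  have "t1 + t2 \<le> T1 + T2" using 1(2) 2(2) by simp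
  with exec_Seq[OF 1(1) 2(1)] 2(3) show ?thesis unfolding run_def by blast
qed

text \<open>Adding the bounds of the branches instead of taking their maximum keeps all bounds
  polynomial.\<close>

lemma run_Cond:
  assumes "tval gi b s \<Longrightarrow> run gi GI c1 s T1 Q" "\<not> tval gi b s \<Longrightarrow> run gi GI c2 s T2 Q"
  shows "run gi GI (Cond b c1 c2) s (tcost GI b s + (T1 + T2)) Q"
proof (cases "tval gi b s")
  case True
  then obtain t s' where 1: "exec gi GI c1 s t s'" "t \<le> T1" "Q s'"
    using assms(1) unfolding run_def by blast
  have "tcost GI b s + t \<le> tcost GI b s + (T1 + T2)" using 1 by simp
  with exec_CondTrue[OF True 1(1)] 1(3) show ?thesis unfolding run_def by blast
next
  case False
  then obtain t s' where 1: "exec gi GI c2 s t s'" "t \<le> T2" "Q s'"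
    using assms(2) unfolding run_def by blast
  have "tcost GI b s + t \<le> tcost GI b s + (T1 + T2)" using 1 by simp
  with exec_CondFalse[OF False 1(1)] 1(3) show ?thesis unfolding run_def by blast
qed

text \<open>The number \<open>N\<close> of rounds is fixed in advance and the invariant is indexed
  by the rounds done; the proof is an induction on the rounds left. The last \<open>K\<close> pays
  for the test that ends the loop.\<close>

lemma run_Loop:
  assumes "I 0 s"
    and step: "\<And>i s'. i < N \<Longrightarrow> I i s' \<Longrightarrow> unchanged c s s' \<Longrightarrow>
      tval gi b s' \<and> tcost GI b s' \<le> K \<and> run gi GI c s' T (I (Suc i))"
    and exit: "\<And>s'. I N s' \<Longrightarrow> unchanged c s s' \<Longrightarrow> \<not> tval gi b s' \<and> tcost GI b s' \<le> K"
  shows "run gi GI (Loop b c) s (N * (T + K) + K) (I N)"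
proof -
  have "run gi GI (Loop b c) s' (d * (T + K) + K) (I N)"
    if "I (N - d) s'" "d \<le> N" "unchanged c s s'" for d s'
    using that
  proof (induction d arbitrary: s')
    case 0
    then have "exec gi GI (Loop b c) s' (tcost GI b s') s'" "tcost GI b s' \<le> K"
      using exit exec_LoopFalse[of gi b s'] by auto
    with 0 show ?case unfolding run_def by fastforce
  next
    case (Suc d)
    have st: "tval gi b s'" "tcost GI b s' \<le> K" "run gi GI c s' T (I (Suc (N - Suc d)))"
      using step[of "N - Suc d" s'] Suc.prems by auto
    then obtain t1 s1 where 1: "exec gi GI c s' t1 s1" "t1 \<le> T" "I (Suc (N - Suc d)) s1"
      unfolding run_def by blast
    have "unchanged c s s1"
      using Suc.prems(3) exec_unchanged[OF 1(1)] by (simp add: unchanged_def)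
    then obtain t2 s2 where 2: "exec gi GI (Loop b c) s1 t2 s2" "t2 \<le> d * (T + K) + K" "I N s2"
      using Suc.IH[of s1] 1(3) Suc.prems(2) by (auto simp: run_def Suc_diff_Suc)
    have "tcost GI b s' + t1 + t2 \<le> Suc d * (T + K) + K"
      using st 1 2 by simp
    with exec_LoopTrue[OF st(1) 1(1) 2(1)] 2(3) show ?case unfolding run_def by blast
  qed
  from this[of N s] assms(1) show ?thesis by (simp add: unchanged_def)
qed

abbreviation V :: "nat \<Rightarrow> iexp" where "V x \<equiv> Idx x (Num 0)"

definition For :: "nat \<Rightarrow> iexp \<Rightarrow> com \<Rightarrow> com" where
  "For x e c = Seq (ISet x (Num 0) (Num 0))
     (Loop (Less (V x) e) (Seq c (ISet x (Num 0) (Add (V x) (Num 1)))))"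

lemma For_arrays [simp]:
  "iarrays (For x e c) = insert x (iarrays c)" "farrays (For x e c) = farrays c"
  by (auto simp: For_def)

text \<open>The next invariant is required in the state after the counter has advanced. Any positive
  \<open>n\<close> above \<open>N\<close> may appear in the bound, so loops over fewer than
  \<open>n\<close> rows, even over none, get bounds in \<open>n\<close> alone, and the factor
  \<open>n\<close> absorbs the cost of setting up.\<close>

lemma run_For:
  assumes "I 0 (iupd s x 0 0)"
    and step: "\<And>i s'. i < N \<Longrightarrow> I i s' \<Longrightarrow> idx s' x 0 = i \<Longrightarrow> unchanged (For x e c) s s' \<Longrightarrow>
      run gi GI c s' T (\<lambda>s''. I (Suc i) (iupd s'' x 0 (Suc i)))"
    and x: "x \<notin> iarrays c"
    and e: "\<And>s'. unchanged (For x e c) s s' \<Longrightarrow> ival e s' = N"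
    and n: "N \<le> n" "0 < n"
  shows "run gi GI (For x e c) s (n * (T + 20 + 2 * icost e)) (I N)"
proof -
  let ?b = "Less (V x) e" and ?c = "Seq c (ISet x (Num 0) (Add (V x) (Num 1)))"
  let ?s = "iupd s x 0 0" and ?J = "\<lambda>i s'. I i s' \<and> idx s' x 0 = i"
  have un: "unchanged (For x e c) s s'" if "unchanged ?c ?s s'" for s'
    using that by (auto simp: unchanged_def)
  have "run gi GI (Loop ?b ?c) ?s (N * ((T + (1 + icost (Num 0) + icost (Add (V x) (Num 1)))) +
      (1 + icost (V x) + icost e)) + (1 + icost (V x) + icost e)) (?J N)"
  proof (rule run_Loop[where I = ?J])
    fix i s'
    assume i: "i < N" "?J i s'" and "unchanged ?c ?s s'"
    then have u: "unchanged (For x e c) s s'" using un by blast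
    have "run gi GI ?c s' (T + (1 + icost (Num 0) + icost (Add (V x) (Num 1)))) (?J (Suc i))"
    proof (rule run_Seq)
      show "run gi GI c s' T (\<lambda>s''. I (Suc i) (iupd s'' x 0 (Suc i)))"
        using step[of i s'] i u by blast
      show "run gi GI (ISet x (Num 0) (Add (V x) (Num 1))) s''
          (1 + icost (Num 0) + icost (Add (V x) (Num 1))) (?J (Suc i))"
        if "I (Suc i) (iupd s'' x 0 (Suc i))" "unchanged c s' s''" for s''
        using that i x by (intro run_ISet) (auto simp: unchanged_def)
    qed
    then show "tval gi ?b s' \<and> tcost GI ?b s' \<le> 1 + icost (V x) + icost e \<and>
        run gi GI ?c s' (T + (1 + icost (Num 0) + icost (Add (V x) (Num 1)))) (?J (Suc i))"
      using i e[OF u] by simp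
  next
    fix s'
    assume "?J N s'" "unchanged ?c ?s s'"
    then show "\<not> tval gi ?b s' \<and> tcost GI ?b s' \<le> 1 + icost (V x) + icost e"
      using e[OF un] by simp
  qed (simp add: assms(1))
  then have "run gi GI (Loop ?b ?c) ?s (N * (T + 10 + icost e) + (4 + icost e)) (?J N)"
    by (rule run_mono) (simp_all add: algebra_simps)
  then have *: "run gi GI (For x e c) s (3 + (N * (T + 10 + icost e) + (4 + icost e))) (?J N)"
    unfolding For_def
  proof (intro run_Seq[where P = "\<lambda>s'. s' = ?s"])
    show "run gi GI (ISet x (Num 0) (Num 0)) s 3 (\<lambda>s'. s' = ?s)"
      by (rule run_mono[OF run_ISet[where Q = "\<lambda>s'. s' = ?s"]]) simp_all
  qed simp
  \<comment> \<open>The 20 in the bound is 10 per round, 7 for the initialisation with the final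
    test, and a reserve of 3.\<close>
  have "N * (T + 10 + icost e) \<le> n * (T + 10 + icost e)" using n by simp
  moreover have "7 + icost e \<le> n * (7 + icost e)" using n by simp
  moreover have "n * (T + 20 + 2 * icost e) = n * (T + 10 + icost e) + n * (7 + icost e) + 3 * n"
    by (simp add: algebra_simps)
  ultimately have "3 + (N * (T + 10 + icost e) + (4 + icost e)) \<le> n * (T + 20 + 2 * icost e)"
    by linarith
  from run_mono[OF * this] show ?thesis by blast
qed

section \<open>Weighted projectors onto a code\<close>

text \<open>The form <x, y>_D. Vectors are functions of which only the values below \<open>n\<close>
  count, because this is the type of a row in memory.\<close>

definition wdot :: "nat \<Rightarrow> (nat \<Rightarrow> 'a::field) \<Rightarrow> (nat \<Rightarrow> 'a) \<Rightarrow> (nat \<Rightarrow> 'a) \<Rightarrow> 'a" where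
  "wdot n D x y = (\<Sum>j<n. x j * D j * y j)"

lemma wdot_commute: "wdot n D x y = wdot n D y x"
  unfolding wdot_def by (intro sum.cong) (auto simp: ac_simps)

lemma wdot_add: "wdot n D (\<lambda>j. x j + y j) z = wdot n D x z + wdot n D y z"
  by (simp add: wdot_def sum.distrib algebra_simps)

lemma wdot_diff: "wdot n D (\<lambda>j. x j - y j) z = wdot n D x z - wdot n D y z"
  by (simp add: wdot_def sum_subtractf algebra_simps)

lemma wdot_scale: "wdot n D (\<lambda>j. a * x j) z = a * wdot n D x z"
  by (simp add: wdot_def sum_distrib_left algebra_simps)

lemma wdot_divide: "wdot n D (\<lambda>j. x j / a) z = wdot n D x z / a"
  using wdot_scale[of n D "inverse a" x z] by (simp add: field_simps)

lemma wdot_sum: "wdot n D (\<lambda>j. \<Sum>r\<in>R. u r * g r j) z = (\<Sum>r\<in>R. u r * wdot n D (g r) z)"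
  unfolding wdot_def sum_distrib_left sum_distrib_right
  by (subst sum.swap) (simp add: ac_simps)

lemma wdot_cong:
  "(\<And>j. j < n \<Longrightarrow> x j = x' j) \<Longrightarrow> (\<And>j. j < n \<Longrightarrow> y j = y' j) \<Longrightarrow> wdot n D x y = wdot n D x' y'"
  unfolding wdot_def by (intro sum.cong) auto

text \<open>Generators are a function of two indices, the shape of a field array, so that memory
  contents can be plugged in directly.\<close>

definition generates :: "nat \<Rightarrow> nat \<Rightarrow> (nat \<Rightarrow> nat \<Rightarrow> 'a::field) \<Rightarrow> 'a vec set \<Rightarrow> bool" where
  "generates n k g A \<longleftrightarrow> A = range (\<lambda>u. vec n (\<lambda>j. \<Sum>r<k. u r * g r j)) \<and>
     (\<forall>u. (\<forall>j<n. (\<Sum>r<k. u r * g r j) = 0) \<longrightarrow> (\<forall>r<k. u r = 0))"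

lemma generates_range:
  "generates n k g A \<Longrightarrow> A = range (\<lambda>u. vec n (\<lambda>j. \<Sum>r<k. u r * g r j))"
  unfolding generates_def by (rule conjunct1)

lemma generates_indep:
  "generates n k g A \<Longrightarrow> (\<And>j. j < n \<Longrightarrow> (\<Sum>r<k. u r * g r j) = 0) \<Longrightarrow> r < k \<Longrightarrow> u r = 0"
  unfolding generates_def by (drule conjunct2) (drule spec[of _ u], blast)

lemma generates_mem:
  assumes "generates n k g A" "a \<in> A"
  obtains u where "a = vec n (\<lambda>j. \<Sum>r<k. u r * g r j)"
  using generates_range[OF assms(1)] assms(2) by blast

lemma generates_lincomb: "generates n k g A \<Longrightarrow> vec n (\<lambda>j. \<Sum>r<k. u r * g r j) \<in> A"
  using generates_range by blast

lemma generates_row: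
  assumes "generates n k g A" "r < k"
  shows "vec n (g r) \<in> A"
proof -
  have "(\<Sum>q<k. (if q = r then 1 else 0) * g q j) = g r j" for j
  proof -
    have "(\<Sum>q<k. (if q = r then 1 else 0) * g q j) = (\<Sum>q<k. if q = r then g q j else 0)"
      by (intro sum.cong) auto
    then show ?thesis using assms(2) by simp
  qed
  then show ?thesis using generates_lincomb[OF assms(1), of "\<lambda>q. if q = r then 1 else 0"] by simp
qed

lemma generates_carrier: "generates n k g A \<Longrightarrow> A \<subseteq> carrier_vec n"
  using generates_range by fastforce

lemma generates_add:
  assumes "generates n k g A" "vec n x \<in> A" "vec n y \<in> A"
  shows "vec n (\<lambda>j. x j + b * y j) \<in> A"
proof -
  obtain u where u: "vec n x = vec n (\<lambda>j. \<Sum>r<k. u r * g r j)"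
    using generates_mem[OF assms(1,2)] by blast
  obtain v where v: "vec n y = vec n (\<lambda>j. \<Sum>r<k. v r * g r j)"
    using generates_mem[OF assms(1,3)] by blast
  have "vec n (\<lambda>j. x j + b * y j) = vec n (\<lambda>j. \<Sum>r<k. (u r + b * v r) * g r j)"
  proof (rule eq_vecI)
    fix j assume j: "j < dim_vec (vec n (\<lambda>j. \<Sum>r<k. (u r + b * v r) * g r j))"
    then have j: "j < n" by simp
    have x: "x j = (\<Sum>r<k. u r * g r j)" using arg_cong[OF u, of "\<lambda>w. w $ j"] j by simp
    have y: "y j = (\<Sum>r<k. v r * g r j)" using arg_cong[OF v, of "\<lambda>w. w $ j"] j by simp
    have "x j + b * y j = (\<Sum>r<k. (u r + b * v r) * g r j)"
      unfolding x y by (simp add: sum.distrib sum_distrib_left distrib_right mult.assoc)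
    then show "vec n (\<lambda>j. x j + b * y j) $ j =
        vec n (\<lambda>j. \<Sum>r<k. (u r + b * v r) * g r j) $ j"
      using j by simp
  qed simp
  then show ?thesis using generates_lincomb[OF assms(1), of "\<lambda>r. u r + b * v r"] by argo
qed

lemma generates_sum:
  fixes m :: nat
  assumes gen: "generates n k g A" and w: "\<forall>r<m. vec n (w r) \<in> A"
  shows "vec n (\<lambda>j. \<Sum>r<m. c r * w r j) \<in> A"
  using w
proof (induction m)
  case 0
  then show ?case using generates_lincomb[OF gen, of "\<lambda>_. 0"] by simp
next
  case (Suc m)
  then have "vec n (\<lambda>j. \<Sum>r<m. c r * w r j) \<in> A" "vec n (w m) \<in> A" by auto
  from generates_add[OF gen this, of "c m"] show ?case by simp
qed

text \<open>If the form \<open>wdot n D\<close> is nondegenerate on \<open>A\<close>, there is exactly one such \<open>M\<close>, namely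
  \<open>M = G\<^sup>T (G D G\<^sup>T)\<inverse> G\<close> for any generator matrix \<open>G\<close>, and \<open>M D\<close> is the projection onto \<open>A\<close> that is
  orthogonal for the form.\<close>

definition weighted_projector ::
  "nat \<Rightarrow> (nat \<Rightarrow> 'a::field) \<Rightarrow> 'a vec set \<Rightarrow> (nat \<Rightarrow> nat \<Rightarrow> 'a) \<Rightarrow> bool" where
  "weighted_projector n D A M \<longleftrightarrow> (\<forall>i<n. vec n (M i) \<in> A) \<and>
     (\<forall>a\<in>A. \<forall>i<n. wdot n D (M i) (($) a) = a $ i)"

text \<open>Row \<open>i\<close> of \<open>M\<close> lies in \<open>A\<close> and is reproduced by
  row \<open>j\<close> of \<open>M'\<close>, and vice versa; both are evaluations of the same value
  of a symmetric form. With \<open>M' = M\<close> this is symmetry, and both statements together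
  give uniqueness.\<close>

lemma weighted_projector_swap:
  assumes M: "weighted_projector n D A M" and M': "weighted_projector n D A M'"
    and "i < n" "j < n"
  shows "M i j = M' j i"
proof -
  have "wdot n D (M' j) (($) (vec n (M i))) = vec n (M i) $ j"
    using assms unfolding weighted_projector_def by blast
  moreover have "wdot n D (M i) (($) (vec n (M' j))) = vec n (M' j) $ i"
    using assms unfolding weighted_projector_def by blast
  moreover have "wdot n D (M' j) (($) (vec n (M i))) = wdot n D (M' j) (M i)"
    by (rule wdot_cong) auto
  moreover have "wdot n D (M i) (($) (vec n (M' j))) = wdot n D (M i) (M' j)"
    by (rule wdot_cong) auto
  ultimately show ?thesis using assms wdot_commute[of n D "M i" "M' j"] by simp
qed

lemma weighted_projector_sym:
  "weighted_projector n D A M \<Longrightarrow> i < n \<Longrightarrow> j < n \<Longrightarrow> M i j = M j i"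
  by (rule weighted_projector_swap)

lemma weighted_projector_unique:
  assumes "weighted_projector n D A M" "weighted_projector n D A M'" "i < n" "j < n"
  shows "M i j = M' i j"
  using weighted_projector_swap[OF assms] weighted_projector_sym[OF assms(2-4)] by simp

text \<open>The rows of a projector are combinations of the generators, so they are orthogonal to
  \<open>x\<close> too; but they reproduce \<open>x\<close>. Hence a projector excludes a
  radical.\<close>

lemma weighted_projector_degenerate:
  assumes gen: "generates n k g A" and x: "vec n x \<in> A"
    and orth: "\<And>r. r < k \<Longrightarrow> wdot n D (g r) x = 0" and M: "weighted_projector n D A M" and "j < n"
  shows "x j = 0"
proof -
  have "vec n (M j) \<in> A" using M \<open>j < n\<close> unfolding weighted_projector_def by blast
  then obtain u where u: "vec n (M j) = vec n (\<lambda>j. \<Sum>r<k. u r * g r j)" 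
    using generates_mem[OF gen] by blast
  have "M j i = (\<Sum>r<k. u r * g r i)" if "i < n" for i
    using arg_cong[OF u, of "\<lambda>w. w $ i"] that by simp
  then have "wdot n D (M j) x = wdot n D (\<lambda>i. \<Sum>r<k. u r * g r i) x"
    by (intro wdot_cong) auto
  also have "\<dots> = 0" unfolding wdot_sum using orth by simp
  also have "wdot n D (M j) x = wdot n D (M j) (($) (vec n x))" by (intro wdot_cong) auto
  also have "\<dots> = x j" using M x \<open>j < n\<close> unfolding weighted_projector_def by auto
  finally show ?thesis by simp
qed

text \<open>Elimination: the rows of \<open>w\<close> are transformed until they form the basis dual to \<open>g\<close>; the
  columns below \<open>c\<close> are done. The second conjunct says that the rows still span the code.\<close>

definition partial_dual ::
  "nat \<Rightarrow> (nat \<Rightarrow> 'a::field) \<Rightarrow> 'a vec set \<Rightarrow> nat \<Rightarrow> (nat \<Rightarrow> nat \<Rightarrow> 'a) \<Rightarrow> nat \<Rightarrow> (nat \<Rightarrow> nat \<Rightarrow> 'a) \<Rightarrow> bool"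
  where
  "partial_dual n D A k g c w \<longleftrightarrow> (\<forall>r<k. vec n (w r) \<in> A) \<and>
     (\<forall>x. (\<forall>r<k. wdot n D (w r) x = 0) \<longrightarrow> (\<forall>r<k. wdot n D (g r) x = 0)) \<and>
     (\<forall>r<k. \<forall>q<c. wdot n D (w r) (g q) = (if r = q then 1 else 0))"

section \<open>Gauss-Jordan steps towards a dual basis\<close>

lemma partial_dual_cong:
  assumes "partial_dual n D A k g c w" "\<And>r j. r < k \<Longrightarrow> j < n \<Longrightarrow> w r j = w' r j"
  shows "partial_dual n D A k g c w'"
proof -
  have 1: "wdot n D (w r) x = wdot n D (w' r) x" if "r < k" for r x
    using assms(2) that by (intro wdot_cong) auto
  have 2: "vec n (w r) = vec n (w' r)" if "r < k" for r
    using assms(2) that by (intro eq_vecI) auto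
  show ?thesis using assms(1) 1 2 unfolding partial_dual_def by force
qed

lemma partial_dual_start: "generates n k g A \<Longrightarrow> partial_dual n D A k g 0 g"
  unfolding partial_dual_def using generates_row by auto

text \<open>Rows \<open>c\<close> and \<open>r\<close> both pair to 0 with the finished columns, so
  their sum does as well, and the old row \<open>c\<close> is recovered by subtracting row
  \<open>r\<close>. This replaces a row exchange when the pivot is 0.\<close>

lemma partial_dual_add_row:
  assumes gen: "generates n k g A" and w: "partial_dual n D A k g c w" and c: "c < r" "r < k"
  shows "partial_dual n D A k g c (w(c := (\<lambda>j. w c j + w r j)))"
  unfolding partial_dual_def
proof (intro conjI allI impI)
  fix i assume "i < k"
  show "vec n ((w(c := (\<lambda>j. w c j + w r j))) i) \<in> A"
    using generates_add[OF gen, of "w c" "w r" 1] w c \<open>i < k\<close> unfolding partial_dual_def by auto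
next
  fix x i assume *: "\<forall>i<k. wdot n D ((w(c := (\<lambda>j. w c j + w r j))) i) x = 0" and "i < k"
  have "wdot n D (w i) x = 0" if "i < k" for i
  proof (cases "i = c")
    case True
    have "wdot n D (w c) x + wdot n D (w r) x = 0" using *[rule_format, of c] c by (simp add: wdot_add)
    moreover have "wdot n D (w r) x = 0" using *[rule_format, of r] c by simp
    ultimately show ?thesis using True by simp
  qed (use *[rule_format, of i] that in simp)
  then show "wdot n D (g i) x = 0" using w \<open>i < k\<close> unfolding partial_dual_def by blast
next
  fix i q assume "i < k" "q < c"
  then show "wdot n D ((w(c := (\<lambda>j. w c j + w r j))) i) (g q) = (if i = q then 1 else 0)"
    using w c unfolding partial_dual_def by (auto simp: wdot_add)
qed

text \<open>If no row from \<open>c\<close> on pairs with \<open>g c\<close>, then the difference of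
  g_c and the sum of <w_r, g_c> g_r over r < c is orthogonal to every \<open>w r\<close>, hence to
  the whole code. It is nonzero because the generators are independent and g_c has coefficient
  1.\<close>

lemma partial_dual_stuck:
  assumes gen: "generates n k g A" and w: "partial_dual n D A k g c w" and c: "c < k"
    and zero: "\<And>r. c \<le> r \<Longrightarrow> r < k \<Longrightarrow> wdot n D (w r) (g c) = 0"
  shows "\<exists>x. vec n x \<in> A \<and> (\<forall>r<k. wdot n D (g r) x = 0) \<and> (\<exists>j<n. x j \<noteq> 0)"
proof -
  define u where "u r = (if r < c then - wdot n D (w r) (g c) else if r = c then 1 else 0)" for r
  define x where "x j = (\<Sum>r<k. u r * g r j)" for j
  have "wdot n D (w r) x = 0" if "r < k" for r
  proof -
    have "wdot n D (w r) x = wdot n D x (w r)" by (rule wdot_commute)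
    also have "\<dots> = (\<Sum>q<k. u q * wdot n D (w r) (g q))"
      unfolding x_def wdot_sum by (simp add: wdot_commute)
    also have "\<dots> = (\<Sum>q<k. (if q = c then wdot n D (w r) (g c) else 0) +
        (if q = r \<and> r < c then - wdot n D (w r) (g c) else 0))"
      using w that by (intro sum.cong) (auto simp: u_def partial_dual_def)
    also have "\<dots> = wdot n D (w r) (g c) + (if r < c then - wdot n D (w r) (g c) else 0)"
      using that c by (cases "r < c") (simp_all add: sum.distrib)
    also have "\<dots> = 0" using zero[of r] that by auto
    finally show ?thesis .
  qed
  then have "\<forall>r<k. wdot n D (g r) x = 0"
    using w unfolding partial_dual_def by blast
  moreover have "vec n x \<in> A" unfolding x_def by (rule generates_lincomb[OF gen])
  moreover have "\<exists>j<n. x j \<noteq> 0"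
  proof (rule ccontr)
    assume "\<not> (\<exists>j<n. x j \<noteq> 0)"
    then have "u c = 0" using generates_indep[OF gen _ c] unfolding x_def by blast
    then show False by (simp add: u_def)
  qed
  ultimately show ?thesis by blast
qed

lemma partial_dual_degenerate:
  assumes gen: "generates n k g A" and w: "partial_dual n D A k g c w" and c: "c < k"
    and zero: "\<And>r. c \<le> r \<Longrightarrow> r < k \<Longrightarrow> wdot n D (w r) (g c) = 0"
  shows "\<not> weighted_projector n D A M"
  using partial_dual_stuck[OF assms] weighted_projector_degenerate[OF gen] by blast

text \<open>Row \<open>c\<close> pairs to 0 with the finished columns, so subtracting its multiples
  from the other rows leaves these columns intact. The new rows are prescribed only below
  \<open>n\<close> because the program computes no other cells.\<close>

lemma partial_dual_Suc:
  assumes gen: "generates n k g A" and w: "partial_dual n D A k g c w" and c: "c < k"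
    and piv: "wdot n D (w c) (g c) \<noteq> 0"
    and w': "\<And>j. j < n \<Longrightarrow> w' c j = w c j / wdot n D (w c) (g c)"
      "\<And>r j. r < k \<Longrightarrow> j < n \<Longrightarrow> r \<noteq> c \<Longrightarrow> w' r j = w r j - wdot n D (w r) (g c) * w' c j"
  shows "partial_dual n D A k g (Suc c) w'"
proof -
  define p where "p = wdot n D (w c) (g c)"
  have 1: "wdot n D (w' c) x = wdot n D (w c) x / p" for x
    using wdot_divide[of n D "w c" p x] w'(1) wdot_cong[of n "w' c" "\<lambda>j. w c j / p" x x D]
    by (simp add: p_def)
  have 2: "wdot n D (w' r) x = wdot n D (w r) x - wdot n D (w r) (g c) * wdot n D (w' c) x"
    if "r < k" "r \<noteq> c" for r x
  proof -
    have "wdot n D (w' r) x = wdot n D (\<lambda>j. w r j - wdot n D (w r) (g c) * w' c j) x"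
      using w'(2) that by (intro wdot_cong) auto
    then show ?thesis by (simp add: wdot_diff wdot_scale)
  qed
  have A: "vec n (w r) \<in> A" if "r < k" for r using w that unfolding partial_dual_def by blast
  have zero: "vec n (\<lambda>j. 0) \<in> A" using generates_lincomb[OF gen, of "\<lambda>_. 0"] by simp
  have A': "vec n (w' c) \<in> A"
  proof -
    \<comment> \<open>Scaling is written as an addition to the zero word, the form in which
      \<open>generates_add\<close> provides closure.\<close>
    have "vec n (w' c) = vec n (\<lambda>j. 0 + inverse p * w c j)"
      using w'(1) by (intro eq_vecI) (auto simp: p_def field_simps)
    then show ?thesis using generates_add[OF gen zero A[OF c]] by simp
  qed
  show ?thesis
    unfolding partial_dual_def
  proof (intro conjI allI impI)
    fix r assume r: "r < k"
    show "vec n (w' r) \<in> A"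
    proof (cases "r = c")
      case False
      have "vec n (w' r) = vec n (\<lambda>j. w r j + (- wdot n D (w r) (g c)) * w' c j)"
        using w'(2)[OF r _ False] by (intro eq_vecI) auto
      then show ?thesis using generates_add[OF gen A[OF r] A', of "- wdot n D (w r) (g c)"] by simp
    qed (use A' in simp)
  next
    fix x r assume *: "\<forall>r<k. wdot n D (w' r) x = 0" and r: "r < k"
    have "wdot n D (w r) x = 0" if "r < k" for r
    proof (cases "r = c")
      case True
      then show ?thesis using 1[of x] * c piv by (simp add: p_def)
    next
      case False
      then show ?thesis using 2[OF that False, of x] * c that by simp
    qed
    then show "wdot n D (g r) x = 0" using w r unfolding partial_dual_def by blast
  next
    fix r q assume r: "r < k" and q: "q < Suc c"
    have w3: "wdot n D (w i) (g q) = (if i = q then 1 else 0)" if "i < k" "q < c" for i q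
      using w that unfolding partial_dual_def by blast
    have c': "wdot n D (w' c) (g q) = (if c = q then 1 else 0)"
      using q piv w3[OF c, of q] by (cases "q = c") (auto simp: 1 p_def)
    show "wdot n D (w' r) (g q) = (if r = q then 1 else 0)"
    proof (cases "r = c")
      case False
      then show ?thesis using 2[OF r False, of "g q"] c' w3[OF r, of q] q by (cases "q = c") auto
    qed (use c' in simp)
  qed
qed

text \<open>A dual basis reads off coefficients: <w_r, a> is the coefficient of \<open>g r\<close>
  in \<open>a\<close>. Hence the product of the transposed generator matrix with \<open>w\<close>
  reproduces every codeword.\<close>

lemma partial_dual_projector:
  assumes gen: "generates n k g A" and w: "partial_dual n D A k g k w"
    and M: "\<And>i j. i < n \<Longrightarrow> j < n \<Longrightarrow> M i j = (\<Sum>r<k. g r i * w r j)"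
  shows "weighted_projector n D A M"
  unfolding weighted_projector_def
proof (intro conjI ballI allI impI)
  fix i assume i: "i < n"
  have "vec n (\<lambda>j. \<Sum>r<k. g r i * w r j) \<in> A"
    using w by (intro generates_sum[OF gen]) (auto simp: partial_dual_def)
  moreover have "vec n (M i) = vec n (\<lambda>j. \<Sum>r<k. g r i * w r j)" using M i by (intro eq_vecI) auto
  ultimately show "vec n (M i) \<in> A" by simp
next
  fix a i assume "a \<in> A" and i: "i < n"
  then obtain u where u: "a = vec n (\<lambda>j. \<Sum>r<k. u r * g r j)" using generates_mem[OF gen] by blast
  have "wdot n D (M i) (($) a) = wdot n D (\<lambda>j. \<Sum>r<k. g r i * w r j) (($) a)"
    using M i by (intro wdot_cong) auto
  also have "\<dots> = (\<Sum>r<k. g r i * wdot n D (w r) (($) a))" by (rule wdot_sum)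
  also have "\<dots> = (\<Sum>r<k. g r i * u r)"
  proof (intro sum.cong refl)
    fix r assume r: "r \<in> {..<k}"
    have "wdot n D (w r) (($) a) = wdot n D (w r) (\<lambda>j. \<Sum>r<k. u r * g r j)"
      unfolding u by (intro wdot_cong) auto
    also have "\<dots> = (\<Sum>q<k. u q * wdot n D (w r) (g q))"
      by (subst wdot_commute) (simp add: wdot_sum wdot_commute)
    also have "\<dots> = (\<Sum>q<k. if q = r then u r else 0)"
      using w r by (intro sum.cong) (auto simp: partial_dual_def)
    also have "\<dots> = u r" using r by simp
    finally show "g r i * wdot n D (w r) (($) a) = g r i * u r" by simp
  qed
  also have "\<dots> = a $ i" using i by (simp add: u mult.commute)
  finally show "wdot n D (M i) (($) a) = a $ i" .
qed

section \<open>Computing a weighted projector\<close>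

definition Row :: "nat \<Rightarrow> iexp \<Rightarrow> nat \<Rightarrow> iexp \<Rightarrow> fexp \<Rightarrow> com" where
  "Row M e1 x e f = For x e (FSet M e1 (V x) f)"

lemma Row_arrays [simp]: "iarrays (Row M e1 x e f) = {x}" "farrays (Row M e1 x e f) = {M}"
  by (simp_all add: Row_def)

text \<open>The expression \<open>f\<close> may read the row that is being overwritten. Premise
  \<open>F\<close> therefore describes this row half way: new below \<open>i\<close>, old from
  \<open>i\<close> on.\<close>

lemma run_Row:
  assumes e: "\<And>s'. unchanged (Row M e1 x e f) s s' \<Longrightarrow> ival e s' = N"
    and e1: "\<And>s'. unchanged (Row M e1 x e f) s s' \<Longrightarrow> ival e1 s' = a"
    and F: "\<And>i s'. i < N \<Longrightarrow> unchanged (Row M e1 x e f) s s' \<Longrightarrow> idx s' x 0 = i \<Longrightarrow>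
      ent s' M = (ent s M)(a := \<lambda>j. if j < i then F j else ent s M a j) \<Longrightarrow> fval f s' = F i"
    and n: "N \<le> n" "0 < n"
  shows "run gi GI (Row M e1 x e f) s (n * (1 + icost e1 + 2 + fcost f + 20 + 2 * icost e))
    (\<lambda>s'. ent s' M = (ent s M)(a := \<lambda>j. if j < N then F j else ent s M a j))"
proof -
  have "run gi GI (For x e (FSet M e1 (V x) f)) s
      (n * ((1 + icost e1 + icost (V x) + fcost f) + 20 + 2 * icost e))
      (\<lambda>s'. ent s' M = (ent s M)(a := \<lambda>j. if j < N then F j else ent s M a j))"
  proof (rule run_For[where I = "\<lambda>i s'. ent s' M =
        (ent s M)(a := \<lambda>j. if j < i then F j else ent s M a j)" and N = N])
    fix i s'
    assume i: "i < N" and s': "ent s' M = (ent s M)(a := \<lambda>j. if j < i then F j else ent s M a j)"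
      "idx s' x 0 = i" and u: "unchanged (For x e (FSet M e1 (V x) f)) s s'"
    have "ival e1 s' = a" "fval f s' = F i" using e1 F i s' u by (auto simp: Row_def)
    then show "run gi GI (FSet M e1 (V x) f) s' (1 + icost e1 + icost (V x) + fcost f)
        (\<lambda>s''. ent (iupd s'' x 0 (Suc i)) M =
          (ent s M)(a := \<lambda>j. if j < Suc i then F j else ent s M a j))"
      using s' by (intro run_FSet) (auto simp: fun_eq_iff less_Suc_eq)
  qed (use e n in \<open>simp_all add: Row_def\<close>)
  then show ?thesis unfolding Row_def by (rule run_mono) (simp_all add: algebra_simps)
qed

definition Sum :: "nat \<Rightarrow> iexp \<Rightarrow> iexp \<Rightarrow> nat \<Rightarrow> iexp \<Rightarrow> fexp \<Rightarrow> com" where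
  "Sum M e1 e2 x e f =
     Seq (FSet M e1 e2 Zero) (For x e (FSet M e1 e2 (FAdd (Entry M e1 e2) f)))"

lemma Sum_arrays [simp]: "iarrays (Sum M e1 e2 x e f) = {x}" "farrays (Sum M e1 e2 x e f) = {M}"
  by (simp_all add: Sum_def)

text \<open>The sum accumulates in its target cell. Premise \<open>F\<close> tells nothing about the
  contents of array \<open>M\<close>, so the value of \<open>f\<close> must not depend on
  them.\<close>

lemma run_Sum:
  assumes e: "\<And>s'. unchanged (Sum M e1 e2 x e f) s s' \<Longrightarrow> ival e s' = N"
    and e12: "\<And>s'. unchanged (Sum M e1 e2 x e f) s s' \<Longrightarrow> ival e1 s' = a \<and> ival e2 s' = b"
    and F: "\<And>i s'. i < N \<Longrightarrow> unchanged (Sum M e1 e2 x e f) s s' \<Longrightarrow> idx s' x 0 = i \<Longrightarrow> fval f s' = F i"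
    and n: "N \<le> n" "0 < n"
  shows "run gi GI (Sum M e1 e2 x e f) s
    (n * (30 + 3 * icost e1 + 3 * icost e2 + fcost f + 2 * icost e))
    (\<lambda>s'. ent s' M = (ent s M)(a := (ent s M a)(b := \<Sum>i<N. F i)))"
proof -
  let ?P = "\<lambda>i s'. ent s' M = (ent s M)(a := (ent s M a)(b := \<Sum>j<i. F j))"
  let ?c = "FSet M e1 e2 (FAdd (Entry M e1 e2) f)"
  have s: "ival e1 s = a" "ival e2 s = b" using e12[of s] by (auto simp: unchanged_def)
  have "run gi GI (Sum M e1 e2 x e f) s ((1 + icost e1 + icost e2 + fcost Zero) +
      n * ((1 + icost e1 + icost e2 + fcost (FAdd (Entry M e1 e2) f)) + 20 + 2 * icost e)) (?P N)"
    unfolding Sum_def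
  proof (rule run_Seq)
    show "run gi GI (FSet M e1 e2 Zero) s (1 + icost e1 + icost e2 + fcost Zero) (?P 0)"
      using s by (intro run_FSet) simp
  next
    fix s0 assume s0: "?P 0 s0" "unchanged (FSet M e1 e2 Zero) s s0"
    have un: "unchanged (Sum M e1 e2 x e f) s s'" if "unchanged (For x e ?c) s0 s'" for s'
      using s0 that by (auto simp: unchanged_def Sum_def)
    show "run gi GI (For x e ?c) s0
        (n * ((1 + icost e1 + icost e2 + fcost (FAdd (Entry M e1 e2) f)) + 20 + 2 * icost e)) (?P N)"
    proof (rule run_For[where I = ?P and N = N])
      fix i s'
      assume i: "i < N" and s': "?P i s'" "idx s' x 0 = i" and u: "unchanged (For x e ?c) s0 s'"
      have "ival e1 s' = a \<and> ival e2 s' = b" "fval f s' = F i" using e12 F i s' un[OF u] by blast+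
      then show "run gi GI ?c s' (1 + icost e1 + icost e2 + fcost (FAdd (Entry M e1 e2) f))
          (\<lambda>s''. ?P (Suc i) (iupd s'' x 0 (Suc i)))"
        using s' by (intro run_FSet) (simp add: fun_eq_iff)
    qed (use s0 e un n in auto)
  qed
  moreover have "(1 + icost e1 + icost e2 + fcost Zero) +
      n * ((1 + icost e1 + icost e2 + fcost (FAdd (Entry M e1 e2) f)) + 20 + 2 * icost e)
    \<le> n * (30 + 3 * icost e1 + 3 * icost e2 + fcost f + 2 * icost e)"
  proof -
    have "2 + icost e1 + icost e2 \<le> n * (2 + icost e1 + icost e2)"
      using n mult_le_mono1[of 1 n "2 + icost e1 + icost e2"] by (simp add: Suc_le_eq)
    then show ?thesis by (simp add: algebra_simps)
  qed
  ultimately show ?thesis by (rule run_mono)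
qed

text \<open>Memory layout. Index arrays: 2 holds the digits that encode the removed coordinates, 3 their
  number, 4 a flag that says whether the projector exists, 5 to 8 are loop counters (5 is also the
  current column \<open>c\<close> of the elimination). Field arrays: 0 and 1 hold the generator matrices, 2 and 3
  the projectors, 4 the rows \<open>w\<close>, row 0 of 5 their pairings with column \<open>c\<close>, row 0 of 6 the
  weights.\<close>

abbreviation numN :: iexp where "numN \<equiv> Idx 0 (Num 0)"

definition Sum_matrix :: "nat \<Rightarrow> iexp \<Rightarrow> fexp \<Rightarrow> com" where
  "Sum_matrix M e f = For 5 numN (For 7 numN (Sum M (V 5) (V 7) 6 e f))"

lemma Sum_matrix_arrays [simp]:
  "iarrays (Sum_matrix M e f) = {5, 6, 7}" "farrays (Sum_matrix M e f) = {M}"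
  by (auto simp: Sum_matrix_def)

text \<open>Kept general because it serves twice: for the projector, and for the schoolbook product
  in the discussion of the exponent of matrix multiplication.\<close>

lemma run_Sum_matrix:
  fixes s :: "'a::field state"
  assumes n: "idx s 0 0 = n" "0 < n" "N \<le> n"
    and e: "\<And>s'. unchanged (Sum_matrix M e f) s s' \<Longrightarrow> ival e s' = N"
    and F: "\<And>i j r s'. r < N \<Longrightarrow> unchanged (Sum_matrix M e f) s s' \<Longrightarrow> idx s' 5 0 = i \<Longrightarrow>
      idx s' 7 0 = j \<Longrightarrow> idx s' 6 0 = r \<Longrightarrow> fval f s' = F i j r"
  shows "run gi GI (Sum_matrix M e f) s (n * (n * (n * (50 + fcost f + 2 * icost e) + 30) + 30))
    (\<lambda>s'. \<forall>i<n. \<forall>j<n. ent s' M i j = (\<Sum>r<N. F i j r))"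
proof -
  let ?sum = "Sum M (V 5) (V 7) 6 e f"
  let ?S = "\<lambda>i j. \<Sum>r<N. F i j r"
  let ?J = "\<lambda>i s'. \<forall>i'<i. \<forall>j<n. ent s' M i' j = ?S i' j"
  have "run gi GI (For 5 numN (For 7 numN ?sum)) s
    (n * (n * (n * (50 + fcost f + 2 * icost e) + 30) + 20 + 2 * icost numN)) (?J n)"
  proof (rule run_For[where I = ?J and N = n])
    fix i and s' :: "'a state"
    assume i: "i < n" and I: "?J i s'" "idx s' 5 0 = i"
      and u: "unchanged (For 5 numN (For 7 numN ?sum)) s s'"
    let ?L = "\<lambda>j s''. (\<forall>i'<i. \<forall>j<n. ent s'' M i' j = ?S i' j) \<and> (\<forall>j'<j. ent s'' M i j' = ?S i j')"
    have "run gi GI (For 7 numN ?sum) s'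
      (n * (n * (50 + fcost f + 2 * icost e) + 20 + 2 * icost numN)) (?L n)"
    proof (rule run_For[where I = ?L and N = n])
      fix j and s'' :: "'a state"
      assume j: "j < n" and L: "?L j s''" "idx s'' 7 0 = j" and u': "unchanged (For 7 numN ?sum) s' s''"
      have un: "unchanged (Sum_matrix M e f) s s3 \<and> idx s3 5 0 = i \<and> idx s3 7 0 = j"
        if "unchanged ?sum s'' s3" for s3 :: "'a state"
        using that u u' I L by (auto simp: unchanged_def)
      have "run gi GI ?sum s'' (n * (30 + 3 * icost (V 5) + 3 * icost (V 7) + fcost f + 2 * icost e))
        (\<lambda>s3. ent s3 M = (ent s'' M)(i := (ent s'' M i)(j := ?S i j)))"
        by (rule run_Sum) (use un e F n in auto)
      then show "run gi GI ?sum s'' (n * (50 + fcost f + 2 * icost e)) (\<lambda>s3. ?L (Suc j) (iupd s3 7 0 (Suc j)))"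
        by (rule run_mono) (use L in \<open>auto simp: less_Suc_eq\<close>)
    qed (use n u I in \<open>auto simp: unchanged_def\<close>)
    then show "run gi GI (For 7 numN ?sum) s' (n * (n * (50 + fcost f + 2 * icost e) + 30))
        (\<lambda>s''. ?J (Suc i) (iupd s'' 5 0 (Suc i)))"
      by (rule run_mono) (auto simp: less_Suc_eq)
  qed (use n in \<open>auto simp: unchanged_def\<close>)
  then show ?thesis unfolding Sum_matrix_def by (rule run_mono) auto
qed

section \<open>One column of the elimination as a program\<close>

definition pairing :: "nat \<Rightarrow> nat \<Rightarrow> com" where
  "pairing g q = For 6 (Idx 0 (Num q)) (Sum 5 (Num 0) (V 6) 7 numN
     (FMul (FMul (Entry 4 (V 6) (V 7)) (Entry 6 (Num 0) (V 7))) (Entry g (V 5) (V 7))))"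

lemma pairing_arrays [simp]: "iarrays (pairing g q) = {6, 7}" "farrays (pairing g q) = {5}"
  by (simp_all add: pairing_def)

lemma run_pairing:
  assumes "idx s 0 0 = n" "idx s 0 q = k" "k \<le> n" "0 < n" "g \<notin> {4, 5, 6}"
  shows "run gi GI (pairing g q) s (n * (n * 60 + 30))
    (\<lambda>s'. \<forall>r<k. ent s' 5 0 r = wdot n (ent s 6 0) (ent s 4 r) (ent s g (idx s 5 0)))"
proof -
  let ?w = "\<lambda>r. wdot n (ent s 6 0) (ent s 4 r) (ent s g (idx s 5 0))"
  let ?f = "FMul (FMul (Entry 4 (V 6) (V 7)) (Entry 6 (Num 0) (V 7))) (Entry g (V 5) (V 7))"
  have "run gi GI (pairing g q) s (n * ((n * 60) + 20 + 2 * icost (Idx 0 (Num q))))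
      (\<lambda>s'. \<forall>r<k. ent s' 5 0 r = ?w r)"
    unfolding pairing_def
  proof (rule run_For[where I = "\<lambda>i s'. \<forall>r<i. ent s' 5 0 r = ?w r" and N = k])
    fix i s'
    assume i: "i < k" and I: "\<forall>r<i. ent s' 5 0 r = ?w r" "idx s' 6 0 = i"
      and u: "unchanged (For 6 (Idx 0 (Num q)) (Sum 5 (Num 0) (V 6) 7 numN ?f)) s s'"
    have "run gi GI (Sum 5 (Num 0) (V 6) 7 numN ?f) s'
      (n * (30 + 3 * icost (Num 0) + 3 * icost (V 6) + fcost ?f + 2 * icost numN))
      (\<lambda>s''. ent s'' 5 = (ent s' 5)(0 := (ent s' 5 0)(i := \<Sum>j<n. ent s 4 i j * ent s 6 0 j * ent s g (idx s 5 0) j)))"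
      by (rule run_Sum) (use assms I u in \<open>auto simp: unchanged_def\<close>)
    then show "run gi GI (Sum 5 (Num 0) (V 6) 7 numN ?f) s' (n * 60)
        (\<lambda>s''. \<forall>r<Suc i. ent (iupd s'' 6 0 (Suc i)) 5 0 r = ?w r)"
      by (rule run_mono) (use I in \<open>auto simp: less_Suc_eq wdot_def\<close>)
  qed (use assms in \<open>auto simp: unchanged_def\<close>)
  then show ?thesis by (rule run_mono) auto
qed

text \<open>Later rows are added to row \<open>c\<close> as long as the pivot is 0. A row with
  pairing 0 does no harm, and the first one with nonzero pairing makes the pivot nonzero and ends
  the additions. This needs neither a temporary row nor a stored index.\<close>

definition pivot_row :: "nat \<Rightarrow> com" where
  "pivot_row q = For 6 (Idx 0 (Num q))
     (Cond (Less (V 5) (V 6))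
       (Cond (FEq (Entry 5 (Num 0) (V 5)) Zero)
         (Seq (FSet 5 (Num 0) (V 5) (FAdd (Entry 5 (Num 0) (V 5)) (Entry 5 (Num 0) (V 6))))
           (Row 4 (V 5) 7 numN (FAdd (Entry 4 (V 5) (V 7)) (Entry 4 (V 6) (V 7)))))
         Skip)
       Skip)"

lemma pivot_row_arrays [simp]: "iarrays (pivot_row q) = {6, 7}" "farrays (pivot_row q) = {4, 5}"
  by (auto simp: pivot_row_def)

definition paired :: "nat \<Rightarrow> 'a::field vec set \<Rightarrow> nat \<Rightarrow> (nat \<Rightarrow> nat \<Rightarrow> 'a) \<Rightarrow> nat \<Rightarrow> (nat \<Rightarrow> 'a) \<Rightarrow> 'a state \<Rightarrow> bool"
  where
  "paired n A k g c D s \<longleftrightarrow> partial_dual n D A k g c (ent s 4) \<and>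
     (\<forall>r<k. ent s 5 0 r = wdot n D (ent s 4 r) (g c))"

text \<open>The postcondition is an implication because the elimination continues after a degenerate
  column, when \<open>paired\<close> may fail; the time bound has to hold even then.\<close>

lemma run_pivot_row:
  assumes "idx s 0 0 = n" "idx s 0 q = k" "k \<le> n" "0 < n" "idx s 5 0 = c" "c < k"
    and gen: "generates n k g A"
  shows "run gi GI (pivot_row q) s (n * (n * 50 + 80))
    (\<lambda>s'. paired n A k g c D s \<longrightarrow> paired n A k g c D s' \<and>
      (ent s' 5 0 c \<noteq> 0 \<or> (\<forall>r. c \<le> r \<and> r < k \<longrightarrow> ent s' 5 0 r = 0)))"
proof -
  let ?I = "\<lambda>i s'. paired n A k g c D s \<longrightarrow> paired n A k g c D s' \<and>
      (ent s' 5 0 c \<noteq> 0 \<or> (\<forall>r. c \<le> r \<and> r < i \<longrightarrow> ent s' 5 0 r = 0))"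
  let ?set = "FSet 5 (Num 0) (V 5) (FAdd (Entry 5 (Num 0) (V 5)) (Entry 5 (Num 0) (V 6)))"
  let ?f = "FAdd (Entry 4 (V 5) (V 7)) (Entry 4 (V 6) (V 7))"
  let ?row = "Row 4 (V 5) 7 numN ?f"
  let ?b = "FEq (Entry 5 (Num 0) (V 5)) Zero"
  let ?body = "Cond (Less (V 5) (V 6)) (Cond ?b (Seq ?set ?row) Skip) Skip"
  have "run gi GI (pivot_row q) s (n * ((n * 50 + 40) + 20 + 2 * icost (Idx 0 (Num q)))) (?I k)"
    unfolding pivot_row_def
  proof (rule run_For[where I = ?I and N = k])
    fix i s'
    assume i: "i < k" and I: "?I i s'" and i': "idx s' 6 0 = i"
      and u: "unchanged (For 6 (Idx 0 (Num q)) ?body) s s'"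
    have c: "idx s' 5 0 = c" "idx s' 0 0 = n" using u assms by (auto simp: unchanged_def)
    define Q where "Q = (\<lambda>s''. ?I (Suc i) (iupd s'' 6 0 (Suc i)))"
    have add: "run gi GI (Seq ?set ?row) s' (20 + n * 50) Q" if ci: "c < i" and z: "ent s' 5 0 c = 0"
    proof (rule run_Seq)
      show "run gi GI ?set s' 20 (\<lambda>s1. s1 = fupd s' 5 0 c (ent s' 5 0 i))"
        by (rule run_mono[OF run_FSet[where Q = "\<lambda>s1. s1 = fupd s' 5 0 c (ent s' 5 0 i)"]])
          (simp_all add: c i' z)
    next
      fix s1 assume s1: "s1 = fupd s' 5 0 c (ent s' 5 0 i)"
      have "run gi GI ?row s1 (n * (1 + icost (V 5) + 2 + fcost ?f + 20 + 2 * icost numN))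
          (\<lambda>s2. ent s2 4 = (ent s1 4)(c := \<lambda>j. if j < n then ent s' 4 c j + ent s' 4 i j else ent s1 4 c j))"
        by (rule run_Row) (use assms c i' ci in \<open>auto simp: unchanged_def s1\<close>)
      then show "run gi GI ?row s1 (n * 50) Q"
      proof (rule run_mono)
        fix s2 assume e4: "ent s2 4 = (ent s1 4)(c := \<lambda>j. if j < n then ent s' 4 c j + ent s' 4 i j else ent s1 4 c j)"
          and un: "unchanged ?row s1 s2"
        have e5: "ent s2 5 = ent s1 5" using un by (simp add: unchanged_def)
        show "Q s2"
          unfolding Q_def
        proof (rule impI)
          assume "paired n A k g c D s"
          then have p: "paired n A k g c D s'"
            and v: "ent s' 5 0 c \<noteq> 0 \<or> (\<forall>r. c \<le> r \<and> r < i \<longrightarrow> ent s' 5 0 r = 0)" using I by auto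
          have "partial_dual n D A k g c ((ent s' 4)(c := \<lambda>j. ent s' 4 c j + ent s' 4 i j))"
            using partial_dual_add_row[OF gen _ ci i] p by (simp add: paired_def)
          then have "partial_dual n D A k g c (ent s2 4)"
            by (rule partial_dual_cong) (auto simp: e4 s1)
          moreover have "ent s2 5 0 r = wdot n D (ent s2 4 r) (g c)" if "r < k" for r
          proof (cases "r = c")
            case True
            have "wdot n D (ent s2 4 c) (g c) = wdot n D (\<lambda>j. ent s' 4 c j + ent s' 4 i j) (g c)"
              by (intro wdot_cong) (auto simp: e4)
            also have "\<dots> = ent s' 5 0 c + ent s' 5 0 i"
              using p assms(6) i by (simp add: wdot_add paired_def)
            finally show ?thesis using True z by (simp add: e5 s1)
          qed (use p that in \<open>simp add: e4 e5 s1 paired_def\<close>)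
          ultimately have "paired n A k g c D s2" by (simp add: paired_def)
          \<comment> \<open>The pivot was 0, so its new pairing is that of row \<open>i\<close>: it
            is nonzero, or row \<open>i\<close> joins the rows with pairing 0.\<close>
          moreover have "ent s2 5 0 c \<noteq> 0 \<or> (\<forall>r. c \<le> r \<and> r < Suc i \<longrightarrow> ent s2 5 0 r = 0)"
            using v z ci by (auto simp: e5 s1 less_Suc_eq)
          ultimately show "paired n A k g c D (iupd s2 6 0 (Suc i)) \<and> (ent (iupd s2 6 0 (Suc i)) 5 0 c \<noteq> 0 \<or>
              (\<forall>r. c \<le> r \<and> r < Suc i \<longrightarrow> ent (iupd s2 6 0 (Suc i)) 5 0 r = 0))"
            by (simp add: paired_def)
        qed
      qed simp
    qed
    have skip: "run gi GI Skip s' 1 Q" if "\<not> (c < i \<and> ent s' 5 0 c = 0)"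
      using that I by (intro run_Skip) (auto simp: Q_def paired_def less_Suc_eq)
    have cond: "run gi GI (Cond ?b (Seq ?set ?row) Skip) s' (tcost GI ?b s' + ((20 + n * 50) + 1)) Q" if "c < i"
      by (rule run_Cond) (use that add skip c in auto)
    have "run gi GI ?body s' (tcost GI (Less (V 5) (V 6)) s' +
        ((tcost GI ?b s' + ((20 + n * 50) + 1)) + 1)) Q"
      by (rule run_Cond) (use cond skip c i' in auto)
    then show "run gi GI ?body s' (n * 50 + 40) (\<lambda>s''. ?I (Suc i) (iupd s'' 6 0 (Suc i)))"
      unfolding Q_def by (rule run_mono) simp_all
  qed (use assms in \<open>auto simp: unchanged_def paired_def\<close>)
  then show ?thesis by (rule run_mono) (simp_all add: algebra_simps)
qed


text \<open>Row \<open>c\<close> is treated like every other row. It survives because its cached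
  pairing, the multiplier, is set to 0 before the sweep.\<close>

definition sweep :: "nat \<Rightarrow> com" where
  "sweep q = For 6 (Idx 0 (Num q)) (Row 4 (V 6) 7 numN
     (FSub (Entry 4 (V 6) (V 7)) (FMul (Entry 5 (Num 0) (V 6)) (Entry 4 (V 5) (V 7)))))"

lemma sweep_arrays [simp]: "iarrays (sweep q) = {6, 7}" "farrays (sweep q) = {4}"
  by (auto simp: sweep_def)

lemma run_sweep:
  assumes "idx s 0 0 = n" "idx s 0 q = k" "k \<le> n" "0 < n" "idx s 5 0 = c" "c < k"
    and c: "ent s 5 0 c = 0"
  shows "run gi GI (sweep q) s (n * (n * 60 + 30))
    (\<lambda>s'. \<forall>r<k. \<forall>j<n. ent s' 4 r j = ent s 4 r j - ent s 5 0 r * ent s 4 c j)"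
proof -
  let ?f = "FSub (Entry 4 (V 6) (V 7)) (FMul (Entry 5 (Num 0) (V 6)) (Entry 4 (V 5) (V 7)))"
  let ?body = "Row 4 (V 6) 7 numN ?f"
  let ?I = "\<lambda>i s'. \<forall>r j. ent s' 4 r j =
    (if r < i \<and> j < n then ent s 4 r j - ent s 5 0 r * ent s 4 c j else ent s 4 r j)"
  have "run gi GI (sweep q) s (n * ((n * 60) + 20 + 2 * icost (Idx 0 (Num q)))) (?I k)"
    unfolding sweep_def
  proof (rule run_For[where I = ?I and N = k])
    fix i s'
    assume i: "i < k" and I: "?I i s'" "idx s' 6 0 = i"
      and u: "unchanged (For 6 (Idx 0 (Num q)) ?body) s s'"
    have cols: "ent s' 4 c = ent s 4 c" using I c by (auto simp: fun_eq_iff)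
    have row: "ent s' 4 i = ent s 4 i" using I by (auto simp: fun_eq_iff)
    have "run gi GI ?body s' (n * (1 + icost (V 6) + 2 + fcost ?f + 20 + 2 * icost numN))
      (\<lambda>s''. ent s'' 4 = (ent s' 4)(i := \<lambda>j. if j < n then ent s 4 i j - ent s 5 0 i * ent s 4 c j else ent s' 4 i j))"
      by (rule run_Row) (use assms I u in \<open>auto simp: unchanged_def cols row\<close>)
    then show "run gi GI ?body s' (n * 60) (\<lambda>s''. ?I (Suc i) (iupd s'' 6 0 (Suc i)))"
      by (rule run_mono) (use I in \<open>auto simp: less_Suc_eq row\<close>)
  qed (use assms in \<open>auto simp: unchanged_def\<close>)
  then show ?thesis by (rule run_mono) auto
qed

text \<open>A zero pivot only lowers the flag. The remaining steps are executed all the same, with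
  quotients by 0 equal to 0, and leave rows about which nothing is claimed.\<close>

definition eliminate :: "nat \<Rightarrow> nat \<Rightarrow> com" where
  "eliminate g q = Seq (pairing g q) (Seq (pivot_row q)
     (Seq (Cond (FEq (Entry 5 (Num 0) (V 5)) Zero) (ISet 4 (Num 0) (Num 0)) Skip)
       (Seq (Row 4 (V 5) 7 numN (FDiv (Entry 4 (V 5) (V 7)) (Entry 5 (Num 0) (V 5))))
         (Seq (FSet 5 (Num 0) (V 5) Zero) (sweep q)))))"

lemma eliminate_arrays [simp]: "iarrays (eliminate g q) = {4, 6, 7}" "farrays (eliminate g q) = {4, 5}"
  by (auto simp: eliminate_def)

text \<open>The second alternative does not mention \<open>c\<close>, so it persists through the
  remaining rounds once it is reached.\<close>

definition dual_or_degenerate ::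
  "nat \<Rightarrow> 'a::field vec set \<Rightarrow> nat \<Rightarrow> (nat \<Rightarrow> nat \<Rightarrow> 'a) \<Rightarrow> (nat \<Rightarrow> 'a) \<Rightarrow> nat \<Rightarrow> 'a state \<Rightarrow> bool" where
  "dual_or_degenerate n A k g D c s \<longleftrightarrow> idx s 4 0 = 1 \<and> partial_dual n D A k g c (ent s 4) \<or>
     idx s 4 0 = 0 \<and> (\<forall>M. \<not> weighted_projector n D A M)"

lemma run_eliminate:
  assumes s: "idx s 0 0 = n" "idx s 0 q = k" "k \<le> n" "0 < n" "idx s 5 0 = c" "c < k" "g \<notin> {4, 5, 6}"
    and gen: "generates n k (ent s g) A" and D: "ent s 6 0 = D"
    and inv: "dual_or_degenerate n A k (ent s g) D c s"
  shows "run gi GI (eliminate g q) s (n * (n * 170 + 240) + 40)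
    (dual_or_degenerate n A k (ent s g) D (Suc c))"
proof -
  let ?g = "ent s g"
  let ?ok = "Cond (FEq (Entry 5 (Num 0) (V 5)) Zero) (ISet 4 (Num 0) (Num 0)) Skip"
  let ?f = "FDiv (Entry 4 (V 5) (V 7)) (Entry 5 (Num 0) (V 5))"
  let ?row = "Row 4 (V 5) 7 numN ?f" and ?z = "FSet 5 (Num 0) (V 5) Zero"
  have "run gi GI (eliminate g q) s (n * (n * 60 + 30) + (n * (n * 50 + 80) + (20 +
      (n * 50 + (10 + n * (n * 60 + 30)))))) (dual_or_degenerate n A k ?g D (Suc c))"
    unfolding eliminate_def
  proof (rule run_Seq)
    show "run gi GI (pairing g q) s (n * (n * 60 + 30))
        (\<lambda>s1. \<forall>r<k. ent s1 5 0 r = wdot n D (ent s 4 r) (?g c))"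
      using run_pairing[OF s(1-4,7)] s D by simp
  next
    fix s1 assume s1: "\<forall>r<k. ent s1 5 0 r = wdot n D (ent s 4 r) (?g c)" "unchanged (pairing g q) s s1"
    have v1: "idx s1 0 = idx s 0" "idx s1 5 = idx s 5" "idx s1 4 = idx s 4" "ent s1 4 = ent s 4"
      using s1(2) by (auto simp: unchanged_def)
    show "run gi GI (Seq (pivot_row q) (Seq ?ok (Seq ?row (Seq ?z (sweep q))))) s1
      (n * (n * 50 + 80) + (20 + (n * 50 + (10 + n * (n * 60 + 30)))))
      (dual_or_degenerate n A k ?g D (Suc c))"
    proof (rule run_Seq)
      show "run gi GI (pivot_row q) s1 (n * (n * 50 + 80)) (\<lambda>s2. paired n A k ?g c D s1 \<longrightarrow>
          paired n A k ?g c D s2 \<and> (ent s2 5 0 c \<noteq> 0 \<or> (\<forall>r. c \<le> r \<and> r < k \<longrightarrow> ent s2 5 0 r = 0)))"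
        by (rule run_pivot_row) (use s v1 gen in simp_all)
    next
      fix s2 assume s2: "paired n A k ?g c D s1 \<longrightarrow> paired n A k ?g c D s2 \<and>
          (ent s2 5 0 c \<noteq> 0 \<or> (\<forall>r. c \<le> r \<and> r < k \<longrightarrow> ent s2 5 0 r = 0))"
        and u2: "unchanged (pivot_row q) s1 s2"
      have v2: "idx s2 0 = idx s 0" "idx s2 5 = idx s 5" "idx s2 4 = idx s 4"
        using u2 by (auto simp: unchanged_def v1)
      \<comment> \<open>Two ways to fail: an earlier column has lowered the flag, or the pivot is
        still 0 after all later rows were considered, so that no row from \<open>c\<close> on pairs
        with \<open>g c\<close>.\<close>
      have degenerate: "\<not> weighted_projector n D A M" if "ent s2 5 0 c = 0 \<or> idx s 4 0 = 0" for M
      proof (cases "idx s 4 0 = 0")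
        case True
        then show ?thesis using inv by (auto simp: dual_or_degenerate_def)
      next
        case False
        then have "paired n A k ?g c D s1" using inv s1(1) v1 by (auto simp: dual_or_degenerate_def paired_def)
        with s2 that False have p: "paired n A k ?g c D s2" "\<forall>r. c \<le> r \<and> r < k \<longrightarrow> ent s2 5 0 r = 0"
          by auto
        show ?thesis
          by (rule partial_dual_degenerate[OF gen _ s(6)]) (use p in \<open>auto simp: paired_def\<close>)
      qed
      have step: "partial_dual n D A k ?g (Suc c) w'"
        if "ent s2 5 0 c \<noteq> 0" "idx s 4 0 \<noteq> 0" "\<And>j. j < n \<Longrightarrow> w' c j = ent s2 4 c j / ent s2 5 0 c"
          "\<And>r j. r < k \<Longrightarrow> j < n \<Longrightarrow> r \<noteq> c \<Longrightarrow> w' r j = ent s2 4 r j - ent s2 5 0 r * w' c j" for w'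
      proof -
        have "paired n A k ?g c D s1"
          using that(2) inv s1(1) v1 by (auto simp: dual_or_degenerate_def paired_def)
        then have "paired n A k ?g c D s2" using s2 by blast
        then show ?thesis
          by (intro partial_dual_Suc[OF gen _ s(6)]) (use that s(6) in \<open>auto simp: paired_def\<close>)
      qed
      show "run gi GI (Seq ?ok (Seq ?row (Seq ?z (sweep q)))) s2
          (20 + (n * 50 + (10 + n * (n * 60 + 30)))) (dual_or_degenerate n A k ?g D (Suc c))"
      proof (rule run_Seq)
        let ?P = "\<lambda>s3. idx s3 4 0 = (if ent s2 5 0 c = 0 then 0 else idx s 4 0)"
        have "run gi GI ?ok s2 (tcost GI (FEq (Entry 5 (Num 0) (V 5)) Zero) s2 + (3 + 1)) ?P"
        proof (rule run_Cond)
          assume "tval gi (FEq (Entry 5 (Num 0) (V 5)) Zero) s2"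
          then show "run gi GI (ISet 4 (Num 0) (Num 0)) s2 3 ?P"
            by (intro run_mono[OF run_ISet[where Q = ?P]]) (simp_all add: v2 s)
        next
          assume "\<not> tval gi (FEq (Entry 5 (Num 0) (V 5)) Zero) s2"
          then show "run gi GI Skip s2 1 ?P" by (intro run_Skip) (simp add: v2 s)
        qed
        then show "run gi GI ?ok s2 20 ?P" by (rule run_mono) auto
      next
        fix s3 assume s3: "idx s3 4 0 = (if ent s2 5 0 c = 0 then 0 else idx s 4 0)"
          and u3: "unchanged ?ok s2 s3"
        have v3: "idx s3 0 = idx s 0" "idx s3 5 = idx s 5" "ent s3 = ent s2"
          using u3 v2 by (auto simp: unchanged_def)
        show "run gi GI (Seq ?row (Seq ?z (sweep q))) s3 (n * 50 + (10 + n * (n * 60 + 30)))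
            (dual_or_degenerate n A k ?g D (Suc c))"
        proof (rule run_Seq)
          have "run gi GI ?row s3 (n * (1 + icost (V 5) + 2 + fcost ?f + 20 + 2 * icost numN))
            (\<lambda>s4. ent s4 4 = (ent s3 4)(c := \<lambda>j. if j < n then ent s2 4 c j / ent s2 5 0 c else ent s3 4 c j))"
            by (rule run_Row) (use s v3 in \<open>auto simp: unchanged_def\<close>)
          then show "run gi GI ?row s3 (n * 50)
            (\<lambda>s4. ent s4 4 = (ent s3 4)(c := \<lambda>j. if j < n then ent s2 4 c j / ent s2 5 0 c else ent s3 4 c j))"
            by (rule run_mono) simp_all
        next
          fix s4 assume s4: "ent s4 4 = (ent s3 4)(c := \<lambda>j. if j < n then ent s2 4 c j / ent s2 5 0 c else ent s3 4 c j)"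
            and u4: "unchanged ?row s3 s4"
          have v4: "idx s4 0 = idx s 0" "idx s4 5 = idx s 5" "idx s4 4 = idx s3 4" "ent s4 5 = ent s2 5"
            using u4 v3 by (auto simp: unchanged_def)
          show "run gi GI (Seq ?z (sweep q)) s4 (10 + n * (n * 60 + 30))
              (dual_or_degenerate n A k ?g D (Suc c))"
          proof (rule run_Seq)
            show "run gi GI ?z s4 10 (\<lambda>s5. s5 = fupd s4 5 0 c 0)"
              by (rule run_mono[OF run_FSet[where Q = "\<lambda>s5. s5 = fupd s4 5 0 c 0"]])
                (simp_all add: v4 s)
          next
            fix s5 assume s5: "s5 = fupd s4 5 0 c 0"
            have "run gi GI (sweep q) s5 (n * (n * 60 + 30))
              (\<lambda>s6. \<forall>r<k. \<forall>j<n. ent s6 4 r j = ent s5 4 r j - ent s5 5 0 r * ent s5 4 c j)"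
              by (rule run_sweep) (use s v4 in \<open>simp_all add: s5\<close>)
            then show "run gi GI (sweep q) s5 (n * (n * 60 + 30)) (dual_or_degenerate n A k ?g D (Suc c))"
            proof (rule run_mono)
              fix s6 assume w6: "\<forall>r<k. \<forall>j<n. ent s6 4 r j = ent s5 4 r j - ent s5 5 0 r * ent s5 4 c j"
                and u6: "unchanged (sweep q) s5 s6"
              have ok: "idx s6 4 0 = (if ent s2 5 0 c = 0 then 0 else idx s 4 0)"
                using u6 s3 by (simp add: unchanged_def s5 v4)
              show "dual_or_degenerate n A k ?g D (Suc c) s6"
              proof (cases "ent s2 5 0 c = 0 \<or> idx s 4 0 = 0")
                case True
                then show ?thesis using degenerate ok by (auto simp: dual_or_degenerate_def)
              next
                case False
                have "partial_dual n D A k ?g (Suc c) (ent s6 4)"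
                  by (rule step) (use False w6 s(6) in \<open>auto simp: s5 s4 v4 v3\<close>)
                moreover have "idx s 4 0 = 1" using inv False by (auto simp: dual_or_degenerate_def)
                ultimately show ?thesis using ok False by (simp add: dual_or_degenerate_def)
              qed
            qed simp
          qed
        qed
      qed
    qed
  qed
  then show ?thesis by (rule run_mono) (simp_all add: algebra_simps)
qed

definition projector :: "nat \<Rightarrow> nat \<Rightarrow> nat \<Rightarrow> com" where
  "projector g q m = Seq (ISet 4 (Num 0) (Num 1))
     (Seq (For 5 (Idx 0 (Num q)) (Row 4 (V 5) 7 numN (Entry g (V 5) (V 7))))
       (Seq (For 5 (Idx 0 (Num q)) (eliminate g q))
         (Sum_matrix m (Idx 0 (Num q)) (FMul (Entry g (V 6) (V 5)) (Entry 4 (V 6) (V 7))))))"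

lemma projector_arrays [simp]:
  "iarrays (projector g q m) = {4, 5, 6, 7}" "farrays (projector g q m) = {4, 5, m}"
  by (auto simp: projector_def)

lemma run_projector:
  assumes s: "idx s 0 0 = n" "idx s 0 q = k" "k \<le> n" "0 < n"
    and gm: "g \<notin> {4, 5, 6}" "m \<notin> {4, 5, 6}" "m \<noteq> g"
    and gen: "generates n k (ent s g) A"
  shows "run gi GI (projector g q m) s (1000 * n ^ 3)
    (\<lambda>s'. idx s' 4 0 = 1 \<and> weighted_projector n (ent s 6 0) A (ent s' m) \<or>
      idx s' 4 0 = 0 \<and> (\<forall>M. \<not> weighted_projector n (ent s 6 0) A M))"
proof -
  let ?g = "ent s g" and ?D = "ent s 6 0" and ?K = "Idx 0 (Num q)"
  let ?row = "Row 4 (V 5) 7 numN (Entry g (V 5) (V 7))"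
  let ?f = "FMul (Entry g (V 6) (V 5)) (Entry 4 (V 6) (V 7))"
  let ?sum = "Sum_matrix m ?K ?f"
  let ?Q = "\<lambda>s'. idx s' 4 0 = 1 \<and> weighted_projector n ?D A (ent s' m) \<or>
      idx s' 4 0 = 0 \<and> (\<forall>M. \<not> weighted_projector n ?D A M)"
  have "run gi GI (projector g q m) s (3 + (n * (n * 50 + 30) +
      (n * (n * (n * 170 + 240) + 40 + 30) + n * (n * (n * 80 + 30) + 30)))) ?Q"
    unfolding projector_def
  proof (rule run_Seq)
    show "run gi GI (ISet 4 (Num 0) (Num 1)) s 3 (\<lambda>s1. s1 = iupd s 4 0 1)"
      by (rule run_mono[OF run_ISet[where Q = "\<lambda>s1. s1 = iupd s 4 0 1"]]) simp_all
  next
    fix s1 assume s1: "s1 = iupd s 4 0 1"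
    show "run gi GI (Seq (For 5 ?K ?row) (Seq (For 5 ?K (eliminate g q)) ?sum)) s1
      (n * (n * 50 + 30) + (n * (n * (n * 170 + 240) + 40 + 30) + n * (n * (n * 80 + 30) + 30))) ?Q"
    proof (rule run_Seq)
      let ?I = "\<lambda>i s'. \<forall>r<i. \<forall>j<n. ent s' 4 r j = ?g r j"
      have "run gi GI (For 5 ?K ?row) s1 (n * (n * 50 + 20 + 2 * icost ?K)) (?I k)"
      proof (rule run_For[where I = ?I and N = k])
        fix i s'
        assume i: "i < k" and I: "?I i s'" "idx s' 5 0 = i" and u: "unchanged (For 5 ?K ?row) s1 s'"
        have "run gi GI ?row s' (n * (1 + icost (V 5) + 2 + fcost (Entry g (V 5) (V 7)) + 20 + 2 * icost numN))
          (\<lambda>s''. ent s'' 4 = (ent s' 4)(i := \<lambda>j. if j < n then ?g i j else ent s' 4 i j))"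
          by (rule run_Row) (use s gm I u in \<open>auto simp: unchanged_def s1\<close>)
        then show "run gi GI ?row s' (n * 50) (\<lambda>s''. ?I (Suc i) (iupd s'' 5 0 (Suc i)))"
          by (rule run_mono) (use I in \<open>auto simp: less_Suc_eq\<close>)
      qed (use s in \<open>auto simp: unchanged_def s1\<close>)
      then show "run gi GI (For 5 ?K ?row) s1 (n * (n * 50 + 30)) (?I k)"
        by (rule run_mono) auto
    next
      fix s2 assume s2: "\<forall>r<k. \<forall>j<n. ent s2 4 r j = ?g r j" and u2: "unchanged (For 5 ?K ?row) s1 s2"
      have v2: "idx s2 0 = idx s 0" "idx s2 4 0 = 1" "ent s2 g = ?g" "ent s2 6 0 = ?D"
        using u2 gm by (auto simp: unchanged_def s1)
      show "run gi GI (Seq (For 5 ?K (eliminate g q)) ?sum) s2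
        (n * (n * (n * 170 + 240) + 40 + 30) + n * (n * (n * 80 + 30) + 30)) ?Q"
      proof (rule run_Seq)
        have "run gi GI (For 5 ?K (eliminate g q)) s2 (n * ((n * (n * 170 + 240) + 40) + 20 + 2 * icost ?K))
          (dual_or_degenerate n A k ?g ?D k)"
        proof (rule run_For[where I = "dual_or_degenerate n A k ?g ?D" and N = k])
          have "partial_dual n ?D A k ?g 0 (ent s2 4)"
            by (rule partial_dual_cong[OF partial_dual_start[OF gen]]) (use s2 in auto)
          then show "dual_or_degenerate n A k ?g ?D 0 (iupd s2 5 0 0)"
            using v2 by (simp add: dual_or_degenerate_def)
        next
          fix i s'
          assume i: "i < k" and I: "dual_or_degenerate n A k ?g ?D i s'" "idx s' 5 0 = i"
            and u: "unchanged (For 5 ?K (eliminate g q)) s2 s'"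
          have v': "idx s' 0 = idx s 0" "ent s' g = ?g" "ent s' 6 0 = ?D"
            using u gm v2 by (auto simp: unchanged_def)
          have "run gi GI (eliminate g q) s' (n * (n * 170 + 240) + 40)
              (dual_or_degenerate n A k (ent s' g) ?D (Suc i))"
            by (rule run_eliminate) (use s gm gen v' i I in auto)
          then show "run gi GI (eliminate g q) s' (n * (n * 170 + 240) + 40)
            (\<lambda>s''. dual_or_degenerate n A k ?g ?D (Suc i) (iupd s'' 5 0 (Suc i)))"
            by (rule run_mono) (simp_all add: dual_or_degenerate_def v')
        qed (use s v2 in \<open>auto simp: unchanged_def\<close>)
        then show "run gi GI (For 5 ?K (eliminate g q)) s2 (n * (n * (n * 170 + 240) + 40 + 30))
          (dual_or_degenerate n A k ?g ?D k)"
          by (rule run_mono) auto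
      next
        fix s3 assume s3: "dual_or_degenerate n A k ?g ?D k s3"
          and u3: "unchanged (For 5 ?K (eliminate g q)) s2 s3"
        have v3: "idx s3 0 = idx s 0" "ent s3 g = ?g" "ent s3 6 0 = ?D"
          using u3 gm v2 by (auto simp: unchanged_def)
        let ?J = "\<lambda>s'. \<forall>i<n. \<forall>j<n. ent s' m i j = (\<Sum>r<k. ?g r i * ent s3 4 r j)"
        have "run gi GI ?sum s3 (n * (n * (n * (50 + fcost ?f + 2 * icost ?K) + 30) + 30)) ?J"
          by (rule run_Sum_matrix) (use s gm v3 in \<open>auto simp: unchanged_def\<close>)
        then show "run gi GI ?sum s3 (n * (n * (n * 80 + 30) + 30)) ?Q"
        proof (rule run_mono)
          fix s4 assume J: "?J s4" and u4: "unchanged ?sum s3 s4"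
          have ok: "idx s4 4 0 = idx s3 4 0" using u4 by (auto simp: unchanged_def)
          have "weighted_projector n ?D A (ent s4 m)" if "partial_dual n ?D A k ?g k (ent s3 4)"
            by (rule partial_dual_projector[OF gen that]) (use J in auto)
          then show "?Q s4" using s3 ok by (auto simp: dual_or_degenerate_def)
        qed simp
      qed
    qed
  qed
  \<comment> \<open>Each lower power of \<open>n\<close> is at most n^3, so the coefficient sum 3 +
    130 + 320 + 250 = 703 stays below 1000.\<close>
  moreover have "3 + (n * (n * 50 + 30) +
      (n * (n * (n * 170 + 240) + 40 + 30) + n * (n * (n * 80 + 30) + 30))) \<le> 1000 * n ^ 3"
  proof -
    have "1 \<le> n ^ 3" "n \<le> n ^ 3" "n ^ 2 \<le> n ^ 3"
      using s(4) power_increasing[of _ 3 n] power_increasing[of 1 3 n] by (auto simp: Suc_le_eq)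
    moreover have "3 + (n * (n * 50 + 30) +
        (n * (n * (n * 170 + 240) + 40 + 30) + n * (n * (n * 80 + 30) + 30))) =
        3 + 130 * n + 320 * n ^ 2 + 250 * n ^ 3"
      by (simp add: algebra_simps power2_eq_square power3_eq_cube)
    ultimately show ?thesis by linarith
  qed
  ultimately show ?thesis by (rule run_mono)
qed

section \<open>Enumerating coordinate sets\<close>

primrec digit :: "nat \<Rightarrow> nat \<Rightarrow> nat \<Rightarrow> nat" where
  "digit b 0 m = m mod b"
| "digit b (Suc i) m = digit b i (m div b)"

lemma digit_eq: "digit b i m = m div b ^ i mod b"
  by (induction i arbitrary: m) (simp_all add: div_mult2_eq)

lemma digit_less: "0 < b \<Longrightarrow> digit b i m < b"
  by (simp add: digit_eq)

lemma digit_large: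
  assumes "m < b ^ l" "l \<le> i"
  shows "digit b i m = 0"
proof (cases "b = 0")
  case False
  then have "b ^ l \<le> b ^ i" using assms(2) by (intro power_increasing) auto
  then show ?thesis using assms(1) by (simp add: digit_eq)
qed (use assms in \<open>auto simp: digit_eq power_0_left split: if_splits\<close>)

lemma digit_power: "1 < b \<Longrightarrow> digit b l (b ^ l) = 1"
  by (simp add: digit_eq)

lemma digit_zero: "digit b i 0 = 0"
  by (simp add: digit_eq)

text \<open>Induction on the length \<open>p\<close> of the carry chain: the least significant digit
  either absorbs the increment or becomes 0 and passes it on to the quotient. The case distinction
  is the one made by the loop of \<open>increment\<close>.\<close>

lemma digit_Suc_number:
  assumes "0 < n" "\<And>i. i < p \<Longrightarrow> digit (Suc n) i m = n" "digit (Suc n) p m \<noteq> n"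
  shows "digit (Suc n) i (Suc m) =
    (if i < p then 0 else if i = p then Suc (digit (Suc n) p m) else digit (Suc n) i m)"
  using assms(2,3)
proof (induction p arbitrary: i m)
  case 0
  then have "Suc (m mod Suc n) \<noteq> Suc n" by simp
  then have "Suc m mod Suc n = Suc (m mod Suc n)" "Suc m div Suc n = m div Suc n"
    by (simp_all add: mod_Suc div_Suc)
  then show ?case by (cases i) auto
next
  case (Suc p)
  have "m mod Suc n = n" using Suc.prems(1)[of 0] by simp
  then have c: "Suc m mod Suc n = 0" "Suc m div Suc n = Suc (m div Suc n)"
    by (simp_all add: mod_Suc div_Suc)
  have IH: "digit (Suc n) j (Suc (m div Suc n)) = (if j < p then 0 else if j = p
      then Suc (digit (Suc n) p (m div Suc n)) else digit (Suc n) j (m div Suc n))" for j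
  proof (rule Suc.IH)
    show "digit (Suc n) i (m div Suc n) = n" if "i < p" for i
      using Suc.prems(1)[of "Suc i"] that by simp
  qed (use Suc.prems(2) in simp)
  show ?case using c IH by (cases i) auto
qed

lemma ex_digits:
  assumes "\<And>i. i < l \<Longrightarrow> d i < b"
  shows "\<exists>m<b ^ l. \<forall>i<l. digit b i m = d i"
  using assms
proof (induction l arbitrary: d)
  case (Suc l)
  obtain m where m: "m < b ^ l" "\<And>i. i < l \<Longrightarrow> digit b i m = d (Suc i)"
    using Suc.IH[of "\<lambda>i. d (Suc i)"] Suc.prems by auto
  have d0: "d 0 < b" using Suc.prems by simp
  have "d 0 + b * m < b * Suc m" using d0 by simp
  also have "\<dots> \<le> b ^ Suc l" using m(1) by (simp only: power_Suc Suc_le_eq mult_le_mono2)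
  finally have "d 0 + b * m < b ^ Suc l" .
  moreover have "digit b i (d 0 + b * m) = d i" if "i < Suc l" for i
    using that d0 m(2) by (cases i) auto
  ultimately show ?case by blast
qed simp

text \<open>Digit \<open>v + 1\<close> of \<open>m\<close> removes coordinate \<open>v\<close>; digit 0 removes nothing.\<close>

definition weights :: "nat \<Rightarrow> nat \<Rightarrow> nat \<Rightarrow> 'a::field" where
  "weights n m j = (if \<exists>i. digit (Suc n) i m = Suc j then 0 else 1)"

lemma weights_less:
  "m < Suc n ^ l \<Longrightarrow> weights n m j = (if \<exists>i<l. digit (Suc n) i m = Suc j then 0 else 1)"
  using digit_large[of m "Suc n" l] unfolding weights_def by (metis not_le nat.distinct(1))

text \<open>Each removed coordinate needs a digit of its own, and only the lowest \<open>l\<close>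
  digits can be nonzero.\<close>

lemma card_weights_zero:
  assumes "m < Suc n ^ l"
  shows "card {j. (weights n m j :: 'a::field) = 0} \<le> l"
proof -
  have "{j. (weights n m j :: 'a) = 0} \<subseteq> (\<lambda>i. digit (Suc n) i m - 1) ` {..<l}"
    by (force simp: weights_less[OF assms] split: if_splits)
  then have "card {j. (weights n m j :: 'a) = 0} \<le> card {..<l}" by (rule surj_card_le[rotated]) simp
  then show ?thesis by simp
qed

lemma ex_weights:
  assumes "S \<subseteq> {..<n}" "card S \<le> l"
  obtains m where "m < Suc n ^ l" "\<And>j. weights n m j = (if j \<in> S then 0 else 1)"
proof -
  have fin: "finite S" using assms(1) finite_subset by blast
  obtain xs where xs: "set xs = S" "distinct xs" using finite_distinct_list[OF fin] by blast
  have len: "length xs \<le> l" using xs assms(2) distinct_card by metis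
  define d where "d i = (if i < length xs then Suc (xs ! i) else 0)" for i
  have "d i < Suc n" for i
    using assms(1) xs(1) nth_mem[of i xs] by (auto simp: d_def)
  then obtain m where m: "m < Suc n ^ l" "\<forall>i<l. digit (Suc n) i m = d i"
    using ex_digits[of l d "Suc n"] by blast
  have "(\<exists>i<l. digit (Suc n) i m = Suc j) \<longleftrightarrow> j \<in> S" for j
  proof
    assume "\<exists>i<l. digit (Suc n) i m = Suc j"
    then obtain i where "d i = Suc j" using m(2) by auto
    then have "i < length xs" "xs ! i = j" by (auto simp: d_def split: if_splits)
    then show "j \<in> S" using nth_mem xs(1) by blast
  next
    assume "j \<in> S"
    then obtain i where "i < length xs" "xs ! i = j" using xs(1) by (metis in_set_conv_nth)
    then have "i < l" "d i = Suc j" using len by (simp_all add: d_def)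
    then show "\<exists>i<l. digit (Suc n) i m = Suc j" using m(2) by auto
  qed
  then have "weights n m j = (if j \<in> S then 0 else 1)" for j
    by (simp add: weights_less[OF m(1)])
  with m(1) show ?thesis using that by blast
qed

section \<open>The base n + 1 counter as a program\<close>

definition increment :: com where
  "increment = Seq (ISet 8 (Num 0) (Num 0))
     (Seq (Loop (Neg (Less (Idx 2 (V 8)) numN))
         (Seq (ISet 2 (V 8) (Num 0)) (ISet 8 (Num 0) (Add (V 8) (Num 1)))))
       (ISet 2 (V 8) (Add (Idx 2 (V 8)) (Num 1))))"

lemma increment_arrays [simp]: "iarrays increment = {2, 8}" "farrays increment = {}"
  by (auto simp: increment_def)

text \<open>Digit \<open>l\<close> of \<open>m\<close> is 0 and thus different from
  \<open>n\<close>, so the carry stops at position \<open>l\<close> at the latest. This makes the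
  time linear in \<open>n\<close>.\<close>

lemma run_increment:
  fixes s :: "'a::field state"
  assumes n: "idx s 0 0 = n" "0 < n" and T: "idx s 2 = (\<lambda>i. digit (Suc n) i m)"
    and m: "m < Suc n ^ l" "l \<le> n"
  shows "run gi GI increment s (70 * n) (\<lambda>s'. idx s' 2 = (\<lambda>i. digit (Suc n) i (Suc m)))"
proof -
  define p where "p = (LEAST i. digit (Suc n) i m \<noteq> n)"
  have l: "digit (Suc n) l m \<noteq> n" using digit_large[OF m(1)] n by simp
  have p: "digit (Suc n) p m \<noteq> n" "p \<le> l" "\<And>i. i < p \<Longrightarrow> digit (Suc n) i m = n"
    using LeastI[of "\<lambda>i. digit (Suc n) i m \<noteq> n", OF l] Least_le[of "\<lambda>i. digit (Suc n) i m \<noteq> n", OF l]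
      not_less_Least[of _ "\<lambda>i. digit (Suc n) i m \<noteq> n"]
    unfolding p_def by blast+
  let ?b = "Neg (Less (Idx 2 (V 8)) numN)"
  let ?c = "Seq (ISet 2 (V 8) (Num 0)) (ISet 8 (Num 0) (Add (V 8) (Num 1)))"
  let ?I = "\<lambda>i s'. idx s' 8 0 = i \<and> idx s' 2 = (\<lambda>j. if j < i then 0 else digit (Suc n) j m)"
  have "run gi GI increment s (3 + ((p * (20 + 10) + 10) + 20))
      (\<lambda>s'. idx s' 2 = (\<lambda>i. digit (Suc n) i (Suc m)))"
    unfolding increment_def
  proof (rule run_Seq)
    show "run gi GI (ISet 8 (Num 0) (Num 0)) s 3 (\<lambda>s1. s1 = iupd s 8 0 0)"
      by (rule run_mono[OF run_ISet[where Q = "\<lambda>s1. s1 = iupd s 8 0 0"]]) simp_all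
  next
    fix s1 assume s1: "s1 = iupd s 8 0 0"
    show "run gi GI (Seq (Loop ?b ?c) (ISet 2 (V 8) (Add (Idx 2 (V 8)) (Num 1)))) s1
        ((p * (20 + 10) + 10) + 20) (\<lambda>s'. idx s' 2 = (\<lambda>i. digit (Suc n) i (Suc m)))"
    proof (rule run_Seq)
      show "run gi GI (Loop ?b ?c) s1 (p * (20 + 10) + 10) (?I p)"
      proof (rule run_Loop)
        show "?I 0 s1" using T by (simp add: s1)
      next
        fix i s' assume i: "i < p" and I: "?I i s'" and u: "unchanged ?c s1 s'"
        have n': "idx s' 0 0 = n" using u n by (simp add: unchanged_def s1)
        let ?s = "iupd s' 2 i 0"
        have "run gi GI ?c s' (4 + 7) (?I (Suc i))"
        proof (rule run_Seq)
          show "run gi GI (ISet 2 (V 8) (Num 0)) s' 4 (\<lambda>s2. s2 = ?s)"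
            by (rule run_mono[OF run_ISet[where Q = "\<lambda>s2. s2 = ?s"]]) (use I in simp_all)
          show "run gi GI (ISet 8 (Num 0) (Add (V 8) (Num 1))) s2 7 (?I (Suc i))" if "s2 = ?s" for s2
            by (rule run_mono[OF run_ISet[where Q = "?I (Suc i)"]])
              (use I that in \<open>auto simp: fun_eq_iff\<close>)
        qed
        then have "run gi GI ?c s' 20 (?I (Suc i))" by (rule run_mono) auto
        then show "tval gi ?b s' \<and> tcost GI ?b s' \<le> 10 \<and> run gi GI ?c s' 20 (?I (Suc i))"
          using I i p(3) n' by simp
      next
        fix s' assume I: "?I p s'" and u: "unchanged ?c s1 s'"
        have "idx s' 0 0 = n" using u n by (simp add: unchanged_def s1)
        moreover have "digit (Suc n) p m < n" using p(1) digit_less[of "Suc n" p m] by simp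
        ultimately show "\<not> tval gi ?b s' \<and> tcost GI ?b s' \<le> 10" using I by simp
      qed
    next
      fix s2 :: "'a state" assume I: "?I p s2"
      show "run gi GI (ISet 2 (V 8) (Add (Idx 2 (V 8)) (Num 1))) s2 20
          (\<lambda>s'. idx s' 2 = (\<lambda>i. digit (Suc n) i (Suc m)))"
        by (rule run_mono[OF run_ISet[where Q = "\<lambda>s'. idx s' 2 = (\<lambda>i. digit (Suc n) i (Suc m))"]])
          (use I in \<open>auto simp: fun_eq_iff digit_Suc_number[OF n(2) p(3,1)]\<close>)
    qed
  qed
  then show ?thesis by (rule run_mono) (use p(2) m(2) n(2) in simp_all)
qed

text \<open>The guard matters: for digit 0 the truncated subtraction would yield 0 and remove
  coordinate 0.\<close>

definition load_weights :: com where
  "load_weights = Seq (Row 6 (Num 0) 7 numN One)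
     (For 6 (V 3) (Cond (Less (Num 0) (Idx 2 (V 6)))
       (FSet 6 (Num 0) (Sub (Idx 2 (V 6)) (Num 1)) Zero) Skip))"

lemma load_weights_arrays [simp]: "iarrays load_weights = {6, 7}" "farrays load_weights = {6}"
  by (auto simp: load_weights_def)

lemma run_load_weights:
  assumes n: "idx s 0 0 = n" "0 < n" and T: "idx s 2 = (\<lambda>i. digit (Suc n) i m)"
    and l: "idx s 3 0 = l" "m < Suc n ^ l" "l \<le> n"
  shows "run gi GI load_weights s (90 * n) (\<lambda>s'. \<forall>j<n. ent s' 6 0 j = weights n m j)"
proof -
  let ?set = "FSet 6 (Num 0) (Sub (Idx 2 (V 6)) (Num 1)) Zero"
  let ?b = "Less (Num 0) (Idx 2 (V 6))"
  let ?I = "\<lambda>i s'. \<forall>j<n. ent s' 6 0 j = (if \<exists>i'<i. digit (Suc n) i' m = Suc j then 0 else 1)"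
  have "run gi GI load_weights s (n * 40 + n * (24 + 20 + 2 * icost (V 3))) (?I l)"
    unfolding load_weights_def
  proof (rule run_Seq)
    have "run gi GI (Row 6 (Num 0) 7 numN One) s
      (n * (1 + icost (Num 0) + 2 + fcost One + 20 + 2 * icost numN))
      (\<lambda>s'. ent s' 6 = (ent s 6)(0 := \<lambda>j. if j < n then 1 else ent s 6 0 j))"
      by (rule run_Row) (use n in \<open>auto simp: unchanged_def\<close>)
    then show "run gi GI (Row 6 (Num 0) 7 numN One) s (n * 40) (\<lambda>s'. \<forall>j<n. ent s' 6 0 j = 1)"
      by (rule run_mono) auto
  next
    fix s1 assume s1: "\<forall>j<n. ent s1 6 0 j = 1" and u1: "unchanged (Row 6 (Num 0) 7 numN One) s s1"
    show "run gi GI (For 6 (V 3) (Cond ?b ?set Skip)) s1 (n * (24 + 20 + 2 * icost (V 3))) (?I l)"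
    proof (rule run_For[where I = ?I and N = l])
      fix i s' assume i: "i < l" and I: "?I i s'" "idx s' 6 0 = i"
        and u: "unchanged (For 6 (V 3) (Cond ?b ?set Skip)) s1 s'"
      have T': "idx s' 2 = (\<lambda>i. digit (Suc n) i m)" using u u1 T by (auto simp: unchanged_def)
      let ?Q = "\<lambda>s''. ?I (Suc i) (iupd s'' 6 0 (Suc i))"
      have "run gi GI (Cond ?b ?set Skip) s' (tcost GI ?b s' + (9 + 1)) ?Q"
      proof (rule run_Cond)
        assume b: "tval gi ?b s'"
        show "run gi GI ?set s' 9 ?Q"
          by (rule run_mono[OF run_FSet[where Q = ?Q]]) (use I T' b in \<open>auto simp: less_Suc_eq\<close>)
      next
        assume b: "\<not> tval gi ?b s'"
        show "run gi GI Skip s' 1 ?Q"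
          by (rule run_Skip) (use I T' b in \<open>auto simp: less_Suc_eq\<close>)
      qed
      then show "run gi GI (Cond ?b ?set Skip) s' 24 ?Q" by (rule run_mono) auto
    qed (use s1 u1 l n in \<open>auto simp: unchanged_def\<close>)
  qed
  then show ?thesis
    by (rule run_mono) (simp_all add: weights_less[OF l(2)])
qed

section \<open>The decision procedure\<close>

lemma weighted_projector_weights_cong:
  assumes "\<And>j. j < n \<Longrightarrow> D j = D' j"
  shows "weighted_projector n D A M \<longleftrightarrow> weighted_projector n D' A M"
proof -
  have "wdot n D x y = wdot n D' x y" for x y
    unfolding wdot_def using assms by (intro sum.cong) auto
  then show ?thesis by (simp add: weighted_projector_def)
qed

text \<open>Needed before the oracle may be consulted, since it is specified for symmetric matrices
  only.\<close>

lemma weighted_projector_graph: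
  assumes "weighted_projector n D A M"
  shows "weighted_graph n (mat n n (\<lambda>(i, j). M i j))"
  unfolding weighted_graph_def
  using weighted_projector_sym[OF assms] by (auto intro!: eq_matI)

definition attempt :: "nat \<Rightarrow> nat \<Rightarrow> nat \<Rightarrow> com" where
  "attempt g q m = Seq load_weights (projector g q m)"

lemma attempt_arrays [simp]:
  "iarrays (attempt g q m) = {4, 5, 6, 7}" "farrays (attempt g q m) = {4, 5, 6, m}"
  by (auto simp: attempt_def)

lemma run_attempt:
  fixes s :: "'a::field state"
  assumes s: "idx s 0 0 = n" "idx s 0 q = k" "k \<le> n" "0 < n"
    and gm: "g \<notin> {4, 5, 6}" "m \<notin> {4, 5, 6}" "m \<noteq> g"
    and gen: "generates n k (ent s g) A"
    and T: "idx s 2 = (\<lambda>i. digit (Suc n) i v)" and l: "idx s 3 0 = l" "v < Suc n ^ l" "l \<le> n"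
  shows "run gi GI (attempt g q m) s (1100 * n ^ 3)
    (\<lambda>s'. idx s' 4 0 = 1 \<and> weighted_projector n (weights n v) A (ent s' m) \<or>
      idx s' 4 0 = 0 \<and> (\<forall>M. \<not> weighted_projector n (weights n v) A M))"
proof -
  have "run gi GI (attempt g q m) s (90 * n + 1000 * n ^ 3)
    (\<lambda>s'. idx s' 4 0 = 1 \<and> weighted_projector n (weights n v) A (ent s' m) \<or>
      idx s' 4 0 = 0 \<and> (\<forall>M. \<not> weighted_projector n (weights n v) A M))"
    unfolding attempt_def
  proof (rule run_Seq)
    show "run gi GI load_weights s (90 * n) (\<lambda>s'. \<forall>j<n. ent s' 6 0 j = weights n v j)"
      by (rule run_load_weights[OF s(1,4) T l])
  next
    fix s1 :: "'a state"
    assume s1: "\<forall>j<n. ent s1 6 0 j = weights n v j" and u: "unchanged load_weights s s1"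
    have eq: "weighted_projector n (ent s1 6 0) A M \<longleftrightarrow> weighted_projector n (weights n v) A M" for M
      using s1 by (intro weighted_projector_weights_cong) auto
    have "run gi GI (projector g q m) s1 (1000 * n ^ 3)
        (\<lambda>s'. idx s' 4 0 = 1 \<and> weighted_projector n (ent s1 6 0) A (ent s' m) \<or>
          idx s' 4 0 = 0 \<and> (\<forall>M. \<not> weighted_projector n (ent s1 6 0) A M))"
      by (rule run_projector) (use u s gm gen in \<open>auto simp: unchanged_def\<close>)
    then show "run gi GI (projector g q m) s1 (1000 * n ^ 3)
        (\<lambda>s'. idx s' 4 0 = 1 \<and> weighted_projector n (weights n v) A (ent s' m) \<or>
          idx s' 4 0 = 0 \<and> (\<forall>M. \<not> weighted_projector n (weights n v) A M))"
      unfolding eq .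
  qed
  moreover have "n \<le> n ^ 3" using power_increasing[of 1 3 n] s(4) by simp
  ultimately show ?thesis by (elim run_mono) auto
qed

text \<open>The exact length of \<open>m\<close> in base n + 1, with length 0 for the number 0.
  Exactness is what turns a success below (n + 1)^h into a length of at most h.\<close>

definition digit_count :: "nat \<Rightarrow> nat \<Rightarrow> nat \<Rightarrow> bool" where
  "digit_count n l m \<longleftrightarrow> m < Suc n ^ l \<and> (l = 0 \<or> Suc n ^ (l - 1) \<le> m)"

lemma digit_count_le:
  assumes "digit_count n l m" "m < Suc n ^ h"
  shows "l \<le> h"
proof (rule ccontr)
  assume "\<not> l \<le> h"
  then have "Suc n ^ h \<le> Suc n ^ (l - 1)" "l \<noteq> 0" by (auto intro!: power_increasing)
  then show False using assms by (auto simp: digit_count_def)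
qed

text \<open>The length grows only when a power of the base is reached, and then digit
  \<open>l\<close> becomes nonzero. Testing this single digit is enough to maintain the
  length.\<close>

lemma digit_count_Suc:
  assumes "digit_count n l m" "0 < n"
  shows "digit_count n (if 0 < digit (Suc n) l (Suc m) then Suc l else l) (Suc m)"
proof (cases "Suc m = Suc n ^ l")
  case True
  have "Suc n ^ l * 1 < Suc n ^ l * Suc n" using assms(2) by (intro mult_strict_left_mono) auto
  then show ?thesis using True digit_power[of "Suc n" l] assms(2) by (simp add: digit_count_def)
next
  case False
  then have "Suc m < Suc n ^ l" using assms(1) by (auto simp: digit_count_def)
  then show ?thesis using digit_large[of "Suc m" "Suc n" l l] assms(1) by (auto simp: digit_count_def)
qed

definition grow :: com where
  "grow = Cond (Less (Num 0) (Idx 2 (V 3))) (ISet 3 (Num 0) (Add (V 3) (Num 1))) Skip"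

lemma grow_arrays [simp]: "iarrays grow = {3}" "farrays grow = {}"
  by (auto simp: grow_def)

lemma run_grow:
  "run gi GI grow s 20 (\<lambda>s'. idx s' 3 0 = (if 0 < idx s 2 (idx s 3 0) then Suc (idx s 3 0) else idx s 3 0))"
proof -
  let ?b = "Less (Num 0) (Idx 2 (V 3))" and ?c = "ISet 3 (Num 0) (Add (V 3) (Num 1))"
  let ?Q = "\<lambda>s'. idx s' 3 0 = (if 0 < idx s 2 (idx s 3 0) then Suc (idx s 3 0) else idx s 3 0)"
  have "run gi GI grow s (tcost GI ?b s + (7 + 1)) ?Q"
    unfolding grow_def
  proof (rule run_Cond)
    assume "tval gi ?b s"
    then show "run gi GI ?c s 7 ?Q"
      by (intro run_mono[OF run_ISet[where Q = ?Q]]) simp_all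
  next
    assume "\<not> tval gi ?b s"
    then show "run gi GI Skip s 1 ?Q" by (intro run_Skip) simp
  qed
  then show ?thesis by (rule run_mono) simp_all
qed

section \<open>Search for weights on the first code\<close>

definition search :: com where
  "search = Seq (attempt 0 1 2)
     (Loop (Less (V 4) (Num 1)) (Seq increment (Seq grow (attempt 0 1 2))))"

lemma search_arrays [simp]: "iarrays search = {2, 3, 4, 5, 6, 7, 8}" "farrays search = {2, 4, 5, 6}"
  by (auto simp: search_def)

text \<open>The premises provide some successful \<open>v\<close> below (n + 1)^h, but the search
  stops at the least success \<open>N\<close>; what counts is that \<open>N\<close> is at most
  \<open>v\<close>. The empty set, number 0, is tried before the loop.\<close>

lemma run_search:
  fixes s :: "'a::field state"
  assumes s: "idx s 0 0 = n" "idx s 0 1 = k" "k \<le> n" "0 < n" "idx s 2 = (\<lambda>_. 0)" "idx s 3 0 = 0"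
    and gen: "generates n k (ent s 0) A"
    and ex: "v < Suc n ^ h" "h \<le> n" "weighted_projector n (weights n v) A M"
  shows "run gi GI search s (Suc n ^ h * (3000 * n ^ 3))
    (\<lambda>s'. \<exists>u l. u < Suc n ^ l \<and> l \<le> h \<and> idx s' 3 0 = l \<and> idx s' 2 = (\<lambda>i. digit (Suc n) i u) \<and>
      weighted_projector n (weights n u) A (ent s' 2))"
proof -
  \<comment> \<open>All numbers below \<open>N\<close> fail, so this is the exact number of rounds
    that the loop rule asks for.\<close>
  define N where "N = (LEAST u. \<exists>M. weighted_projector n (weights n u) A M)"
  have N: "\<exists>M. weighted_projector n (weights n N) A M" "N \<le> v"
    "\<And>u. u < N \<Longrightarrow> \<not> (\<exists>M. weighted_projector n (weights n u) A M)"
    using LeastI[of "\<lambda>u. \<exists>M. weighted_projector n (weights n u) A M" v]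
      Least_le[of "\<lambda>u. \<exists>M. weighted_projector n (weights n u) A M" v]
      not_less_Least[of _ "\<lambda>u. \<exists>M. weighted_projector n (weights n u) A M"] ex(3)
    unfolding N_def by blast+
  let ?res = "\<lambda>u s'. idx s' 4 0 = 1 \<and> weighted_projector n (weights n u) A (ent s' 2) \<or>
      idx s' 4 0 = 0 \<and> (\<forall>M. \<not> weighted_projector n (weights n u) A M)"
  let ?I = "\<lambda>u s'. digit_count n (idx s' 3 0) u \<and> idx s' 2 = (\<lambda>i. digit (Suc n) i u) \<and> ?res u s'"
  let ?c = "Seq increment (Seq grow (attempt 0 1 2))"
  have "run gi GI search s (1100 * n ^ 3 + (N * ((70 * n + (20 + 1100 * n ^ 3)) + 10) + 10)) (?I N)"
    unfolding search_def
  proof (rule run_Seq)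
    have "run gi GI (attempt 0 1 2) s (1100 * n ^ 3) (?res 0)"
      by (rule run_attempt[where l = 0 and k = k]) (use s gen in \<open>auto simp: digit_zero\<close>)
    then show "run gi GI (attempt 0 1 2) s (1100 * n ^ 3) (?I 0)"
    proof (rule run_mono)
      fix s' assume "?res 0 s'" "unchanged (attempt 0 1 2) s s'"
      then show "?I 0 s'" using s by (auto simp: unchanged_def digit_zero digit_count_def)
    qed simp
  next
    fix s1 :: "'a state" assume s1: "?I 0 s1" and u1: "unchanged (attempt 0 1 2) s s1"
    show "run gi GI (Loop (Less (V 4) (Num 1)) ?c) s1
        (N * ((70 * n + (20 + 1100 * n ^ 3)) + 10) + 10) (?I N)"
    proof (rule run_Loop)
      fix u and s' :: "'a state"
      assume u: "u < N" and I: "?I u s'" and un: "unchanged ?c s1 s'"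
      have v': "idx s' 0 = idx s 0" "ent s' 0 = ent s 0" using un u1 by (auto simp: unchanged_def)
      \<comment> \<open>The bound for \<open>Suc u\<close> keeps the length at most h after the
        increment.\<close>
      have uh: "u < Suc n ^ h" "Suc u < Suc n ^ h" using u N(2) ex(1) by auto
      have l: "idx s' 3 0 \<le> n" "u < Suc n ^ idx s' 3 0"
        using digit_count_le[of n _ u h] I uh ex(2) by (force simp: digit_count_def)+
      have "run gi GI ?c s' (70 * n + (20 + 1100 * n ^ 3)) (?I (Suc u))"
      proof (rule run_Seq)
        show "run gi GI increment s' (70 * n) (\<lambda>s''. idx s'' 2 = (\<lambda>i. digit (Suc n) i (Suc u)))"
          by (rule run_increment[where l = "idx s' 3 0"]) (use v' s I l in auto)
      next
        fix s2 :: "'a state" assume s2: "idx s2 2 = (\<lambda>i. digit (Suc n) i (Suc u))" "unchanged increment s' s2"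
        show "run gi GI (Seq grow (attempt 0 1 2)) s2 (20 + 1100 * n ^ 3) (?I (Suc u))"
        proof (rule run_Seq[OF run_grow])
          fix s3 :: "'a state"
          assume s3: "idx s3 3 0 = (if 0 < idx s2 2 (idx s2 3 0) then Suc (idx s2 3 0) else idx s2 3 0)"
            and u3: "unchanged grow s2 s3"
          have v3: "idx s3 0 = idx s 0" "ent s3 0 = ent s 0" "idx s3 2 = (\<lambda>i. digit (Suc n) i (Suc u))"
            using u3 s2 v' by (auto simp: unchanged_def)
          have "idx s2 3 0 = idx s' 3 0" using s2(2) by (simp add: unchanged_def)
          then have "idx s3 3 0 =
              (if 0 < digit (Suc n) (idx s' 3 0) (Suc u) then Suc (idx s' 3 0) else idx s' 3 0)"
            using s3 s2(1) by simp
          then have dc: "digit_count n (idx s3 3 0) (Suc u)"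
            using digit_count_Suc[of n "idx s' 3 0" u] I s(4) by presburger
          have l3: "Suc u < Suc n ^ idx s3 3 0" using dc by (simp add: digit_count_def)
          have "idx s3 3 0 \<le> n" using digit_count_le[OF dc uh(2)] ex(2) by simp
          then have "run gi GI (attempt 0 1 2) s3 (1100 * n ^ 3) (?res (Suc u))"
            by (intro run_attempt[where l = "idx s3 3 0" and k = k]) (use v3 s gen l3 in auto)
          then show "run gi GI (attempt 0 1 2) s3 (1100 * n ^ 3) (?I (Suc u))"
          proof (rule run_mono)
            fix s4 :: "'a state" assume "?res (Suc u) s4" "unchanged (attempt 0 1 2) s3 s4"
            then show "?I (Suc u) s4" using v3 dc by (auto simp: unchanged_def)
          qed simp
        qed
      qed
      moreover have "idx s' 4 0 = 0" using I N(3)[OF u] by blast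
      ultimately show "tval gi (Less (V 4) (Num 1)) s' \<and> tcost GI (Less (V 4) (Num 1)) s' \<le> 10 \<and>
          run gi GI ?c s' (70 * n + (20 + 1100 * n ^ 3)) (?I (Suc u))" by simp
    next
      fix s' :: "'a state" assume "?I N s'"
      then show "\<not> tval gi (Less (V 4) (Num 1)) s' \<and> tcost GI (Less (V 4) (Num 1)) s' \<le> 10"
        using N(1) by auto
    qed (rule s1)
  qed
  then show ?thesis
  proof (rule run_mono)
    have n3: "1 \<le> n ^ 3" "n \<le> n ^ 3" using s(4) power_increasing[of 1 3 n] by (auto simp: Suc_le_eq)
    have "N * ((70 * n + (20 + 1100 * n ^ 3)) + 10) \<le> N * (3000 * n ^ 3)"
      using n3 by (intro mult_le_mono2) linarith
    then have "1100 * n ^ 3 + (N * ((70 * n + (20 + 1100 * n ^ 3)) + 10) + 10)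
        \<le> 3000 * n ^ 3 + N * (3000 * n ^ 3)"
      using n3(1) by linarith
    \<comment> \<open>Together with the attempt before the loop there are \<open>Suc N\<close>
      attempts, and \<open>Suc N\<close> is at most \<open>Suc v\<close>, hence at most (n +
      1)^h.\<close>
    also have "\<dots> = Suc N * (3000 * n ^ 3)" by simp
    also have "\<dots> \<le> Suc n ^ h * (3000 * n ^ 3)" using N(2) ex(1) by (intro mult_le_mono1) auto
    finally show "1100 * n ^ 3 + (N * ((70 * n + (20 + 1100 * n ^ 3)) + 10) + 10) \<le> Suc n ^ h * (3000 * n ^ 3)" .
  next
    fix s' :: "'a state" assume I: "?I N s'"
    then have "weighted_projector n (weights n N) A (ent s' 2)" using N(1) by auto
    moreover have "N < Suc n ^ idx s' 3 0" "idx s' 3 0 \<le> h"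
      using I digit_count_le[of n _ N h] N(2) ex(1) by (auto simp: digit_count_def)
    ultimately show "\<exists>u l. u < Suc n ^ l \<and> l \<le> h \<and> idx s' 3 0 = l \<and>
        idx s' 2 = (\<lambda>i. digit (Suc n) i u) \<and> weighted_projector n (weights n u) A (ent s' 2)"
      using I by blast
  qed
qed

section \<open>Trying all weights on the second code\<close>

definition scan :: com where
  "scan = Seq (For 6 (V 3) (ISet 2 (V 6) (Num 0)))
     (Loop (Less (Idx 2 (V 3)) (Num 1))
       (Seq (attempt 1 2 3)
         (Seq (Cond (Less (Num 0) (V 4)) (Cond (Iso 2 3 numN) (ISet 1 (Num 0) (Num 1)) Skip) Skip)
           increment)))"

definition matching ::
  "nat \<Rightarrow> 'a::field mat \<Rightarrow> 'a vec set \<Rightarrow> nat \<Rightarrow> bool" where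
  "matching n K B v \<longleftrightarrow> (\<exists>M. weighted_projector n (weights n v) B M \<and>
     graph_isomorphic n K (mat n n (\<lambda>(i, j). M i j)))"

text \<open>The loop does not stop at a match; it passes through all numbers below (n + 1)^l until a
  carry makes digit \<open>l\<close> nonzero, so the number of rounds is known. Clearing the lowest
  \<open>l\<close> digits resets the counter because \<open>u\<close> has no other nonzero
  digits.\<close>

lemma run_scan:
  fixes s :: "'a::field state"
  assumes gi: "decides_graph_isomorphism gi"
    and s: "idx s 0 0 = n" "idx s 0 2 = k" "k \<le> n" "0 < n" "idx s 1 0 = 0"
    and l: "idx s 3 0 = l" "l \<le> n" and T: "idx s 2 = (\<lambda>i. digit (Suc n) i u)" "u < Suc n ^ l"
    and gen: "generates n k (ent s 1) B"
    and K: "weighted_graph n (read_mat s 2 n n)"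
  shows "run gi GI scan s (Suc n ^ l * (3000 * n ^ 3 + GI n))
    (\<lambda>s'. idx s' 1 0 = 1 \<longleftrightarrow> (\<exists>v<Suc n ^ l. matching n (read_mat s 2 n n) B v))"
proof -
  let ?K = "read_mat s 2 n n"
  let ?good = "matching n ?K B"
  let ?iso = "Cond (Iso 2 3 numN) (ISet 1 (Num 0) (Num 1)) Skip"
  let ?test = "Cond (Less (Num 0) (V 4)) ?iso Skip"
  let ?c = "Seq (attempt 1 2 3) (Seq ?test increment)"
  let ?clear = "For 6 (V 3) (ISet 2 (V 6) (Num 0))"
  let ?b = "Less (Idx 2 (V 3)) (Num 1)"
  let ?A = "\<lambda>v s'. idx s' 1 0 = (if \<exists>v'<v. ?good v' then 1 else 0)"
  let ?I = "\<lambda>v s'. idx s' 2 = (\<lambda>i. digit (Suc n) i v) \<and> ?A v s'"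
  let ?N = "Suc n ^ l"
  let ?T = "1100 * n ^ 3 + ((GI n + 20) + 70 * n)"
  have "run gi GI scan s (n * 40 + (?N * (?T + 10) + 10)) (?I ?N)"
    unfolding scan_def
  proof (rule run_Seq)
    let ?J = "\<lambda>i s'. idx s' 2 = (\<lambda>j. if j < i then 0 else digit (Suc n) j u)"
    have "run gi GI ?clear s (n * (4 + 20 + 2 * icost (V 3))) (?J l)"
    proof (rule run_For[where I = ?J and N = l])
      fix i and s' :: "'a state" assume I: "?J i s'" "idx s' 6 0 = i"
      let ?Q = "\<lambda>s''. ?J (Suc i) (iupd s'' 6 0 (Suc i))"
      show "run gi GI (ISet 2 (V 6) (Num 0)) s' 4 ?Q"
        by (rule run_mono[OF run_ISet[where Q = ?Q]]) (use I in \<open>auto simp: fun_eq_iff\<close>)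
    qed (use l s T in \<open>auto simp: unchanged_def\<close>)
    then show "run gi GI ?clear s (n * 40) (\<lambda>s'. idx s' 2 = (\<lambda>_. 0))"
      by (rule run_mono) (auto simp: fun_eq_iff digit_large[OF T(2)])
  next
    fix s1 :: "'a state" assume s1: "idx s1 2 = (\<lambda>_. 0)" and u1: "unchanged ?clear s s1"
    show "run gi GI (Loop ?b ?c) s1 (?N * (?T + 10) + 10) (?I ?N)"
    proof (rule run_Loop)
      show "?I 0 s1" using s1 u1 s by (auto simp: unchanged_def digit_zero)
    next
      fix v and s' :: "'a state" assume v: "v < ?N" and I: "?I v s'" and un: "unchanged ?c s1 s'"
      have v': "idx s' 0 = idx s 0" "idx s' 3 = idx s 3" "ent s' 1 = ent s 1" "ent s' 2 = ent s 2"
        using un u1 by (auto simp: unchanged_def)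
      have "run gi GI ?c s' ?T (?I (Suc v))"
      proof (rule run_Seq)
        show "run gi GI (attempt 1 2 3) s' (1100 * n ^ 3)
          (\<lambda>s2. idx s2 4 0 = 1 \<and> weighted_projector n (weights n v) B (ent s2 3) \<or>
            idx s2 4 0 = 0 \<and> (\<forall>M. \<not> weighted_projector n (weights n v) B M))"
          by (rule run_attempt[where l = l and k = k]) (use s v' gen I v l in auto)
      next
        fix s2 :: "'a state"
        assume s2: "idx s2 4 0 = 1 \<and> weighted_projector n (weights n v) B (ent s2 3) \<or>
            idx s2 4 0 = 0 \<and> (\<forall>M. \<not> weighted_projector n (weights n v) B M)"
          and u2: "unchanged (attempt 1 2 3) s' s2"
        have v2: "idx s2 0 = idx s 0" "idx s2 3 = idx s 3" "idx s2 2 = idx s' 2" "ent s2 2 = ent s 2"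
          "idx s2 1 = idx s' 1"
          using u2 v' by (auto simp: unchanged_def)
        \<comment> \<open>By uniqueness of projectors below \<open>n\<close>, the computed matrix
          stands for every \<open>M\<close> in \<open>matching\<close>, so one oracle call decides
          it.\<close>
        have good: "?good v \<longleftrightarrow> idx s2 4 0 = 1 \<and> gi (read_mat s2 2 n n) (read_mat s2 3 n n)"
        proof (cases "idx s2 4 0 = 1")
          case True
          then have w: "weighted_projector n (weights n v) B (ent s2 3)" using s2 by auto
          have eq: "mat n n (\<lambda>(i, j). M i j) = read_mat s2 3 n n"
            if "weighted_projector n (weights n v) B M" for M
            using weighted_projector_unique[OF that w] by (auto simp: read_mat_def intro!: eq_matI)
          then have "?good v \<longleftrightarrow> graph_isomorphic n ?K (read_mat s2 3 n n)"
            using w unfolding matching_def by metis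
          moreover have "read_mat s2 2 n n = ?K" by (simp add: read_mat_def v2)
          moreover have "weighted_graph n (read_mat s2 3 n n)"
            using weighted_projector_graph[OF w] by (simp add: read_mat_def)
          ultimately show ?thesis using gi K True unfolding decides_graph_isomorphism_def by metis
        qed (use s2 in \<open>auto simp: matching_def\<close>)
        show "run gi GI (Seq ?test increment) s2 ((GI n + 20) + 70 * n) (?I (Suc v))"
        proof (rule run_Seq)
          have n2: "idx s2 0 0 = n" using v2 s by simp
          have "run gi GI ?iso s2 (tcost GI (Iso 2 3 numN) s2 + (3 + 1)) (?A (Suc v))" if ok: "idx s2 4 0 = 1"
          proof (rule run_Cond)
            assume "tval gi (Iso 2 3 numN) s2"
            then have "?good v" using good ok n2 by simp
            then show "run gi GI (ISet 1 (Num 0) (Num 1)) s2 3 (?A (Suc v))"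
              by (intro run_mono[OF run_ISet[where Q = "?A (Suc v)"]]) auto
          next
            assume "\<not> tval gi (Iso 2 3 numN) s2"
            then have "\<not> ?good v" using good n2 by simp
            then show "run gi GI Skip s2 1 (?A (Suc v))"
              using I v2(5) by (intro run_Skip) (auto simp: less_Suc_eq)
          qed
          then have iso: "run gi GI ?iso s2 (GI n + 8) (?A (Suc v))" if "idx s2 4 0 = 1"
            by (rule run_mono) (use that n2 in auto)
          have skip: "run gi GI Skip s2 1 (?A (Suc v))" if "idx s2 4 0 \<noteq> 1"
            using I v2(5) good that by (intro run_Skip) (auto simp: less_Suc_eq)
          have "run gi GI ?test s2 (tcost GI (Less (Num 0) (V 4)) s2 + ((GI n + 8) + 1)) (?A (Suc v))"
            by (rule run_Cond) (use iso skip s2 in auto)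
          then show "run gi GI ?test s2 (GI n + 20) (?A (Suc v))"
            by (rule run_mono) simp_all
        next
          fix s3 :: "'a state" assume s3: "?A (Suc v) s3" and u3: "unchanged ?test s2 s3"
          have v3: "idx s3 0 = idx s 0" "idx s3 3 = idx s 3" "idx s3 2 = idx s' 2"
            using u3 v2 by (auto simp: unchanged_def)
          have "run gi GI increment s3 (70 * n) (\<lambda>s''. idx s'' 2 = (\<lambda>i. digit (Suc n) i (Suc v)))"
            by (rule run_increment[where l = l]) (use v3 s I l v in auto)
          then show "run gi GI increment s3 (70 * n) (?I (Suc v))"
          proof (rule run_mono)
            fix s4 :: "'a state" assume "idx s4 2 = (\<lambda>i. digit (Suc n) i (Suc v))" "unchanged increment s3 s4"
            then show "?I (Suc v) s4" using s3 by (simp add: unchanged_def)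
          qed simp
        qed
      qed
      moreover have "digit (Suc n) l v = 0" using digit_large[OF v] by simp
      ultimately show "tval gi ?b s' \<and> tcost GI ?b s' \<le> 10 \<and> run gi GI ?c s' ?T (?I (Suc v))"
        using I l v' by simp
    next
      fix s' :: "'a state" assume I: "?I ?N s'" and un: "unchanged ?c s1 s'"
      have "idx s' 3 = idx s 3" using un u1 by (auto simp: unchanged_def)
      then show "\<not> tval gi ?b s' \<and> tcost GI ?b s' \<le> 10"
        using I l digit_power[of "Suc n" l] s(4) by simp
    qed
  qed
  then show ?thesis
  proof (rule run_mono)
    have n3: "1 \<le> n ^ 3" "n \<le> n ^ 3" using s(4) power_increasing[of 1 3 n] by (auto simp: Suc_le_eq)
    have "n * 40 + 10 \<le> ?N * (n * 40 + 10)" by simp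
    then have "n * 40 + (?N * (?T + 10) + 10) \<le> ?N * (n * 40 + 10 + (?T + 10))"
      by (simp add: algebra_simps)
    also have "\<dots> \<le> ?N * (3000 * n ^ 3 + GI n)" using n3 by (intro mult_le_mono2) linarith
    finally show "n * 40 + (?N * (?T + 10) + 10) \<le> ?N * (3000 * n ^ 3 + GI n)" .
  qed auto
qed

section \<open>Permutation equivalence through projectors\<close>

text \<open>Row \<open>i\<close> of the matrix has its 1 in column \<open>p i\<close>, so entry
  \<open>i\<close> of \<open>a\<close> moves to position \<open>p i\<close>; hence the inverse on
  the right.\<close>

lemma permutation_mat_mult_vec:
  fixes a :: "'a::field vec"
  assumes "p permutes {..<n}" "a \<in> carrier_vec n"
  shows "(mat n n (\<lambda>(i, j). if p i = j then 1 else 0))\<^sup>T *\<^sub>v a = vec n (\<lambda>j. a $ inv_into UNIV p j)"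
proof (rule eq_vecI)
  fix j assume "j < dim_vec (vec n (\<lambda>j. a $ inv_into UNIV p j))"
  then have j: "j < n" by simp
  have q: "inv_into UNIV p j < n" using permutes_in_image[OF permutes_inv[OF assms(1)]] j by auto
  have "((mat n n (\<lambda>(i, j). if p i = j then 1 else 0))\<^sup>T *\<^sub>v a) $ j =
      (\<Sum>i<n. (if p i = j then 1 else 0) * a $ i)"
    using j assms(2) by (simp add: scalar_prod_def atLeast0LessThan)
  also have "\<dots> = (\<Sum>i<n. if i = inv_into UNIV p j then a $ i else 0)"
  proof (intro sum.cong refl)
    fix i
    have "p i = j \<longleftrightarrow> i = inv_into UNIV p j" using permutes_inv_eq[OF assms(1), of j i] by auto
    then show "(if p i = j then 1 else 0) * a $ i = (if i = inv_into UNIV p j then a $ i else 0)" by simp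
  qed
  also have "\<dots> = a $ inv_into UNIV p j" using q by simp
  finally show "((mat n n (\<lambda>(i, j). if p i = j then 1 else 0))\<^sup>T *\<^sub>v a) $ j = vec n (\<lambda>j. a $ inv_into UNIV p j) $ j"
    using j by simp
qed simp

text \<open>The transposed matrix permutes each column as in
  \<open>permutation_mat_mult_vec\<close>; in the product with \<open>X\<close> a single summand
  survives.\<close>

lemma permutation_mat_conjugate:
  assumes "p permutes {..<n}" "M \<in> carrier_mat n n"
  defines "X \<equiv> mat n n (\<lambda>(i, j). if p i = j then 1 else 0 :: 'a::field)"
  shows "X\<^sup>T * M * X = mat n n (\<lambda>(i, j). M $$ (inv_into UNIV p i, inv_into UNIV p j))"
proof (rule eq_matI)
  have X: "X \<in> carrier_mat n n" by (simp add: X_def)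
  fix i j assume "i < dim_row (mat n n (\<lambda>(i, j). M $$ (inv_into UNIV p i, inv_into UNIV p j)))"
    "j < dim_col (mat n n (\<lambda>(i, j). M $$ (inv_into UNIV p i, inv_into UNIV p j)))"
  then have ij: "i < n" "j < n" by auto
  have q: "inv_into UNIV p i < n" "inv_into UNIV p j < n" using permutes_in_image[OF permutes_inv[OF assms(1)]] ij by auto
  have *: "col (X\<^sup>T * M) l = vec n (\<lambda>i. M $$ (inv_into UNIV p i, l))" if "l < n" for l
  proof -
    have "col (X\<^sup>T * M) l = X\<^sup>T *\<^sub>v col M l"
      using X assms(2) that by (intro col_mult2[of _ n n _ n]) auto
    also have "\<dots> = vec n (\<lambda>i. col M l $ inv_into UNIV p i)"
      unfolding X_def using assms that by (intro permutation_mat_mult_vec) auto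
    also have "\<dots> = vec n (\<lambda>i. M $$ (inv_into UNIV p i, l))"
      using assms(2) that permutes_in_image[OF permutes_inv[OF assms(1)]] by (intro eq_vecI) auto
    finally show ?thesis .
  qed
  have row: "(X\<^sup>T * M) $$ (i, l) = M $$ (inv_into UNIV p i, l)" if "l < n" for l
    using arg_cong[OF *[OF that], of "\<lambda>v. v $ i"] X assms(2) ij that by simp
  have "(X\<^sup>T * M * X) $$ (i, j) = (\<Sum>l<n. (X\<^sup>T * M) $$ (i, l) * X $$ (l, j))"
  proof -
    have "P \<in> carrier_mat n n \<Longrightarrow> (P * X) $$ (i, j) = (\<Sum>l<n. P $$ (i, l) * X $$ (l, j))" for P
      using X ij by (simp add: scalar_prod_def atLeast0LessThan)
    then show ?thesis using mult_carrier_mat[OF transpose_carrier_mat[THEN iffD2, OF X] assms(2)] by blast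
  qed
  also have "\<dots> = (\<Sum>l<n. if l = inv_into UNIV p j then M $$ (inv_into UNIV p i, l) else 0)"
  proof (intro sum.cong refl)
    fix l assume l: "l \<in> {..<n}"
    then have "X $$ (l, j) = (if l = inv_into UNIV p j then 1 else 0)"
      using ij permutes_inv_eq[OF assms(1), of j l] by (auto simp: X_def)
    then show "(X\<^sup>T * M) $$ (i, l) * X $$ (l, j) = (if l = inv_into UNIV p j then M $$ (inv_into UNIV p i, l) else 0)"
      using row l by simp
  qed
  also have "\<dots> = M $$ (inv_into UNIV p i, inv_into UNIV p j)" using q by simp
  finally show "(X\<^sup>T * M * X) $$ (i, j) = mat n n (\<lambda>(i, j). M $$ (inv_into UNIV p i, inv_into UNIV p j)) $$ (i, j)"
    using ij by simp
qed (use assms(2) in \<open>auto simp: X_def\<close>)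

definition permute_code :: "nat \<Rightarrow> (nat \<Rightarrow> nat) \<Rightarrow> 'a vec set \<Rightarrow> 'a vec set" where
  "permute_code n q A = (\<lambda>a. vec n (\<lambda>j. a $ q j)) ` A"

text \<open>Substituting the inverse permutation removes the inverses from the descriptions of
  equivalence and isomorphism that follow.\<close>

lemma bex_permutation_mats:
  "(\<exists>X \<in> permutation_mats n. P X) \<longleftrightarrow>
    (\<exists>q. q permutes {..<n} \<and> P (mat n n (\<lambda>(i, j). if inv_into UNIV q i = j then 1 else 0)))"
proof
  assume "\<exists>X \<in> permutation_mats n. P X"
  then obtain p where p: "p permutes {..<n}" "P (mat n n (\<lambda>(i, j). if p i = j then 1 else 0))"
    unfolding permutation_mats_def by blast
  then show "\<exists>q. q permutes {..<n} \<and> P (mat n n (\<lambda>(i, j). if inv_into UNIV q i = j then 1 else 0))"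
    by (intro exI[of _ "inv_into UNIV p"]) (simp add: permutes_inv permutes_inv_inv)
qed (use permutes_inv in \<open>auto simp: permutation_mats_def\<close>)

lemma permutation_equivalent_iff:
  assumes "A \<subseteq> carrier_vec n"
  shows "permutation_equivalent n A B \<longleftrightarrow> (\<exists>q. q permutes {..<n} \<and> B = permute_code n q A)"
proof -
  have "(\<lambda>a. (mat n n (\<lambda>(i, j). if inv_into UNIV q i = j then 1 else 0))\<^sup>T *\<^sub>v a) ` A = permute_code n q A"
    if "q permutes {..<n}" for q
    unfolding permute_code_def using assms permutes_inv_inv[OF that]
    by (intro image_cong refl) (auto simp: permutation_mat_mult_vec[OF permutes_inv[OF that]])
  then show ?thesis unfolding permutation_equivalent_def bex_permutation_mats by auto
qed

lemma graph_isomorphic_iff: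
  assumes "M \<in> carrier_mat n n"
  shows "graph_isomorphic n M M' \<longleftrightarrow>
    (\<exists>q. q permutes {..<n} \<and> M' = mat n n (\<lambda>(i, j). M $$ (q i, q j)))"
proof -
  have "(mat n n (\<lambda>(i, j). if inv_into UNIV q i = j then 1 else 0))\<^sup>T * M *
      mat n n (\<lambda>(i, j). if inv_into UNIV q i = j then 1 else 0) = mat n n (\<lambda>(i, j). M $$ (q i, q j))"
    if "q permutes {..<n}" for q
    using permutation_mat_conjugate[OF permutes_inv[OF that] assms] permutes_inv_inv[OF that] by simp
  then show ?thesis unfolding graph_isomorphic_def bex_permutation_mats by auto
qed

text \<open>Reindexing the sum in the form along \<open>q\<close>. This is the passage from
  equivalent codes to isomorphic graphs.\<close>

lemma weighted_projector_permute:
  assumes q: "q permutes {..<n}" and M: "weighted_projector n D A M"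
  shows "weighted_projector n (\<lambda>j. D (q j)) (permute_code n q A) (\<lambda>i j. M (q i) (q j))"
  unfolding weighted_projector_def
proof (intro conjI ballI allI impI)
  have qn: "q i < n" if "i < n" for i using permutes_in_image[OF q] that by auto
  fix i assume i: "i < n"
  have "vec n (\<lambda>j. M (q i) (q j)) = vec n (\<lambda>j. vec n (M (q i)) $ q j)"
    using qn by (intro eq_vecI) auto
  moreover have "vec n (M (q i)) \<in> A" using M qn[OF i] by (simp add: weighted_projector_def)
  ultimately show "vec n (\<lambda>j. M (q i) (q j)) \<in> permute_code n q A"
    unfolding permute_code_def by blast
  fix b assume "b \<in> permute_code n q A"
  then obtain a where a: "a \<in> A" "b = vec n (\<lambda>j. a $ q j)" unfolding permute_code_def by blast
  have "wdot n (\<lambda>j. D (q j)) (\<lambda>j. M (q i) (q j)) (($) b) = (\<Sum>j<n. M (q i) (q j) * D (q j) * a $ q j)"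
    unfolding wdot_def by (intro sum.cong) (auto simp: a)
  also have "\<dots> = wdot n D (M (q i)) (($) a)"
    unfolding wdot_def using sum.permute[OF q, of "\<lambda>j. M (q i) j * D j * a $ j"] by (simp add: comp_def)
  also have "\<dots> = b $ i" using M a i qn[OF i] by (simp add: weighted_projector_def)
  finally show "wdot n (\<lambda>j. D (q j)) (\<lambda>j. M (q i) (q j)) (($) b) = b $ i" .
qed

text \<open>By symmetry of \<open>M\<close>, the reproducing property reads a_j = sum_i (D_i a_i)
  M_ij, which displays a codeword as a combination of rows.\<close>

lemma weighted_projector_rows_span:
  assumes gen: "generates n k g A" and M: "weighted_projector n D A M"
  shows "A = range (\<lambda>c. vec n (\<lambda>j. \<Sum>i<n. c i * M i j))"
proof
  show "A \<subseteq> range (\<lambda>c. vec n (\<lambda>j. \<Sum>i<n. c i * M i j))"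
  proof
    fix a assume a: "a \<in> A"
    have "a = vec n (\<lambda>j. \<Sum>i<n. (D i * a $ i) * M i j)"
    proof (rule eq_vecI)
      fix j assume "j < dim_vec (vec n (\<lambda>j. \<Sum>i<n. (D i * a $ i) * M i j))"
      then have j: "j < n" by simp
      have "a $ j = wdot n D (M j) (($) a)" using M a j by (simp add: weighted_projector_def)
      also have "\<dots> = (\<Sum>i<n. (D i * a $ i) * M i j)"
        unfolding wdot_def using weighted_projector_sym[OF M j] by (intro sum.cong) auto
      finally show "a $ j = vec n (\<lambda>j. \<Sum>i<n. (D i * a $ i) * M i j) $ j" using j by simp
    qed (use a generates_carrier[OF gen] in auto)
    then show "a \<in> range (\<lambda>c. vec n (\<lambda>j. \<Sum>i<n. c i * M i j))"
      by (rule image_eqI[where x = "\<lambda>i. D i * a $ i"]) simp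
  qed
  show "range (\<lambda>c. vec n (\<lambda>j. \<Sum>i<n. c i * M i j)) \<subseteq> A"
    using M by (auto intro!: generates_sum[OF gen] simp: weighted_projector_def)
qed

text \<open>Both codes are row spaces, and permuting the rows only renames coefficients. No relation
  between \<open>D\<close> and \<open>D'\<close> is assumed, so a positive answer of the isomorphism
  test is conclusive for any weights.\<close>

lemma permute_code_eqI:
  assumes q: "q permutes {..<n}" and A: "generates n k g A" "weighted_projector n D A M"
    and B: "generates n k' g' B" "weighted_projector n D' B M'"
    and iso: "\<And>i j. i < n \<Longrightarrow> j < n \<Longrightarrow> M' i j = M (q i) (q j)"
  shows "B = permute_code n q A"
proof -
  have qn: "q i < n" if "i < n" for i using permutes_in_image[OF q] that by auto
  have eq: "vec n (\<lambda>j. vec n (\<lambda>j. \<Sum>i<n. c i * M i j) $ q j) = vec n (\<lambda>j. \<Sum>i<n. c (q i) * M' i j)" for c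
  proof (rule eq_vecI)
    fix j assume "j < dim_vec (vec n (\<lambda>j. \<Sum>i<n. c (q i) * M' i j))"
    then have j: "j < n" by simp
    have "(\<Sum>i<n. c (q i) * M' i j) = (\<Sum>i<n. c (q i) * M (q i) (q j))"
      using iso j by (intro sum.cong) auto
    also have "\<dots> = (\<Sum>i<n. c i * M i (q j))"
      using sum.permute[OF q, of "\<lambda>i. c i * M i (q j)"] by (simp add: comp_def)
    finally show "vec n (\<lambda>j. vec n (\<lambda>j. \<Sum>i<n. c i * M i j) $ q j) $ j =
        vec n (\<lambda>j. \<Sum>i<n. c (q i) * M' i j) $ j"
      using j qn[OF j] by simp
  qed simp
  have "permute_code n q A = range (\<lambda>c. vec n (\<lambda>j. \<Sum>i<n. c (q i) * M' i j))"
    unfolding permute_code_def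
    by (subst weighted_projector_rows_span[OF A]) (simp add: image_image eq)
  also have "\<dots> = range (\<lambda>c. vec n (\<lambda>j. \<Sum>i<n. c i * M' i j))"
  proof (intro equalityI image_subsetI)
    fix c :: "nat \<Rightarrow> 'a"
    show "vec n (\<lambda>j. \<Sum>i<n. c i * M' i j) \<in> range (\<lambda>c. vec n (\<lambda>j. \<Sum>i<n. c (q i) * M' i j))"
      by (rule image_eqI[where x = "c \<circ> inv_into UNIV q"]) (simp_all add: permutes_inverses(2)[OF q])
    show "vec n (\<lambda>j. \<Sum>i<n. c (q i) * M' i j) \<in> range (\<lambda>c. vec n (\<lambda>j. \<Sum>i<n. c i * M' i j))"
      by (rule image_eqI[where x = "c \<circ> q"]) simp_all
  qed
  also have "\<dots> = B" by (rule weighted_projector_rows_span[OF B, symmetric])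
  finally show ?thesis by simp
qed

text \<open>Soundness holds for every \<open>v\<close>. For completeness the weights of
  \<open>A\<close> are transported along \<open>q\<close>; they again remove at most
  \<open>l\<close> coordinates and so have a number below the same bound.\<close>

lemma matching_iff_permutation_equivalent:
  assumes A: "generates n k g A" "weighted_projector n (weights n u) A M" "u < Suc n ^ l"
    and B: "generates n k' g' B"
  shows "(\<exists>v<Suc n ^ l. matching n (mat n n (\<lambda>(i, j). M i j)) B v) \<longleftrightarrow> permutation_equivalent n A B"
proof
  assume "\<exists>v<Suc n ^ l. matching n (mat n n (\<lambda>(i, j). M i j)) B v"
  then obtain v M' where M': "weighted_projector n (weights n v) B M'"
    and "graph_isomorphic n (mat n n (\<lambda>(i, j). M i j)) (mat n n (\<lambda>(i, j). M' i j))"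
    unfolding matching_def by blast
  then obtain q where q: "q permutes {..<n}"
    and eq: "mat n n (\<lambda>(i, j). M' i j) = mat n n (\<lambda>(i, j). mat n n (\<lambda>(i, j). M i j) $$ (q i, q j))"
    by (subst (asm) graph_isomorphic_iff) auto
  have "M' i j = M (q i) (q j)" if "i < n" "j < n" for i j
    using arg_cong[OF eq, of "\<lambda>X. X $$ (i, j)"] permutes_in_image[OF q] that by simp
  then have "B = permute_code n q A" by (intro permute_code_eqI[OF q A(1,2) B M'])
  then show "permutation_equivalent n A B"
    using q permutation_equivalent_iff[OF generates_carrier[OF A(1)]] by blast
next
  assume "permutation_equivalent n A B"
  then obtain q where q: "q permutes {..<n}" and B': "B = permute_code n q A"
    using permutation_equivalent_iff[OF generates_carrier[OF A(1)]] by blast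
  let ?S = "{j. j < n \<and> (weights n u (q j) :: 'a) = 0}"
  have "card ?S \<le> card {j. (weights n u j :: 'a) = 0 \<and> j < n}"
    using permutes_inj_on[OF q] permutes_in_image[OF q]
    by (intro card_inj_on_le[of q]) auto
  also have "\<dots> \<le> card {j. (weights n u j :: 'a) = 0}"
  proof (rule card_mono)
    \<comment> \<open>Digits in base n + 1 are at most \<open>n\<close>, and digit v + 1 stands for
      coordinate v.\<close>
    have "{j. (weights n u j :: 'a) = 0} \<subseteq> {..<n}"
    proof
      fix j assume "j \<in> {j. (weights n u j :: 'a) = 0}"
      then obtain i where "digit (Suc n) i u = Suc j" by (auto simp: weights_def split: if_splits)
      then show "j \<in> {..<n}" using digit_less[of "Suc n" i u] by simp
    qed
    then show "finite {j. (weights n u j :: 'a) = 0}" using finite_subset by blast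
  qed auto
  also have "\<dots> \<le> l" by (rule card_weights_zero[OF A(3)])
  finally obtain v where v: "v < Suc n ^ l" "\<And>j. (weights n v j :: 'a) = (if j \<in> ?S then 0 else 1)"
    using ex_weights[of ?S n l] by auto
  have "(weights n u (q j) :: 'a) = weights n v j" if "j < n" for j
    using that v(2)[of j] by (auto simp: weights_def)
  then have "weighted_projector n (weights n v) B (\<lambda>i j. M (q i) (q j))"
    using weighted_projector_permute[OF q A(2)] weighted_projector_weights_cong[of n "\<lambda>j. weights n u (q j)" "weights n v"]
    unfolding B' by blast
  moreover have "mat n n (\<lambda>(i, j). M (q i) (q j)) =
      mat n n (\<lambda>(i, j). mat n n (\<lambda>(i, j). M i j) $$ (q i, q j))"
    using permutes_in_image[OF q] by (intro eq_matI) auto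
  ultimately have "matching n (mat n n (\<lambda>(i, j). M i j)) B v"
    unfolding matching_def using q graph_isomorphic_iff[of "mat n n (\<lambda>(i, j). M i j)" n] by auto
  with v(1) show "\<exists>v<Suc n ^ l. matching n (mat n n (\<lambda>(i, j). M i j)) B v" by blast
qed

section \<open>Coordinates to remove\<close>

text \<open>The machine loop without the machine: nondegeneracy rules out the stuck case, so a zero
  pivot can always be repaired by adding a later row. It is needed to show that the search can
  succeed.\<close>

lemma ex_partial_dual:
  assumes gen: "generates n k g A"
    and nondeg: "\<And>x. vec n x \<in> A \<Longrightarrow> (\<forall>r<k. wdot n D (g r) x = 0) \<Longrightarrow> \<forall>j<n. x j = 0"
  shows "c \<le> k \<Longrightarrow> \<exists>w. partial_dual n D A k g c w"
proof (induction c)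
  case 0
  then show ?case using partial_dual_start[OF gen] by blast
next
  case (Suc c)
  then obtain w where w: "partial_dual n D A k g c w" and c: "c < k" by auto
  obtain w' where w': "partial_dual n D A k g c w'" and piv: "wdot n D (w' c) (g c) \<noteq> 0"
  proof (cases "wdot n D (w c) (g c) = 0")
    case True
    obtain r where r: "c \<le> r" "r < k" "wdot n D (w r) (g c) \<noteq> 0"
      using partial_dual_stuck[OF gen w c] nondeg by blast
    with True have "c < r" by (cases "c = r") auto
    then show ?thesis
      using that[OF partial_dual_add_row[OF gen w _ r(2)]] r True by (simp add: wdot_add)
  qed (use w that in blast)
  let ?row = "\<lambda>j. w' c j / wdot n D (w' c) (g c)"
  let ?w = "\<lambda>r j. if r = c then ?row j else w' r j - wdot n D (w' r) (g c) * ?row j"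
  have "partial_dual n D A k g (Suc c) ?w"
    by (rule partial_dual_Suc[OF gen w' c piv]) auto
  then show ?case by blast
qed

lemma ex_weighted_projector:
  assumes gen: "generates n k g A"
    and nondeg: "\<And>x. vec n x \<in> A \<Longrightarrow> (\<forall>a\<in>A. wdot n D (($) a) x = 0) \<Longrightarrow> \<forall>j<n. x j = 0"
  shows "\<exists>M. weighted_projector n D A M"
proof -
  have "\<exists>w. partial_dual n D A k g k w"
  proof (rule ex_partial_dual[OF gen _ order_refl])
    fix x assume x: "vec n x \<in> A" "\<forall>r<k. wdot n D (g r) x = 0"
    have "wdot n D (($) a) x = 0" if a: "a \<in> A" for a
    proof -
      obtain u where "a = vec n (\<lambda>j. \<Sum>r<k. u r * g r j)" using generates_mem[OF gen a] by blast
      then have "wdot n D (($) a) x = wdot n D (\<lambda>j. \<Sum>r<k. u r * g r j) x"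
        by (intro wdot_cong) auto
      then show ?thesis using x(2) by (simp add: wdot_sum)
    qed
    then show "\<forall>j<n. x j = 0" using nondeg x(1) by blast
  qed
  then obtain w where w: "partial_dual n D A k g k w" by blast
  have "weighted_projector n D A (\<lambda>i j. \<Sum>r<k. g r i * w r j)"
    by (rule partial_dual_projector[OF gen w]) auto
  then show ?thesis by blast
qed

text \<open>Span and independence are notions for sets of vectors. Distinctness makes
  \<open>row G\<close> injective, so coefficients can be indexed by row numbers instead. The bound
  on the number of rows, a dimension count, is what all loops over rows rely on.\<close>

lemma generates_generator_matrix:
  fixes G :: "'a::field mat"
  assumes G: "generator_matrix n A G"
    and g: "\<And>r j. r < dim_row G \<Longrightarrow> j < n \<Longrightarrow> g r j = G $$ (r, j)"
  shows "generates n (dim_row G) g A" "dim_row G \<le> n"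
proof -
  interpret vec_space "TYPE('a)" n .
  let ?k = "dim_row G" and ?R = "set (rows G)"
  have n: "dim_col G = n" and A: "A = span ?R" and li: "\<not> lin_dep ?R" and dis: "distinct (rows G)"
    using G unfolding generator_matrix_def row_space_def by auto
  have R: "?R = row G ` {..<?k}" by (auto simp: rows_def)
  have inj: "inj_on (row G) {..<?k}"
    using dis unfolding rows_def distinct_map by (simp add: atLeast0LessThan)
  have car: "?R \<subseteq> carrier_vec n" using n by (auto simp: R)
  have lc: "lincomb a ?R = vec n (\<lambda>j. \<Sum>r<?k. a (row G r) * g r j)" for a
  proof (rule eq_vecI)
    fix j assume "j < dim_vec (vec n (\<lambda>j. \<Sum>r<?k. a (row G r) * g r j))"
    then have j: "j < n" by simp
    have "lincomb a ?R $ j = (\<Sum>x\<in>?R. a x * x $ j)" using lincomb_index[OF j car] .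
    also have "\<dots> = (\<Sum>r<?k. a (row G r) * row G r $ j)" unfolding R by (simp add: sum.reindex[OF inj])
    also have "\<dots> = (\<Sum>r<?k. a (row G r) * g r j)" using j n g by (intro sum.cong) auto
    finally show "lincomb a ?R $ j = vec n (\<lambda>j. \<Sum>r<?k. a (row G r) * g r j) $ j" using j by simp
  qed (use lincomb_dim[OF _ car] in simp)
  have ext: "\<exists>a. \<forall>r<?k. a (row G r) = u r" for u :: "nat \<Rightarrow> 'a"
    using the_inv_into_f_f[OF inj] by (intro exI[of _ "\<lambda>x. u (the_inv_into {..<?k} (row G) x)"]) simp
  have lc': "\<exists>a. lincomb a ?R = vec n (\<lambda>j. \<Sum>r<?k. u r * g r j) \<and> (\<forall>r<?k. a (row G r) = u r)" for u
  proof -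
    obtain a where a: "\<forall>r<?k. a (row G r) = u r" using ext by blast
    then show ?thesis unfolding lc by (intro exI[of _ a]) simp
  qed
  have fs: "span ?R = {lincomb a ?R | a. a \<in> ?R \<rightarrow> UNIV}"
    using finite_span[OF finite_set car] by (simp add: class_ring_simps)
  have "A = range (\<lambda>u. vec n (\<lambda>j. \<Sum>r<?k. u r * g r j))"
  proof (intro equalityI subsetI)
    fix x assume "x \<in> A"
    then obtain a where "x = lincomb a ?R" unfolding A fs by blast
    then show "x \<in> range (\<lambda>u. vec n (\<lambda>j. \<Sum>r<?k. u r * g r j))"
      unfolding lc by (rule image_eqI[where x = "\<lambda>r. a (row G r)"]) simp
  next
    fix x assume "x \<in> range (\<lambda>u. vec n (\<lambda>j. \<Sum>r<?k. u r * g r j))"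
    then obtain u where "x = vec n (\<lambda>j. \<Sum>r<?k. u r * g r j)" by (rule imageE)
    moreover obtain a where "lincomb a ?R = vec n (\<lambda>j. \<Sum>r<?k. u r * g r j)" using lc'[of u] by blast
    ultimately have "x = lincomb a ?R" by simp
    then show "x \<in> A" unfolding A fs by blast
  qed
  moreover have "u r = 0" if z: "\<forall>j<n. (\<Sum>r<?k. u r * g r j) = 0" and r: "r < ?k" for u r
  proof -
    obtain a where a: "lincomb a ?R = vec n (\<lambda>j. \<Sum>r<?k. u r * g r j)" "\<forall>r<?k. a (row G r) = u r"
      using lc' by blast
    have "lincomb a ?R = 0\<^sub>v n" unfolding a(1) using z by (intro eq_vecI) auto
    then have "a \<in> ?R \<rightarrow> {0}"
      using not_lindepD[OF li finite_set subset_refl, of a] by (simp add: class_ring_simps)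
    then have "a (row G r) \<in> {0}" by (rule funcset_mem) (use r in \<open>simp add: R\<close>)
    then show ?thesis using a(2) r by simp
  qed
  ultimately show "generates n ?k g A" unfolding generates_def by blast
  have "?k = card ?R" using distinct_card[OF dis] by simp
  also have "\<dots> \<le> n" using li_le_dim(2)[OF fin_dim _ li] car dim_is_n by simp
  finally show "?k \<le> n" .
qed

section \<open>The hull and its information sets\<close>

lemma mem_code_hull:
  fixes A :: "'a::field vec set"
  assumes "A \<subseteq> carrier_vec n"
  shows "vec n x \<in> code_hull n A \<longleftrightarrow> vec n x \<in> A \<and> (\<forall>a\<in>A. wdot n (\<lambda>_. 1) x (($) a) = 0)"
proof -
  interpret vec_space "TYPE('a)" n .
  have "vec n x \<bullet> a = wdot n (\<lambda>_. 1) x (($) a)" if "a \<in> A" for a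
    using assms that by (auto simp: scalar_prod_def wdot_def atLeast0LessThan intro!: sum.cong)
  then show ?thesis by (auto simp: code_hull_def orthogonal_complement_def)
qed

lemma code_hull_add:
  assumes gen: "generates n k g A" and x: "vec n x \<in> code_hull n A" and y: "vec n y \<in> code_hull n A"
  shows "vec n (\<lambda>j. x j + c * y j) \<in> code_hull n A"
  using x y generates_add[OF gen, of x y c] unfolding mem_code_hull[OF generates_carrier[OF gen]]
  by (auto simp: wdot_add wdot_scale)

text \<open>Makes \<open>code_dim\<close> of the hull the dimension of an actual vector space, so
  that bases compute it.\<close>

lemma subspace_code_hull:
  fixes A :: "'a::field vec set"
  assumes gen: "generates n k g A"
  shows "subspace class_ring (code_hull n A) (module_vec TYPE('a) n)"
proof -
  interpret vec_space "TYPE('a)" n .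
  let ?H = "code_hull n A"
  have car: "?H \<subseteq> carrier_vec n"
    using generates_carrier[OF gen] by (auto simp: code_hull_def)
  have fn: "vec n (($) v) = v" if "v \<in> ?H" for v
    using that car by (intro eq_vecI) auto
  have z: "vec n (\<lambda>j. 0) \<in> ?H"
    using generates_lincomb[OF gen, of "\<lambda>_. 0"] mem_code_hull[OF generates_carrier[OF gen]]
    by (simp add: wdot_def)
  have add: "v + w \<in> ?H" if "v \<in> ?H" "w \<in> ?H" for v w
  proof -
    have "v + w = vec n (\<lambda>j. v $ j + 1 * w $ j)" using car that by (intro eq_vecI) auto
    then show ?thesis using code_hull_add[OF gen, of "($) v" "($) w" 1] fn that by simp
  qed
  have smult: "c \<cdot>\<^sub>v v \<in> ?H" if "v \<in> ?H" for c v
  proof -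
    have "c \<cdot>\<^sub>v v = vec n (\<lambda>j. 0 + c * v $ j)" using car that by (intro eq_vecI) auto
    then show ?thesis using code_hull_add[OF gen z, of "($) v" c] fn that by simp
  qed
  have "submodule class_ring ?H V"
    by (rule submodule.intro) (use car add smult z module_axioms in \<open>auto simp: module_vec_simps zero_vec_def\<close>)
  then show ?thesis using vectorspace_axioms by (simp add: subspace_def)
qed

text \<open>A maximal set of coordinates on which the hull has all unit vectors is an information set of
  the hull.\<close>

lemma ex_information_set:
  assumes gen: "generates n k g A"
  obtains S b where "S \<subseteq> {..<n}" "\<And>i. i \<in> S \<Longrightarrow> vec n (b i) \<in> code_hull n A"
    "\<And>i j. i \<in> S \<Longrightarrow> j \<in> S \<Longrightarrow> b i j = (if i = j then 1 else 0)"
    "\<And>x j. vec n x \<in> code_hull n A \<Longrightarrow> (\<forall>j\<in>S. x j = 0) \<Longrightarrow> j < n \<Longrightarrow> x j = 0"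
proof -
  let ?H = "code_hull n A"
  let ?unit = "\<lambda>S b. \<forall>i\<in>S. vec n (b i) \<in> ?H \<and> (\<forall>j\<in>S. b i j = (if i = j then 1 else 0))"
  let ?F = "{S. S \<subseteq> {..<n} \<and> (\<exists>b. ?unit S b)}"
  have "finite ?F" by (rule finite_subset[of _ "Pow {..<n}"]) auto
  moreover have "{} \<in> ?F" by auto
  ultimately have "\<exists>S\<in>?F. \<forall>T\<in>?F. S \<subseteq> T \<longrightarrow> S = T"
    by (intro finite_has_maximal) auto
  then obtain S where S: "S \<in> ?F" and max: "\<And>T. T \<in> ?F \<Longrightarrow> S \<subseteq> T \<Longrightarrow> S = T" by meson
  then obtain b where Sn: "S \<subseteq> {..<n}" and b: "?unit S b" by blast
  have "x l = 0" if x: "vec n x \<in> ?H" "\<forall>j\<in>S. x j = 0" and l: "l < n" for x l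
  proof (rule ccontr)
    assume xl: "x l \<noteq> 0"
    then have lS: "l \<notin> S" using x(2) by blast
    \<comment> \<open>The vector \<open>x\<close> is scaled to have entry 1 at \<open>l\<close>,
      written as \<open>x\<close> plus a multiple of \<open>x\<close> to fit
      \<open>code_hull_add\<close>, and its multiples clear coordinate \<open>l\<close> of the old
      vectors. Their entries on \<open>S\<close> stay the same since \<open>x\<close> vanishes
      there.\<close>
    let ?b = "\<lambda>i. if i = l then (\<lambda>j. x j + (1 / x l - 1) * x j) else (\<lambda>j. b i j + (- b i l / x l) * x j)"
    have "?unit (insert l S) ?b"
    proof (intro ballI conjI)
      fix i assume i: "i \<in> insert l S"
      show "vec n (?b i) \<in> ?H"
      proof (cases "i = l")
        case True
        then show ?thesis using code_hull_add[OF gen x(1) x(1), of "1 / x l - 1"] by simp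
      next
        case False
        then show ?thesis using code_hull_add[OF gen _ x(1), of "b i" "- b i l / x l"] b i by simp
      qed
      fix j assume j: "j \<in> insert l S"
      show "?b i j = (if i = j then 1 else 0)"
        using i j lS xl x(2) b by (auto simp: field_simps)
    qed
    moreover have "insert l S \<subseteq> {..<n}" using Sn l by simp
    ultimately have "insert l S \<in> ?F" by (intro CollectI conjI exI[of _ ?b])
    then show False using max[of "insert l S"] lS by blast
  qed
  with that[OF Sn, of b] b show thesis by blast
qed

text \<open>Entry \<open>j\<close> in \<open>S\<close> of a combination is the coefficient of
  \<open>b j\<close>, whence independence. A hull vector minus the combination that takes its own
  entries as coefficients vanishes on \<open>S\<close>, hence everywhere, whence spanning.\<close>

lemma card_information_set:
  fixes A :: "'a::field vec set"
  assumes gen: "generates n k g A" and S: "S \<subseteq> {..<n}"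
    and b: "\<And>i. i \<in> S \<Longrightarrow> vec n (b i) \<in> code_hull n A"
    and unit: "\<And>i j. i \<in> S \<Longrightarrow> j \<in> S \<Longrightarrow> b i j = (if i = j then 1 else 0)"
    and vanish: "\<And>x j. vec n x \<in> code_hull n A \<Longrightarrow> (\<forall>j\<in>S. x j = 0) \<Longrightarrow> j < n \<Longrightarrow> x j = 0"
  shows "card S = code_dim n (code_hull n A)"
proof -
  interpret vec_space "TYPE('a)" n .
  let ?H = "code_hull n A" and ?f = "\<lambda>i. vec n (b i)"
  let ?B = "?f ` S"
  have fin: "finite S" using S finite_subset by blast
  have sub: "subspace class_ring ?H V" by (rule subspace_code_hull[OF gen])
  then have subm: "submodule class_ring ?H V" by (simp add: subspace_def)
  interpret W: vectorspace class_ring "vs ?H" by (rule subspace_is_vs[OF sub])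
  have BH: "?B \<subseteq> ?H" using b by blast
  have fn: "vec n (($) v) = v" if "v \<in> carrier_vec n" for v :: "'a vec"
    using that by (intro eq_vecI) auto
  have car: "?B \<subseteq> carrier_vec n" by auto
  have inj: "inj_on ?f S"
  proof (rule inj_onI)
    fix i j assume ij: "i \<in> S" "j \<in> S" "vec n (b i) = vec n (b j)"
    have "i < n" using S ij(1) by auto
    then have "b i i = b j i" using arg_cong[OF ij(3), of "\<lambda>v. v $ i"] by simp
    then show "i = j" using unit[OF ij(1,1)] unit[OF ij(2,1)] by (auto split: if_splits)
  qed
  have lc: "lincomb a ?B $ j = (\<Sum>i\<in>S. a (?f i) * b i j)" if "j < n" for a j
    using lincomb_index[OF that car] that by (simp add: sum.reindex[OF inj])
  have lcS: "lincomb a ?B $ j = a (?f j)" if "j \<in> S" for a j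
  proof -
    have "lincomb a ?B $ j = (\<Sum>i\<in>S. a (?f i) * b i j)" using lc that S by auto
    also have "\<dots> = (\<Sum>i\<in>S. if i = j then a (?f j) else 0)"
      using unit that by (intro sum.cong) auto
    finally have "lincomb a ?B $ j = (\<Sum>i\<in>S. if i = j then a (?f j) else 0)" .
    then show ?thesis using fin that by simp
  qed
  have "a (?f i) = 0" if "lincomb a ?B = 0\<^sub>v n" "i \<in> S" for a i
    using lcS[of i a] that S by auto
  then have li: "lin_indpt ?B"
    by (intro finite_lin_indpt2) (use fin car in \<open>auto simp: class_ring_simps\<close>)
  have "span ?B = ?H"
  proof
    show "span ?B \<subseteq> ?H" by (rule span_is_subset[OF BH subm])
    show "?H \<subseteq> span ?B"
    proof
      fix x assume x: "x \<in> ?H"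
      then have xc: "x \<in> carrier_vec n" using generates_carrier[OF gen] by (auto simp: code_hull_def)
      define c where "c v = x $ (the_inv_into S ?f v)" for v
      have c: "c (?f i) = x $ i" if "i \<in> S" for i using the_inv_into_f_f[OF inj that] by (simp add: c_def)
      have sp: "lincomb c ?B \<in> span ?B" using fin by (intro in_spanI) auto
      then have "lincomb c ?B \<in> ?H" using \<open>span ?B \<subseteq> ?H\<close> by blast
      moreover have "lincomb c ?B \<in> carrier_vec n" using sp car by (meson span_closed)
      ultimately have "vec n (\<lambda>j. x $ j + (- 1) * lincomb c ?B $ j) \<in> ?H"
        using x xc by (intro code_hull_add[OF gen]) (simp_all add: fn)
      then have "x $ j + (- 1) * lincomb c ?B $ j = 0" if "j < n" for j
        by (rule vanish[OF _ _ that]) (use c lcS in auto)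
      then have "x = lincomb c ?B"
        using xc \<open>lincomb c ?B \<in> carrier_vec n\<close> by (intro eq_vecI) auto
      then show "x \<in> span ?B" using sp by simp
    qed
  qed
  then have "W.basis ?B"
    unfolding W.basis_def using span_li_not_depend[OF BH subm] li BH by simp
  then have "W.dim = card ?B" using W.dim_basis fin by blast
  then show ?thesis by (simp add: code_dim_def card_image[OF inj])
qed

text \<open>Let x in A be orthogonal to A for the weighted form. The ordinary pairing of x with the
  hull vector b_i is 0, its weighted part is 0, and the part on \<open>S\<close> is x_i; so x
  vanishes on \<open>S\<close>. There alone the two forms differ, so x lies in the hull, and being 0
  on an information set it is 0.\<close>

lemma ex_removal_set:
  assumes gen: "generates n k g A"
  obtains S M where "S \<subseteq> {..<n}" "card S = code_dim n (code_hull n A)"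
    "weighted_projector n (\<lambda>j. if j \<in> S then 0 else 1) A M"
proof -
  obtain S b where S: "S \<subseteq> {..<n}" and b: "\<And>i. i \<in> S \<Longrightarrow> vec n (b i) \<in> code_hull n A"
    and unit: "\<And>i j. i \<in> S \<Longrightarrow> j \<in> S \<Longrightarrow> b i j = (if i = j then 1 else 0)"
    and vanish: "\<And>x j. vec n x \<in> code_hull n A \<Longrightarrow> (\<forall>j\<in>S. x j = 0) \<Longrightarrow> j < n \<Longrightarrow> x j = 0"
    by (rule ex_information_set[OF gen]) (rule that)
  note hull = mem_code_hull[OF generates_carrier[OF gen]]
  let ?D = "\<lambda>j. if j \<in> S then 0 else 1 :: 'a"
  have split: "wdot n (\<lambda>_. 1) y x = wdot n ?D y x + (\<Sum>j\<in>S. y j * x j)" for x y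
  proof -
    have "wdot n (\<lambda>_. 1) y x =
        (\<Sum>j<n. y j * ?D j * x j + (if j \<in> S then y j * x j else 0))"
      unfolding wdot_def by (intro sum.cong) auto
    also have "\<dots> = wdot n ?D y x + (\<Sum>j<n. if j \<in> S then y j * x j else 0)"
      by (simp only: wdot_def sum.distrib)
    also have "(\<Sum>j<n. if j \<in> S then y j * x j else 0) = sum (\<lambda>j. y j * x j) ({..<n} \<inter> S)"
      by (rule sum.inter_restrict[symmetric]) simp
    also have "{..<n} \<inter> S = S" using S by blast
    finally show ?thesis .
  qed
  have "\<exists>M. weighted_projector n ?D A M"
  proof (rule ex_weighted_projector[OF gen])
    fix x assume x: "vec n x \<in> A" and orth: "\<forall>a\<in>A. wdot n ?D (($) a) x = 0"
    have zero: "x i = 0" if i: "i \<in> S" for i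
    proof -
      have "wdot n (\<lambda>_. 1) (b i) (($) (vec n x)) = 0" using b[OF i] x hull by blast
      moreover have "wdot n (\<lambda>_. 1) (b i) (($) (vec n x)) = wdot n (\<lambda>_. 1) (b i) x"
        by (intro wdot_cong) auto
      moreover have "wdot n ?D (b i) x = wdot n ?D (($) (vec n (b i))) x"
        by (intro wdot_cong) auto
      moreover have "vec n (b i) \<in> A" using b[OF i] hull by blast
      ultimately have "(\<Sum>j\<in>S. b i j * x j) = 0" using split[of "b i" x] orth by simp
      also have "(\<Sum>j\<in>S. b i j * x j) = (\<Sum>j\<in>S. if j = i then x i else 0)"
        using unit[OF i] by (intro sum.cong) auto
      also have "\<dots> = x i" using i finite_subset[OF S] by simp
      finally show ?thesis .
    qed
    have "wdot n (\<lambda>_. 1) x (($) a) = 0" if "a \<in> A" for a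
      using split[of "($) a" x] orth that zero by (simp add: wdot_commute[of _ _ x])
    then have "vec n x \<in> code_hull n A" using x hull by blast
    then show "\<forall>j<n. x j = 0" using vanish zero by blast
  qed
  moreover have "card S = code_dim n (code_hull n A)"
    by (rule card_information_set[OF gen S, of b]) (fact b unit vanish)+
  ultimately show thesis using that[OF S] by blast
qed

section \<open>The exponent of matrix multiplication is at least 2\<close>

text \<open>One operation writes at most one cell. The lower bound 2 on the exponent rests on this
  count.\<close>

lemma exec_card_changed:
  "exec gi GI c s t s' \<Longrightarrow>
    finite {(i, j). ent s' M i j \<noteq> ent s M i j} \<and> card {(i, j). ent s' M i j \<noteq> ent s M i j} \<le> t"
proof (induction rule: exec.induct)
  case (exec_FSet M' e1 e2 f s)
  let ?s = "s\<lparr>ent := (ent s)(M' := (ent s M')(ival e1 s :=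
      (ent s M' (ival e1 s))(ival e2 s := fval f s)))\<rparr>"
  have sub: "{(i, j). ent ?s M i j \<noteq> ent s M i j} \<subseteq> {(ival e1 s, ival e2 s)}"
    by (auto split: if_splits)
  show ?case using finite_subset[OF sub] card_mono[OF _ sub] by simp
next
  case (exec_Seq c1 s t1 s1 c2 t2 s2)
  let ?D = "\<lambda>s s'. {(i, j). ent s' M i j \<noteq> ent s M i j}"
  have sub: "?D s s2 \<subseteq> ?D s s1 \<union> ?D s1 s2" by auto
  have "card (?D s s2) \<le> card (?D s s1) + card (?D s1 s2)"
    using card_mono[OF _ sub] card_Un_le[of "?D s s1" "?D s1 s2"] exec_Seq.IH by auto
  then show ?case using finite_subset[OF sub] exec_Seq.IH by auto
next
  case (exec_LoopTrue b s c t1 s1 t2 s2)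
  let ?D = "\<lambda>s s'. {(i, j). ent s' M i j \<noteq> ent s M i j}"
  have sub: "?D s s2 \<subseteq> ?D s s1 \<union> ?D s1 s2" by auto
  have "card (?D s s2) \<le> card (?D s s1) + card (?D s1 s2)"
    using card_mono[OF _ sub] card_Un_le[of "?D s s1" "?D s1 s2"] exec_LoopTrue.IH by auto
  then show ?case using finite_subset[OF sub] exec_LoopTrue.IH by auto
qed auto

lemma oracle_free_For [simp]: "oracle_free (For x e c) \<longleftrightarrow> oracle_free c"
  by (simp add: For_def)

text \<open>Schoolbook multiplication shows that the set of admissible exponents is nonempty,
  without which nothing could be said about its infimum.\<close>

lemma matmul_in_time_3: "matmul_in_time TYPE('a::field) 3"
  unfolding matmul_in_time_def
proof (intro exI[of _ "Sum_matrix 2 numN (FMul (Entry 0 (V 5) (V 6)) (Entry 1 (V 6) (V 7)))"]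
    exI[of _ "200 :: real"] conjI allI impI ballI)
  let ?f = "FMul (Entry 0 (V 5) (V 6)) (Entry 1 (V 6) (V 7))"
  show "oracle_free (Sum_matrix 2 numN ?f)" by (simp add: Sum_matrix_def Sum_def)
  fix n :: nat and A B :: "'a mat"
  assume n: "1 \<le> n" and A: "A \<in> carrier_mat n n" and B: "B \<in> carrier_mat n n"
  let ?s = "input [n] [A, B]"
  have e: "ent ?s 0 i j = A $$ (i, j)" "ent ?s 1 i j = B $$ (i, j)" if "i < n" "j < n" for i j
    using that A B by (simp_all add: input_def)
  have "run (\<lambda>_ _. False) (\<lambda>_. 0) (Sum_matrix 2 numN ?f) ?s
      (n * (n * (n * (50 + fcost ?f + 2 * icost numN) + 30) + 30))
      (\<lambda>s. \<forall>i<n. \<forall>j<n. ent s 2 i j = (\<Sum>r<n. ent ?s 0 i r * ent ?s 1 r j))"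
    by (rule run_Sum_matrix) (use n in \<open>auto simp: unchanged_def input_def\<close>)
  then obtain t s where ex: "exec (\<lambda>_ _. False) (\<lambda>_. 0) (Sum_matrix 2 numN ?f) ?s t s"
    and t: "t \<le> n * (n * (n * (50 + fcost ?f + 2 * icost numN) + 30) + 30)"
    and s: "\<forall>i<n. \<forall>j<n. ent s 2 i j = (\<Sum>r<n. ent ?s 0 i r * ent ?s 1 r j)"
    unfolding run_def by blast
  have "read_mat s 2 n n = A * B"
  proof (rule eq_matI)
    fix i j assume "i < dim_row (A * B)" "j < dim_col (A * B)"
    then have ij: "i < n" "j < n" using A B by auto
    have "(\<Sum>r<n. ent ?s 0 i r * ent ?s 1 r j) = (\<Sum>r<n. A $$ (i, r) * B $$ (r, j))"
      using e ij by (intro sum.cong) auto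
    then show "read_mat s 2 n n $$ (i, j) = (A * B) $$ (i, j)"
      using s ij A B by (simp add: read_mat_def scalar_prod_def atLeast0LessThan)
  qed (use A B in \<open>auto simp: read_mat_def\<close>)
  moreover have "real t \<le> 200 * real n powr 3"
  proof -
    have "n \<le> n ^ 3" "n ^ 2 \<le> n ^ 3"
      using n power_increasing[of 1 3 n] power_increasing[of 2 3 n] by simp_all
    moreover have "n * (n * (n * (50 + fcost ?f + 2 * icost numN) + 30) + 30) =
        30 * n + 30 * n ^ 2 + (50 + fcost ?f + 2 * icost numN) * n ^ 3"
      by (simp add: algebra_simps power2_eq_square power3_eq_cube)
    moreover have "50 + fcost ?f + 2 * icost numN \<le> 100" by simp
    then have "(50 + fcost ?f + 2 * icost numN) * n ^ 3 \<le> 100 * n ^ 3" by (rule mult_le_mono1)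
    ultimately have "t \<le> 200 * n ^ 3" using t by linarith
    then have "real t \<le> real (200 * n ^ 3)" by (rule of_nat_mono)
    then show ?thesis using n by (simp add: powr_numeral)
  qed
  ultimately show "\<exists>t s. exec (\<lambda>_ _. False) (\<lambda>_. 0) (Sum_matrix 2 numN ?f) ?s t s \<and>
      read_mat s 2 n n = A * B \<and> real t \<le> 200 * real n powr 3"
    using ex by blast
qed

text \<open>Multiplying the identity by the all-ones matrix turns n^2 cells of the output array from
  0 into 1, which takes n^2 operations.\<close>

lemma matmul_in_time_ge_2:
  assumes "matmul_in_time TYPE('a::field) \<tau>"
  shows "2 \<le> \<tau>"
proof (rule ccontr)
  assume \<tau>: "\<not> 2 \<le> \<tau>"
  obtain c C where c: "\<And>n (A :: 'a mat) B. 1 \<le> n \<Longrightarrow> A \<in> carrier_mat n n \<Longrightarrow> B \<in> carrier_mat n n \<Longrightarrow>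
      \<exists>t s. exec (\<lambda>_ _. False) (\<lambda>_. 0) c (input [n] [A, B]) t s \<and>
        read_mat s 2 n n = A * B \<and> real t \<le> C * real n powr \<tau>"
    using assms unfolding matmul_in_time_def by blast
  have bound: "real n ^ 2 \<le> C * real n powr \<tau>" if n: "1 \<le> n" for n
  proof -
    let ?J = "mat n n (\<lambda>_. 1) :: 'a mat"
    obtain t s where ex: "exec (\<lambda>_ _. False) (\<lambda>_. 0) c (input [n] [1\<^sub>m n, ?J]) t s"
      and s: "read_mat s 2 n n = 1\<^sub>m n * ?J" and t: "real t \<le> C * real n powr \<tau>"
      using c[OF n, of "1\<^sub>m n" ?J] by auto
    let ?D = "{(i, j). ent s 2 i j \<noteq> ent (input [n] [1\<^sub>m n, ?J]) 2 i j}"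
    have "ent s 2 i j = 1" if "i < n" "j < n" for i j
      using arg_cong[OF s, of "\<lambda>X. X $$ (i, j)"] that by (simp add: read_mat_def)
    then have "{..<n} \<times> {..<n} \<subseteq> ?D" by (auto simp: input_def)
    then have "card ({..<n} \<times> {..<n}) \<le> card ?D"
      using exec_card_changed[OF ex, of 2] by (intro card_mono) blast+
    also have "\<dots> \<le> t" using exec_card_changed[OF ex, of 2] by blast
    finally have "real (n * n) \<le> real t" by (intro of_nat_mono) simp
    moreover have "real n ^ 2 = real (n * n)" by (simp add: power2_eq_square)
    ultimately show ?thesis using t by linarith
  qed
  \<comment> \<open>The solution of x^(2 - \<tau>) = |C| + 1; at any n above it the bound n^2 \<le>
    C n^\<tau> breaks down.\<close>
  define x where "x = (\<bar>C\<bar> + 1) powr (1 / (2 - \<tau>))"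
  define n where "n = nat \<lceil>x\<rceil>"
  have x: "0 < x" by (simp add: x_def)
  have xn: "x \<le> real n" using x by (simp add: n_def)
  have n: "1 \<le> n" using x xn by (cases n) auto
  have "\<bar>C\<bar> + 1 = x powr (2 - \<tau>)" using \<tau> by (simp add: x_def powr_powr)
  also have "\<dots> \<le> real n powr (2 - \<tau>)" using x xn \<tau> by (intro powr_mono2) auto
  finally have "(\<bar>C\<bar> + 1) * real n powr \<tau> \<le> real n powr (2 - \<tau>) * real n powr \<tau>"
    by (rule mult_right_mono) simp
  also have "\<dots> = real n ^ 2" using n by (simp add: powr_add[symmetric] powr_numeral)
  also have "\<dots> \<le> C * real n powr \<tau>" by (rule bound[OF n])
  finally have "\<bar>C\<bar> + 1 \<le> C" using n by simp
  then show False by simp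
qed

lemma matmul_exponent_ge_2: "2 \<le> matmul_exponent TYPE('a::field)"
  unfolding matmul_exponent_def
  by (rule cInf_greatest) (use matmul_in_time_3 matmul_in_time_ge_2 in auto)

section \<open>Correctness and running time\<close>

lemma Suc_power_le_exp:
  assumes "l \<le> n" "1 \<le> n"
  shows "real (Suc n ^ l) \<le> exp 1 * real n ^ l"
proof -
  have "real (Suc n ^ l) = (1 + 1 / real n) ^ l * real n ^ l"
    using assms by (simp add: power_mult_distrib[symmetric] field_simps)
  also have "(1 + 1 / real n) ^ l \<le> exp (1 / real n) ^ l"
    by (intro power_mono exp_ge_add_one_self) simp
  also have "\<dots> = exp (real l / real n)" by (simp add: exp_of_nat_mult[symmetric])
  also have "\<dots> \<le> exp 1" using assms by simp
  finally show ?thesis by (simp add: mult_right_mono)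
qed

text \<open>The search does not touch the answer cell, which is therefore still 0 when the scan
  begins. Of the length found for \<open>A\<close> only \<open>l \<le> h\<close> is used.\<close>

lemma run_search_scan:
  fixes gi :: "'a::field mat \<Rightarrow> 'a mat \<Rightarrow> bool"
  assumes gi: "decides_graph_isomorphism gi" and n: "1 \<le> n"
    and A: "generator_matrix n A GA" and B: "generator_matrix n B GB"
  defines "h \<equiv> code_dim n (code_hull n A)"
  shows "h \<le> n" "run gi GI (Seq search scan) (input [n, dim_row GA, dim_row GB] [GA, GB])
    (Suc n ^ h * (6000 * n ^ 3 + GI n)) (\<lambda>s. accepts s \<longleftrightarrow> permutation_equivalent n A B)"
proof -
  let ?s = "input [n, dim_row GA, dim_row GB] [GA, GB]"
  have dim: "dim_col GA = n" "dim_col GB = n" using A B by (auto simp: generator_matrix_def)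
  have s: "idx ?s 0 0 = n" "idx ?s 0 1 = dim_row GA" "idx ?s 0 2 = dim_row GB" "idx ?s 1 0 = 0"
    "idx ?s 2 = (\<lambda>_. 0)" "idx ?s 3 0 = 0"
    by (auto simp: input_def)
  have genA: "generates n (dim_row GA) (ent ?s 0) A" and kA: "dim_row GA \<le> n"
    using generates_generator_matrix[OF A, of "ent ?s 0"] dim by (auto simp: input_def)
  have genB: "generates n (dim_row GB) (ent ?s 1) B" and kB: "dim_row GB \<le> n"
    using generates_generator_matrix[OF B, of "ent ?s 1"] dim by (auto simp: input_def)
  obtain S M where S: "S \<subseteq> {..<n}" "card S = h"
    and M: "weighted_projector n (\<lambda>j. if j \<in> S then 0 else 1) A M"
    using ex_removal_set[OF genA] unfolding h_def by blast
  show h: "h \<le> n" using card_mono[OF _ S(1)] S(2) by simp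
  obtain v where v: "v < Suc n ^ h" "\<And>j. (weights n v j :: 'a) = (if j \<in> S then 0 else 1)"
    using ex_weights[OF S(1), of h] S(2) by auto
  have Mv: "weighted_projector n (weights n v) A M"
    using weighted_projector_weights_cong[of n "weights n v" "\<lambda>j. if j \<in> S then 0 else 1"] v(2) M by blast
  have "run gi GI (Seq search scan) ?s
      (Suc n ^ h * (3000 * n ^ 3) + Suc n ^ h * (3000 * n ^ 3 + GI n))
      (\<lambda>s. accepts s \<longleftrightarrow> permutation_equivalent n A B)"
  proof (rule run_Seq)
    show "run gi GI search ?s (Suc n ^ h * (3000 * n ^ 3))
      (\<lambda>s'. \<exists>u l. u < Suc n ^ l \<and> l \<le> h \<and> idx s' 3 0 = l \<and> idx s' 2 = (\<lambda>i. digit (Suc n) i u) \<and>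
        weighted_projector n (weights n u) A (ent s' 2))"
      using run_search[OF s(1,2) kA _ s(5,6) genA v(1) h Mv] n by simp
  next
    fix s1 :: "'a state"
    assume "\<exists>u l. u < Suc n ^ l \<and> l \<le> h \<and> idx s1 3 0 = l \<and> idx s1 2 = (\<lambda>i. digit (Suc n) i u) \<and>
        weighted_projector n (weights n u) A (ent s1 2)" and un: "unchanged search ?s s1"
    then obtain u l where u: "u < Suc n ^ l" and l: "l \<le> h" "idx s1 3 0 = l"
      and T: "idx s1 2 = (\<lambda>i. digit (Suc n) i u)" and K: "weighted_projector n (weights n u) A (ent s1 2)"
      by blast
    have v1: "idx s1 0 = idx ?s 0" "idx s1 1 = idx ?s 1" "ent s1 1 = ent ?s 1"
      using un by (auto simp: unchanged_def)
    have K': "read_mat s1 2 n n = mat n n (\<lambda>(i, j). ent s1 2 i j)" by (simp add: read_mat_def)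
    have "run gi GI scan s1 (Suc n ^ l * (3000 * n ^ 3 + GI n))
        (\<lambda>s'. idx s' 1 0 = 1 \<longleftrightarrow> (\<exists>v<Suc n ^ l. matching n (read_mat s1 2 n n) B v))"
    proof (rule run_scan[OF gi])
      show "weighted_graph n (read_mat s1 2 n n)"
        unfolding K' by (rule weighted_projector_graph[OF K])
      show "generates n (dim_row GB) (ent s1 1) B" using genB v1 by simp
      show "idx s1 0 0 = n" "idx s1 0 2 = dim_row GB" "idx s1 1 0 = 0" using s v1 by simp_all
    qed (use T l u h kB n in auto)
    then show "run gi GI scan s1 (Suc n ^ h * (3000 * n ^ 3 + GI n))
        (\<lambda>s. accepts s \<longleftrightarrow> permutation_equivalent n A B)"
    proof (rule run_mono)
      show "Suc n ^ l * (3000 * n ^ 3 + GI n) \<le> Suc n ^ h * (3000 * n ^ 3 + GI n)"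
        using l(1) by (intro mult_le_mono1 power_increasing) auto
    qed (simp add: accepts_def K' matching_iff_permutation_equivalent[OF genA K u genB])
  qed
  then show "run gi GI (Seq search scan) ?s (Suc n ^ h * (6000 * n ^ 3 + GI n))
      (\<lambda>s. accepts s \<longleftrightarrow> permutation_equivalent n A B)"
    by (rule run_mono) (simp_all add: algebra_simps)
qed

text \<open>With a literal factor h the bound would be 0 for codes with trivial hull, hence
  \<open>max 1 h\<close>. Codes are presented to the machine by generator matrices, whose numbers of
  rows belong to the input.\<close>

theorem theorem3:
  fixes gi :: "'a::field mat \<Rightarrow> 'a mat \<Rightarrow> bool" and GI :: "nat \<Rightarrow> nat"
  assumes "decides_graph_isomorphism gi" and "\<And>n. GI n \<ge> 1"
  shows "\<exists>prog C. \<forall>n \<ge> 1. \<forall>h A B G\<^sub>A G\<^sub>B.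
           linear_code n A \<longrightarrow> linear_code n B \<longrightarrow>
           code_dim n (code_hull n A) = h \<longrightarrow> code_dim n (code_hull n B) = h \<longrightarrow>
           generator_matrix n A G\<^sub>A \<longrightarrow> generator_matrix n B G\<^sub>B \<longrightarrow>
           (\<exists>t s. exec gi GI prog (input [n, dim_row G\<^sub>A, dim_row G\<^sub>B] [G\<^sub>A, G\<^sub>B]) t s \<and>
              (accepts s \<longleftrightarrow> permutation_equivalent n A B) \<and>
              real t \<le> C * real (max 1 h) *
                real n powr (matmul_exponent TYPE('a) + real h + 1) * real (GI n))"
proof (intro exI[of _ "Seq search scan"] exI[of _ "6001 * exp 1 :: real"] allI impI)
  fix n h :: nat and A B :: "'a vec set" and GA GB :: "'a mat"
  assume n: "1 \<le> n" and hA: "code_dim n (code_hull n A) = h"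
    and gA: "generator_matrix n A GA" and gB: "generator_matrix n B GB"
  let ?\<omega> = "matmul_exponent TYPE('a)"
  have h: "h \<le> n" using run_search_scan(1)[OF assms(1) n gA gB] hA by simp
  obtain t s where ex: "exec gi GI (Seq search scan) (input [n, dim_row GA, dim_row GB] [GA, GB]) t s"
    and t: "t \<le> Suc n ^ h * (6000 * n ^ 3 + GI n)"
    and acc: "accepts s \<longleftrightarrow> permutation_equivalent n A B"
    using run_search_scan(2)[OF assms(1) n gA gB, of GI] hA unfolding run_def by auto
  \<comment> \<open>A call costs at least 1, which turns the sum of elimination time and oracle time
    into a product.\<close>
  have "6000 * n ^ 3 \<le> 6000 * (n ^ 3 * GI n)" "GI n \<le> n ^ 3 * GI n"
    using n assms(2)[of n] by simp_all
  then have "6000 * n ^ 3 + GI n \<le> 6001 * (n ^ 3 * GI n)" by linarith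
  with t have "t \<le> Suc n ^ h * (6001 * (n ^ 3 * GI n))" by (meson le_trans mult_le_mono2)
  then have "real t \<le> real (Suc n ^ h * (6001 * (n ^ 3 * GI n)))" by (rule of_nat_mono)
  also have "\<dots> = real (Suc n ^ h) * (6001 * (real n ^ 3 * real (GI n)))"
    by (simp only: of_nat_mult of_nat_power of_nat_numeral)
  also have "\<dots> \<le> (exp 1 * real n ^ h) * (6001 * (real n ^ 3 * real (GI n)))"
    using Suc_power_le_exp[OF h n] by (intro mult_right_mono) auto
  \<comment> \<open>The factor 1 and the exponent written as 2 + h + 1 prepare a comparison factor
    by factor with \<open>max 1 h\<close> and with \<omega> in place of 2.\<close>
  also have "\<dots> = 6001 * exp 1 * 1 * real n powr (2 + real h + 1) * real (GI n)"
    using n by (simp add: powr_add powr_realpow powr_numeral power2_eq_square power3_eq_cube)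
  also have "\<dots> \<le> 6001 * exp 1 * real (max 1 h) * real n powr (?\<omega> + real h + 1) * real (GI n)"
    using n matmul_exponent_ge_2[where 'a = 'a] by (intro mult_right_mono mult_mono powr_mono) auto
  finally show "\<exists>t s. exec gi GI (Seq search scan) (input [n, dim_row GA, dim_row GB] [GA, GB]) t s \<and>
      (accepts s \<longleftrightarrow> permutation_equivalent n A B) \<and>
      real t \<le> 6001 * exp 1 * real (max 1 h) * real n powr (?\<omega> + real h + 1) * real (GI n)"
    using ex acc by blast
qed

end
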